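(* Let $F:U\to\mathbb C^n$ be a nonconstant holomorphic map defined in a domain $U\subset\mathbb C$ containing a compact interval $I\subset\mathbb R$ such that $F(I)\subset\mathbb R^n$. Then there exist nonconstant holomorphic maps $h:D\to\mathbb C$, where $D\Subset U$ is a domain containing $I$, and $G:h(D)\to\mathbb C^n$ such that (1) $F|_D=G\circ h$; (2) $h(I)\subset\mathbb S:=\{z\in\mathbb C : |z|=1\}$; (3) $G$ is injective outside a finite subset of $h(D)$. If also $F|_{D_1}=G_1\circ h_1$ for some holomorphic maps $h_1:D_1\to\mathbb C$ of a domain $D_1\Subset U$ containing $I$ and $G_1:h_1(D_1)\to\mathbb C^n$, then there exists a holomorphic map $q:h_1(D\cap D_1)\to h(D)$ such that $h=q\circ h_1$ on $D\cap D_1$ and $G_1=G\circ q$ on $h_1(D\cap D_1)$.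
   Context: $D\Subset U$ means that $D$ is relatively compact in $U$. A domain is a nonempty connected open set. "$G$ is injective outside a finite subset of $h(D)$" means that there is a finite set $E\subset h(D)$ such that $G|_{h(D)\setminus E}$ is injective. *)

theory Defs
  imports "HOL-Complex_Analysis.Complex_Analysis"
begin

definition complex_domain :: "complex set \<Rightarrow> bool" where
  "complex_domain D \<longleftrightarrow> D \<noteq> {} \<and> open D \<and> connected D"

definition relatively_compact_in :: "complex set \<Rightarrow> complex set \<Rightarrow> bool"
    (infix "\<Subset>" 50) where
  "D \<Subset> U \<longleftrightarrow> compact (closure D) \<and> closure D \<subseteq> U"

text \<open>The library notion \<open>holomorphic_on\<close> is for scalar-valued functions; a map into
  \<open>complex ^ 'n\<close> is holomorphic if all its components are.\<close>

definition vec_holomorphic_on :: "(complex \<Rightarrow> complex ^ 'n) \<Rightarrow> complex set \<Rightarrow> bool"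
    (infixl "vec'_holomorphic'_on" 50) where
  "F vec_holomorphic_on S \<longleftrightarrow> (\<forall>i. (\<lambda>z. F z $ i) holomorphic_on S)"

definition real_vectors :: "(complex ^ 'n) set" where
  "real_vectors = {v. \<forall>i. v $ i \<in> \<real>}"

definition real_interval :: "real \<Rightarrow> real \<Rightarrow> complex set" where
  "real_interval a b = complex_of_real ` {a..b}"

definition inj_outside_finite :: "('a \<Rightarrow> 'b) \<Rightarrow> 'a set \<Rightarrow> bool" where
  "inj_outside_finite G W \<longleftrightarrow> (\<exists>E. finite E \<and> E \<subseteq> W \<and> inj_on G (W - E))"

end

theory Submission
  imports Defs
begin

text \<open>
  Along the interval the values of \<open>F\<close> move on a real-analytic curve: they may turn back, run
  several times around a closed curve, and pass through cusps and self-intersections.  The map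
  \<open>h\<close> records the position on that curve in an analytic parameter, and \<open>G\<close> is the curve itself.

  Local parameters.  Consider all functions that are analytic near the interval, real on it unless it
  is a single point, and determined by the value of \<open>F\<close> off a finite set (\<open>determined_near\<close>).  At a point \<open>t\<close> let \<open>m\<close> be such a
  function with the least positive order of vanishing \<open>k\<close>.  Dividing orders as in Euclid's
  algorithm shows that all orders are multiples of \<open>k\<close>, and therefore every function of the
  class is locally a function of \<open>m\<close> (\<open>generator_of_local_functions\<close>).  If the interval is a
  single point, \<open>h = 1 + m\<close> already has all the required properties (\<open>factorization_at_point\<close>).

  A global parameter.  The arc length of \<open>F\<close> is a local parameter except at cusps such as
  \<open>(t\<^sup>2, t\<^sup>3)\<close>.  Adding to the components of \<open>F\<close> the generators at the finitely many critical points
  of one component gives a finite family that is still determined by \<open>F\<close> and whose common curve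
  is immersed.  Its arc length \<open>\<theta>\<close> is unique up to sign and an additive constant, so local choices can be
  glued along the interval, and the family becomes \<open>\<Gamma> \<circ> \<theta>\<close> with \<open>\<Gamma>\<close> of unit speed
  (\<open>unit_speed_factorization_exists\<close>).  Folds of the curve are absorbed in \<open>\<theta>\<close>.

  Coincidences of a unit-speed curve.  If solutions of \<open>\<Gamma> s = \<Gamma> s'\<close> accumulate at a pair of
  points, then there \<open>s'\<close> is an isometric function of \<open>s\<close>.  A reflection would force the
  velocity to vanish at its centre, so only translations remain, and these are the multiples of one
  period \<open>L\<close> (\<open>fundamental_period\<close>).  All other coincidences are isolated, and by compactness finite in
  number (\<open>finitely_many_coincidences\<close>).  Thus \<open>h = exp (2 \<pi> \<i> \<theta> / L)\<close> identifies exactly the points that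
  \<open>\<Gamma>\<close> identifies up to a finite set, and takes the interval into the unit circle; if there is no
  period, any \<open>L\<close> larger than the length of the parameter interval will do.

  Universality.  If \<open>F = G\<^sub>1 \<circ> h\<^sub>1\<close>, then \<open>h\<close> is constant on the fibres of \<open>h\<^sub>1\<close>: this is clear
  where \<open>G\<close> is injective, and it extends to the exceptional values because \<open>h\<^sub>1\<close> is open
  (\<open>injective_factorization_universal\<close>).
\<close>

section \<open>Factoring one holomorphic function through another\<close>

definition nowhere_locally_constant_on :: "(complex \<Rightarrow> 'a) \<Rightarrow> complex set \<Rightarrow> bool" where
  "nowhere_locally_constant_on h S \<longleftrightarrow>
     (\<forall>X. open X \<and> X \<noteq> {} \<and> X \<subseteq> S \<longrightarrow> \<not> h constant_on X)"

lemma nowhere_locally_constant_on_subset: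
  "nowhere_locally_constant_on h S \<Longrightarrow> T \<subseteq> S \<Longrightarrow> nowhere_locally_constant_on h T"
  unfolding nowhere_locally_constant_on_def by (meson order_trans)

lemma nowhere_locally_constant_on_connected:
  assumes "f holomorphic_on S" "open S" "connected S" "\<not> f constant_on S"
  shows "nowhere_locally_constant_on f S"
  unfolding nowhere_locally_constant_on_def
proof (intro allI impI notI; elim conjE)
  fix X assume X: "open X" "X \<subseteq> S" "f constant_on X" "X \<noteq> {}"
  then obtain c where c: "\<And>y. y \<in> X \<Longrightarrow> f y = c"
    by (auto simp: constant_on_def)
  have "f z = c" if "z \<in> S" for z
    using analytic_continuation_open[of X S f "\<lambda>_. c" z] X c assms that by auto
  then show False
    using assms(4) by (auto simp: constant_on_def)
qed

lemma open_image_nowhere_locally_constant: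
  assumes "h holomorphic_on S" "open S" "nowhere_locally_constant_on h S" "open X" "X \<subseteq> S"
  shows "open (h ` X)"
  using open_mapping_thm2[OF assms(1,2,4,5)] assms(3)
  unfolding nowhere_locally_constant_on_def by blast

lemma holomorphic_local_inverse:
  assumes "f holomorphic_on S" "open S" "z \<in> S" "deriv f z \<noteq> 0"
  obtains r \<psi> where "r > 0" "ball z r \<subseteq> S" "inj_on f (ball z r)" "open (f ` ball z r)"
    "\<psi> holomorphic_on f ` ball z r" "\<And>x. x \<in> ball z r \<Longrightarrow> \<psi> (f x) = x"
    "\<And>x. x \<in> ball z r \<Longrightarrow> deriv f x * deriv \<psi> (f x) = 1"
proof -
  obtain r where r: "r > 0" "ball z r \<subseteq> S" "open (f ` ball z r)" "inj_on f (ball z r)"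
    using has_complex_derivative_locally_invertible[OF assms(1,3,2,4)] by metis
  have "f holomorphic_on ball z r" using assms(1) r(2) by (rule holomorphic_on_subset)
  then obtain g where "g holomorphic_on f ` ball z r"
     "\<And>x. x \<in> ball z r \<Longrightarrow> deriv f x * deriv g (f x) = 1" "\<And>x. x \<in> ball z r \<Longrightarrow> g (f x) = x"
    using holomorphic_has_inverse[OF _ open_ball r(4)] by metis
  with r show thesis by (intro that[of r g]) auto
qed

text \<open>
  The derivative is not identically zero near any point, so its zeros are isolated.
\<close>
lemma isolated_critical_point:
  assumes h: "h holomorphic_on S" "open S" "nowhere_locally_constant_on h S" "z \<in> S"
  obtains r where "r > 0" "ball z r \<subseteq> S" "\<And>x. x \<in> ball z r - {z} \<Longrightarrow> deriv h x \<noteq> 0"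
proof -
  obtain r where r: "r > 0" "ball z r \<subseteq> S"
    using assms(2,4) open_contains_ball by blast
  have hol: "h holomorphic_on ball z r" using h(1) r(2) by (rule holomorphic_on_subset)
  have dhol: "deriv h holomorphic_on ball z r" by (intro holomorphic_deriv hol) auto
  have nc: "\<not> h constant_on ball z r"
    using h(3) r unfolding nowhere_locally_constant_on_def by (metis centre_in_ball empty_iff open_ball)
  have "\<exists>b\<in>ball z r. deriv h b \<noteq> 0"
  proof (rule ccontr)
    assume "\<not> ?thesis"
    then have "\<And>x. x \<in> ball z r \<Longrightarrow> (h has_field_derivative 0) (at x)"
      using hol holomorphic_derivI[OF hol open_ball] by (metis)
    then have "\<exists>c. \<forall>x\<in>ball z r. h x = c"
      by (intro has_field_derivative_zero_constant) (auto intro: has_field_derivative_at_within)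
    then have "h constant_on ball z r" by (simp add: constant_on_def)
    with nc show False by simp
  qed
  then obtain b where b: "b \<in> ball z r" "deriv h b \<noteq> 0" by blast
  show thesis
  proof (cases "deriv h z = 0")
    case True
    then obtain s where "0 < s" "ball z s \<subseteq> ball z r" "\<And>x. x \<in> ball z s - {z} \<Longrightarrow> deriv h x \<noteq> 0"
      using isolated_zeros[OF dhol open_ball connected_ball _ True b] r(1) by (metis centre_in_ball)
    then show thesis using r by (intro that[of s]) auto
  next
    case False
    have "continuous_on (ball z r) (deriv h)" using dhol by (rule holomorphic_on_imp_continuous_on)
    then have "open (ball z r \<inter> deriv h -` (- {0}))"
      by (intro continuous_open_preimage) auto
    moreover have "z \<in> ball z r \<inter> deriv h -` (- {0})" using False r by simp
    ultimately obtain s where "s > 0" "ball z s \<subseteq> ball z r \<inter> deriv h -` (- {0})"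
      using open_contains_ball by blast
    then show thesis using r by (intro that[of s]) auto
  qed
qed

text \<open>
  The factor is well defined by the assumption on fibres and continuous because \<open>h\<close> is open.  It
  is holomorphic at values of regular points, where \<open>h\<close> has a local inverse; near a given point all others
  are regular, so the value at a critical point is a removable singularity.
\<close>
lemma holomorphic_factor_through:
  assumes h: "h holomorphic_on S" "open S" "nowhere_locally_constant_on h S"
    and f: "f holomorphic_on S"
    and fibres: "\<And>z z'. z \<in> S \<Longrightarrow> z' \<in> S \<Longrightarrow> h z = h z' \<Longrightarrow> f z = f z'"
  obtains q where "q holomorphic_on h ` S" "\<And>z. z \<in> S \<Longrightarrow> q (h z) = f z"
proof -
  define q where "q w = f (SOME z. z \<in> S \<and> h z = w)" for w
  have q: "q (h z) = f z" if "z \<in> S" for z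
  proof -
    have "(SOME x. x \<in> S \<and> h x = h z) \<in> S \<and> h (SOME x. x \<in> S \<and> h x = h z) = h z"
      by (rule someI[of _ z]) (use that in simp)
    then show ?thesis
      unfolding q_def using fibres that by blast
  qed
  have contf: "continuous_on S f" and conth: "continuous_on S h"
    using f h(1) by (auto intro: holomorphic_on_imp_continuous_on)
  have openh: "open (h ` S)"
    by (rule open_image_nowhere_locally_constant[OF h]) (use h in auto)
  have contq: "continuous_on (h ` S) q"
  proof (rule continuous_on_open_invariant[THEN iffD2], safe)
    fix B :: "complex set" assume "open B"
    then have "open (S \<inter> f -` B)"
      using contf h(2) continuous_open_preimage by blast
    then have "open (h ` (S \<inter> f -` B))"
      by (rule open_image_nowhere_locally_constant[OF h]) auto
    moreover have "h ` (S \<inter> f -` B) \<inter> h ` S = q -` B \<inter> h ` S"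
      using q by auto
    ultimately show "\<exists>A. open A \<and> A \<inter> h ` S = q -` B \<inter> h ` S" by blast
  qed
  have diff: "q field_differentiable at (h z)" if z: "z \<in> S" "deriv h z \<noteq> 0" for z
  proof -
    obtain r \<psi> where r: "r > 0" "ball z r \<subseteq> S" "open (h ` ball z r)"
      "\<psi> holomorphic_on h ` ball z r" "\<And>x. x \<in> ball z r \<Longrightarrow> \<psi> (h x) = x"
      using holomorphic_local_inverse[OF h(1,2) z] by metis
    have "(\<lambda>w. f (\<psi> w)) holomorphic_on h ` ball z r"
      by (rule holomorphic_on_compose_gen[OF r(4) f, unfolded o_def]) (use r in auto)
    then have "q holomorphic_on h ` ball z r"
      by (rule holomorphic_transform) (use r q in force)
    then show ?thesis
      using r by (meson centre_in_ball holomorphic_on_imp_differentiable_at imageI)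
  qed
  have "q holomorphic_on h ` S"
  proof (rule holomorphic_on_open[THEN iffD2, OF openh], safe)
    fix z assume z: "z \<in> S"
    obtain r where r: "r > 0" "ball z r \<subseteq> S" "\<And>x. x \<in> ball z r - {z} \<Longrightarrow> deriv h x \<noteq> 0"
      using isolated_critical_point[OF h z] by blast
    have op: "open (h ` ball z r)"
      by (rule open_image_nowhere_locally_constant[OF h]) (use r in auto)
    have "q field_differentiable at w" if "w \<in> h ` ball z r - {h z}" for w
      using that diff r by blast
    then have "q holomorphic_on (h ` ball z r - {h z})"
      by (simp add: holomorphic_on_def field_differentiable_at_within)
    then have "q holomorphic_on h ` ball z r"
      using no_isolated_singularity[OF _ _ op, of q "{h z}"] continuous_on_subset[OF contq] r(2) by blast
    then show "\<exists>f'. (q has_field_derivative f') (at (h z))"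
      using op r(1) by (metis centre_in_ball holomorphic_derivI imageI)
  qed
  with q show thesis using that by blast
qed

text \<open>
  If \<open>h z\<close> and \<open>h z'\<close> differ, they still differ for points near \<open>z\<close> and \<open>z'\<close>.  The nearby points with a common
  value under the open map \<open>k\<close> fill an open set of values, but for each of them one of the two
  points is sent by \<open>h\<close> into the exceptional set \<open>E\<close>, which happens at only finitely many points near \<open>z\<close>
  and \<open>z'\<close>.
\<close>
lemma equal_fibres_of_equal_outside_finite:
  fixes G G\<^sub>1 :: "complex \<Rightarrow> 'a"
  assumes h: "h holomorphic_on D" "open D" "connected D" "\<not> h constant_on D"
    and k: "k holomorphic_on S" "open S" "nowhere_locally_constant_on k S" "S \<subseteq> D"
    and E: "finite E" "inj_on G (h ` D - E)"
    and eq: "\<And>z. z \<in> S \<Longrightarrow> G (h z) = G\<^sub>1 (k z)"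
    and zz: "z \<in> S" "z' \<in> S" "k z = k z'"
  shows "h z = h z'"
proof (rule ccontr)
  assume ne: "h z \<noteq> h z'"
  have conth: "continuous_on S h"
    using h(1) k(4) by (meson continuous_on_subset holomorphic_on_imp_continuous_on)
  obtain A B where AB: "open A" "open B" "h z \<in> A" "h z' \<in> B" "A \<inter> B = {}"
    using hausdorff[OF ne] by auto
  obtain r r' where r: "r > 0" "cball z r \<subseteq> D" "r' > 0" "cball z' r' \<subseteq> D"
    using h(2) k(4) zz open_contains_cball by (metis subsetD)
  define X Y where "X = (S \<inter> h -` A) \<inter> ball z r" and "Y = (S \<inter> h -` B) \<inter> ball z' r'"
  define Z where "Z = (\<Union>e\<in>E. {x\<in>cball z r \<union> cball z' r'. h x = e})"
  have "open (S \<inter> h -` A)" "open (S \<inter> h -` B)"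
    using AB by (auto intro: continuous_open_preimage[OF conth k(2)])
  then have XY: "open X" "open Y" "z \<in> X" "z' \<in> Y" "X \<subseteq> S" "Y \<subseteq> S"
    using AB zz r by (auto simp: X_def Y_def)
  have op: "open (k ` X \<inter> k ` Y)"
    using open_image_nowhere_locally_constant[OF k(1,2,3)] XY by auto
  have fin: "finite {x\<in>cball z r \<union> cball z' r'. h x - e = 0}" for e
    by (rule holomorphic_compact_finite_zeros[of _ D])
       (use h r in \<open>auto intro!: holomorphic_intros simp: constant_on_def algebra_simps\<close>)
  then have "finite Z"
    using E(1) by (auto simp: Z_def)
  moreover have "k ` X \<inter> k ` Y \<subseteq> k ` Z"
  proof
    fix w assume "w \<in> k ` X \<inter> k ` Y"
    then obtain x y where xy: "x \<in> X" "y \<in> Y" "w = k x" "w = k y" by blast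
    then have "G (h x) = G (h y)" "h x \<noteq> h y"
      using eq XY(5,6) AB(5) by (auto simp: X_def Y_def subset_iff)
    then have "h x \<in> E \<or> h y \<in> E"
      using E(2) xy XY(5,6) k(4) unfolding inj_on_def by blast
    then have "x \<in> Z \<or> y \<in> Z"
      using xy by (auto simp: Z_def X_def Y_def)
    with xy show "w \<in> k ` Z" by blast
  qed
  ultimately have "finite (k ` X \<inter> k ` Y)"
    by (meson finite_imageI finite_subset)
  then have "k ` X \<inter> k ` Y = {}"
    using op by (meson finite_imp_not_open)
  moreover have "k z \<in> k ` X \<inter> k ` Y"
    using XY zz(3) by (metis IntI imageI)
  ultimately show False by blast
qed

text \<open>
  Convexity is what makes analytic continuation single-valued below: intersections of convex
  neighbourhoods are connected.
\<close>
lemma convex_neighbourhood: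
  fixes K :: "complex set"
  assumes "compact K" "convex K" "open W" "K \<subseteq> W"
  obtains V where "open V" "convex V" "K \<subseteq> V" "V \<subseteq> W" "compact (closure V)" "closure V \<subseteq> W"
proof -
  obtain e where e: "e > 0" "(\<Union>x\<in>K. cball x e) \<subseteq> W"
    using compact_subset_open_imp_cball_epsilon_subset[OF assms(1,3,4)] by blast
  define V where "V = (\<Union>x\<in>K. \<Union>y\<in>ball 0 e. {x + y})"
  define C where "C = (\<Union>x\<in>K. \<Union>y\<in>cball 0 e. {x + y})"
  have "compact C"
    unfolding C_def using compact_sums'[OF assms(1) compact_cball] by simp
  have "V \<subseteq> C" by (auto simp: V_def C_def)
  then have cl: "closure V \<subseteq> C"
    using \<open>compact C\<close> by (simp add: closure_minimal compact_imp_closed)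
  have "C \<subseteq> W"
  proof
    fix z assume "z \<in> C"
    then obtain x y where "x \<in> K" "norm y \<le> e" "z = x + y" by (auto simp: C_def)
    then have "z \<in> cball x e" by (simp add: dist_norm)
    then show "z \<in> W" using e \<open>x \<in> K\<close> by blast
  qed
  show thesis
  proof (rule that[of V])
    show "open V" unfolding V_def by (intro open_sums) simp
    show "convex V" unfolding V_def by (intro convex_sums assms) simp
    show "K \<subseteq> V" using e by (force simp: V_def)
    show "V \<subseteq> W" using \<open>V \<subseteq> C\<close> \<open>C \<subseteq> W\<close> by blast
    show "compact (closure V)" using compact_Int_closed[OF \<open>compact C\<close> closed_closure[of V]] cl by (simp add: inf.absorb2)
    show "closure V \<subseteq> W" using cl \<open>C \<subseteq> W\<close> by blast
  qed
qed

section \<open>Orders of vanishing and local generators\<close>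

definition vanishes_to_order :: "(complex \<Rightarrow> complex) \<Rightarrow> complex \<Rightarrow> nat \<Rightarrow> bool" where
  "vanishes_to_order f t n \<longleftrightarrow>
     (\<exists>u. u analytic_on {t} \<and> u t \<noteq> 0 \<and> (\<forall>\<^sub>F z in nhds t. f z = (z - t) ^ n * u z))"

lemma analytic_at_nonzero_eventually:
  assumes "f analytic_on {t}" "f t \<noteq> (0::complex)"
  shows "\<forall>\<^sub>F z in nhds t. f z \<noteq> 0"
  using analytic_at_neq_imp_eventually_neq[OF assms] assms(2)
  by (simp add: eventually_nhds_conv_at)

lemma analytic_at_zero_factor:
  assumes "f analytic_on {t}" "f t = 0"
  obtains g where "g analytic_on {t}" "\<forall>\<^sub>F z in nhds t. f z = (z - t) * g z"
proof -
  obtain r where r: "r > 0" "f holomorphic_on ball t r"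
    using assms(1) by (auto simp: analytic_on_def)
  define g where "g z = (if z = t then deriv f t else (f z - f t) / (z - t))" for z
  have "g holomorphic_on ball t r"
    unfolding g_def using pole_lemma_open[OF r(2) open_ball] by simp
  then have "g analytic_on {t}" using r(1) by (auto simp: analytic_on_def)
  moreover have "f z = (z - t) * g z" for z
    using assms(2) by (simp add: g_def)
  ultimately show thesis using that by simp
qed

lemma analytic_at_zero_or_order:
  assumes "f analytic_on {t}"
  shows "(\<forall>\<^sub>F z in nhds t. f z = 0) \<or> (\<exists>n. vanishes_to_order f t n)"
proof -
  obtain r where r: "r > 0" "f holomorphic_on ball t r"
    using assms by (auto simp: analytic_on_def)
  consider "f t \<noteq> 0" | "f t = 0" "f constant_on ball t r" | "f t = 0" "\<not> f constant_on ball t r"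
    by blast
  then show ?thesis
  proof cases
    case 1
    then have "vanishes_to_order f t 0"
      unfolding vanishes_to_order_def using assms by auto
    then show ?thesis by blast
  next
    case 2
    then have "\<forall>z\<in>ball t r. f z = 0"
      using r(1) by (metis centre_in_ball constant_on_def)
    then show ?thesis
      using r(1) by (meson centre_in_ball eventually_nhds open_ball)
  next
    case 3
    then obtain g s n where g: "0 < s" "g holomorphic_on ball t s"
       "\<And>w. w \<in> ball t s \<Longrightarrow> f w = (w - t) ^ n * g w" "\<And>w. w \<in> ball t s \<Longrightarrow> g w \<noteq> 0"
      using holomorphic_factor_zero_nonconstant[OF r(2) open_ball connected_ball _ 3] r(1)
      by (metis centre_in_ball)
    have "vanishes_to_order f t n"
      unfolding vanishes_to_order_def
      using g by (intro exI[of _ g] conjI)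
        (auto simp: analytic_on_def eventually_nhds intro!: exI[of _ "ball t s"])
    then show ?thesis by blast
  qed
qed

text \<open>
  Take a \<open>k\<close>-th root of the nonvanishing factor \<open>u\<close>.  The root \<open>w\<close> of \<open>m\<close> is a local coordinate in which
  \<open>m\<close> is the power \<open>w\<^sup>k\<close>.
\<close>
lemma vanishes_to_order_root:
  assumes "vanishes_to_order m t k" "k > 0"
  obtains w where "w analytic_on {t}" "w t = 0" "deriv w t \<noteq> 0" "\<forall>\<^sub>F z in nhds t. m z = w z ^ k"
proof -
  obtain u where u: "u analytic_on {t}" "u t \<noteq> 0" "\<forall>\<^sub>F z in nhds t. m z = (z - t) ^ k * u z"
    using assms(1) unfolding vanishes_to_order_def by blast
  \<comment> \<open>Dividing by \<open>u t\<close> moves the values near 1, away from the branch cut of the logarithm.\<close>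
  define v where "v z = exp (Ln (u t) / k) * exp (Ln (u z / u t) / k)" for z
  have v: "v analytic_on {t}"
    unfolding v_def by (intro analytic_intros u analytic_on_compose_gen[of u _ Ln])
       (use u assms(2) in auto)
  have ev: "\<forall>\<^sub>F z in nhds t. u z \<noteq> 0"
    using analytic_at_nonzero_eventually u by blast
  have vk: "v z ^ k = u z" if "u z \<noteq> 0" for z
    using that u(2) assms(2) by (simp add: v_def power_mult_distrib flip: exp_of_nat_mult)
  define w where "w z = (z - t) * v z" for z
  have "(w has_field_derivative v t) (at t)"
  proof -
    have "(v has_field_derivative deriv v t) (at t)"
      using v by (simp add: analytic_on_imp_differentiable_at field_differentiable_derivI)
    then show ?thesis unfolding w_def by (auto intro!: derivative_eq_intros)
  qed
  then have "deriv w t \<noteq> 0"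
    using DERIV_imp_deriv by (fastforce simp: v_def)
  moreover have "w analytic_on {t}"
    unfolding w_def by (intro analytic_intros v)
  moreover have "\<forall>\<^sub>F z in nhds t. m z = w z ^ k"
    using ev u(3) by eventually_elim (simp add: w_def power_mult_distrib vk)
  ultimately show thesis
    using that[of w] by (simp add: w_def)
qed

text \<open>
  This is division with remainder on orders: quotients lower the order by \<open>k\<close> until it is \<open>0\<close> or \<open>k\<close>.
\<close>
lemma minimal_order_divides:
  assumes quot: "\<And>f g n p. f \<in> A \<Longrightarrow> g \<in> A \<Longrightarrow> vanishes_to_order f t n \<Longrightarrow>
      vanishes_to_order g t p \<Longrightarrow> p < n \<Longrightarrow> \<exists>h\<in>A. vanishes_to_order h t (n - p)"
    and m: "m \<in> A" "vanishes_to_order m t k" "k > 0"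
    and least: "\<And>f j. f \<in> A \<Longrightarrow> vanishes_to_order f t j \<Longrightarrow> 0 < j \<Longrightarrow> k \<le> j"
    and f: "f \<in> A" "vanishes_to_order f t n"
  shows "k dvd n"
  using f
proof (induction n arbitrary: f rule: less_induct)
  case (less n)
  show ?case
  proof (cases "n = 0 \<or> n = k")
    case False
    then have "k < n" using least less.prems by (metis le_neq_implies_less neq0_conv)
    then obtain h where "h \<in> A" "vanishes_to_order h t (n - k)"
      using quot less.prems m by blast
    then have "k dvd n - k" using less.IH[of "n - k" h] \<open>k < n\<close> m(3) by simp
    then show ?thesis using \<open>k < n\<close> by (simp add: dvd_minus_self)
  qed auto
qed

text \<open>
  Since every order that occurs is a multiple of \<open>k\<close>, leading terms can be removed one after
  another by subtracting multiples of powers of \<open>m\<close>.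
\<close>
lemma approximation_by_polynomials_in_generator:
  fixes A :: "(complex \<Rightarrow> complex) set"
  assumes an: "\<And>f. f \<in> A \<Longrightarrow> f analytic_on {t}"
    and lead: "\<And>f m l k. f \<in> A \<Longrightarrow> m \<in> A \<Longrightarrow> vanishes_to_order f t (l * k) \<Longrightarrow>
      vanishes_to_order m t k \<Longrightarrow> \<exists>c u. (\<lambda>z. f z - c * m z ^ l) \<in> A \<and> u analytic_on {t} \<and>
         (\<forall>\<^sub>F z in nhds t. f z - c * m z ^ l = (z - t) ^ Suc (l * k) * u z)"
    and m: "m \<in> A" "vanishes_to_order m t k"
    and dvd: "\<And>f n. f \<in> A \<Longrightarrow> vanishes_to_order f t n \<Longrightarrow> k dvd n"
    and f: "f \<in> A"
  shows "\<exists>p e u. e \<in> A \<and> u analytic_on {t} \<and> (\<forall>\<^sub>F z in nhds t. f z = poly p (m z) + e z) \<and>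
           (\<forall>\<^sub>F z in nhds t. e z = (z - t) ^ N * u z)"
proof (induction N)
  case 0
  show ?case
    by (rule exI[of _ 0], rule exI[of _ f], rule exI[of _ f]) (use f an in auto)
next
  case (Suc N)
  then obtain p e u where e: "e \<in> A" "u analytic_on {t}"
    "\<forall>\<^sub>F z in nhds t. f z = poly p (m z) + e z" "\<forall>\<^sub>F z in nhds t. e z = (z - t) ^ N * u z"
    by blast
  show ?case
  proof (cases "u t = 0")
    case True
    then obtain v where v: "v analytic_on {t}" "\<forall>\<^sub>F z in nhds t. u z = (z - t) * v z"
      using analytic_at_zero_factor[OF e(2)] by blast
    have "\<forall>\<^sub>F z in nhds t. e z = (z - t) ^ Suc N * v z"
      using e(4) v(2) by eventually_elim (simp add: algebra_simps)
    then show ?thesis using e v by blast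
  next
    case False
    then have "vanishes_to_order e t N"
      using e by (auto simp: vanishes_to_order_def)
    then obtain l where l: "N = l * k"
      using dvd[OF e(1)] by (metis dvd_def mult.commute)
    then obtain c v where v: "(\<lambda>z. e z - c * m z ^ l) \<in> A" "v analytic_on {t}"
       "\<forall>\<^sub>F z in nhds t. e z - c * m z ^ l = (z - t) ^ Suc N * v z"
      using lead[OF e(1) m(1) _ m(2), of l] \<open>vanishes_to_order e t N\<close> by blast
    have "\<forall>\<^sub>F z in nhds t. f z = poly (p + monom c l) (m z) + (e z - c * m z ^ l)"
      using e(3) by eventually_elim (simp add: poly_monom)
    then show ?thesis using v by blast
  qed
qed

text \<open>
  In the coordinate \<open>w\<close> with \<open>m = w\<^sup>k\<close>, the fibres of \<open>m\<close> are the orbits of the rotations by \<open>k\<close>-th roots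
  of unity \<open>\<zeta>\<close>.  Polynomials in \<open>m\<close> are invariant under \<open>\<zeta>\<close>, and \<open>f\<close> differs from such a polynomial
  by an error of arbitrarily high order.  Therefore \<open>f (\<zeta> w) - f w\<close> vanishes to every
  order, \<open>f\<close> is invariant, and it factors through \<open>m\<close>.  The two closure assumptions on \<open>A\<close> are
  the removal of a leading term and division by an element of smaller order.
\<close>
lemma generator_of_local_functions:
  fixes A :: "(complex \<Rightarrow> complex) set"
  assumes an: "\<And>f. f \<in> A \<Longrightarrow> f analytic_on {t}"
    and lead: "\<And>f m l k. f \<in> A \<Longrightarrow> m \<in> A \<Longrightarrow> vanishes_to_order f t (l * k) \<Longrightarrow>
      vanishes_to_order m t k \<Longrightarrow> \<exists>c u. (\<lambda>z. f z - c * m z ^ l) \<in> A \<and> u analytic_on {t} \<and>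
         (\<forall>\<^sub>F z in nhds t. f z - c * m z ^ l = (z - t) ^ Suc (l * k) * u z)"
    and quot: "\<And>f g n p. f \<in> A \<Longrightarrow> g \<in> A \<Longrightarrow> vanishes_to_order f t n \<Longrightarrow>
      vanishes_to_order g t p \<Longrightarrow> p < n \<Longrightarrow> \<exists>h\<in>A. vanishes_to_order h t (n - p)"
    and ex: "\<exists>f\<in>A. \<exists>n>0. vanishes_to_order f t n"
  obtains m k where "m \<in> A" "k > 0" "vanishes_to_order m t k"
    "\<And>f. f \<in> A \<Longrightarrow> \<exists>g. g analytic_on {0} \<and> (\<forall>\<^sub>F z in nhds t. f z = g (m z))"
proof -
  define P where "P k \<longleftrightarrow> k > 0 \<and> (\<exists>f\<in>A. vanishes_to_order f t k)" for k
  define k where "k = (LEAST k. P k)"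
  obtain j where "P j" using ex by (auto simp: P_def)
  then have "P k" unfolding k_def by (rule LeastI)
  then obtain m where m: "m \<in> A" "vanishes_to_order m t k" and k: "k > 0"
    by (auto simp: P_def)
  have least: "k \<le> j" if "f \<in> A" "vanishes_to_order f t j" "0 < j" for f j
    unfolding k_def by (rule Least_le) (use that in \<open>auto simp: P_def\<close>)
  have dvd: "k dvd n" if "f \<in> A" "vanishes_to_order f t n" for f n
    using minimal_order_divides[of A t m k f n, OF quot m k least that] .
  have "\<exists>g. g analytic_on {0} \<and> (\<forall>\<^sub>F z in nhds t. f z = g (m z))" if f: "f \<in> A" for f
  proof -
    obtain w where w: "w analytic_on {t}" "w t = 0" "deriv w t \<noteq> 0" "\<forall>\<^sub>F z in nhds t. m z = w z ^ k"
      using vanishes_to_order_root[OF m(2) k] .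
    have "\<exists>r>0. f holomorphic_on ball t r" "\<exists>r>0. w holomorphic_on ball t r"
      using an[OF f] w(1) by (auto simp: analytic_on_def)
    then obtain r1 r2 where r12: "r1 > 0" "f holomorphic_on ball t r1" "r2 > 0" "w holomorphic_on ball t r2"
      by blast
    define r0 where "r0 = min r1 r2"
    have r0: "r0 > 0" "f holomorphic_on ball t r0" "w holomorphic_on ball t r0"
      using r12 by (auto simp: r0_def intro: holomorphic_on_subset)
    obtain r \<psi> where r: "r > 0" "ball t r \<subseteq> ball t r0" "inj_on w (ball t r)" "open (w ` ball t r)"
      "\<psi> holomorphic_on w ` ball t r" "\<And>x. x \<in> ball t r \<Longrightarrow> \<psi> (w x) = x"
      using holomorphic_local_inverse[OF r0(3) open_ball _ w(3)] r0(1) by (metis centre_in_ball)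
    have "0 \<in> w ` ball t r" using r(1) w(2) by (metis centre_in_ball imageI)
    then obtain \<rho> where \<rho>: "\<rho> > 0" "ball 0 \<rho> \<subseteq> w ` ball t r"
      using r(4) open_contains_ball by blast
    define X where "X = ball t r \<inter> w -` ball 0 \<rho>"
    have wX: "w holomorphic_on ball t r" and fX: "f holomorphic_on ball t r"
      using r(2) r0 by (auto intro: holomorphic_on_subset)
    have "open X"
      unfolding X_def using holomorphic_on_imp_continuous_on[OF wX]
      by (intro continuous_open_preimage) auto
    have "t \<in> X" using r(1) \<rho>(1) w(2) by (simp add: X_def)
    have \<psi>: "\<psi> y \<in> ball t r" "w (\<psi> y) = y" if y: "y \<in> ball 0 \<rho>" for y
    proof -
      obtain x where "x \<in> ball t r" "y = w x" using y \<rho>(2) by blast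
      then show "\<psi> y \<in> ball t r" "w (\<psi> y) = y" using r(6) by auto
    qed
    have \<psi>hol: "\<psi> holomorphic_on ball 0 \<rho>"
      using r(5) \<rho>(2) by (rule holomorphic_on_subset)
    have \<psi>0: "\<psi> 0 = t" using r(1,6) w(2) by (metis centre_in_ball)
    have \<psi>an: "\<psi> analytic_on {0}" using \<psi>hol \<rho>(1) by (auto simp: analytic_on_def)
    have rot: "f (\<psi> (\<zeta> * y)) = f (\<psi> y)" if \<zeta>: "\<zeta> ^ k = 1" and y: "y \<in> ball 0 \<rho>" for \<zeta> y
    proof -
      have n\<zeta>: "norm \<zeta> = 1" using power_eq_1_iff[OF \<zeta>] k by simp
      have mem: "\<zeta> * y \<in> ball 0 \<rho>" if "y \<in> ball 0 \<rho>" for y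
        using that n\<zeta> by (simp add: norm_mult)
      define \<Delta> where "\<Delta> y = f (\<psi> (\<zeta> * y)) - f (\<psi> y)" for y
      have f\<psi>: "(\<lambda>y. f (\<psi> y)) holomorphic_on ball 0 \<rho>"
        by (rule holomorphic_on_compose_gen[OF \<psi>hol fX, unfolded o_def]) (use \<psi> in auto)
      have "(\<lambda>y. f (\<psi> (\<zeta> * y))) holomorphic_on ball 0 \<rho>"
        by (rule holomorphic_on_compose_gen[OF _ f\<psi>, of "\<lambda>y. \<zeta> * y", unfolded o_def])
           (use mem in \<open>auto intro!: holomorphic_intros\<close>)
      then have \<Delta>hol: "\<Delta> holomorphic_on ball 0 \<rho>"
        unfolding \<Delta>_def using f\<psi> by (intro holomorphic_intros)
      then have \<Delta>an: "\<Delta> analytic_on {0}" using \<rho>(1) by (auto simp: analytic_on_def)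
      have "\<not> vanishes_to_order \<Delta> 0 n" for n
      proof
        assume "vanishes_to_order \<Delta> 0 n"
        then obtain u0 where u0: "u0 analytic_on {0}" "u0 0 \<noteq> 0" "\<forall>\<^sub>F y in nhds 0. \<Delta> y = y ^ n * u0 y"
          by (auto simp: vanishes_to_order_def)
        have "\<exists>p e u. e \<in> A \<and> u analytic_on {t} \<and> (\<forall>\<^sub>F z in nhds t. f z = poly p (m z) + e z) \<and>
           (\<forall>\<^sub>F z in nhds t. e z = (z - t) ^ Suc n * u z)"
          by (rule approximation_by_polynomials_in_generator[OF _ _ m _ f])
             (fact an | fact lead | fact dvd)+
        then obtain p e u where e: "u analytic_on {t}" "\<forall>\<^sub>F z in nhds t. f z = poly p (m z) + e z"
            "\<forall>\<^sub>F z in nhds t. e z = (z - t) ^ Suc n * u z"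
          by blast
        have "(\<lambda>y. \<psi> y - t) analytic_on {0}" by (intro analytic_intros \<psi>an)
        then obtain \<eta> where \<eta>: "\<eta> analytic_on {0}" "\<forall>\<^sub>F y in nhds 0. \<psi> y - t = (y - 0) * \<eta> y"
          by (rule analytic_at_zero_factor) (simp_all add: \<psi>0)
        have "isCont \<psi> 0" using \<psi>an by (rule analytic_at_imp_isCont)
        then have lim\<psi>: "filterlim \<psi> (nhds t) (nhds 0)"
          unfolding isCont_def using \<psi>0 by (metis tendsto_at_iff_tendsto_nhds)
        have lim\<zeta>: "filterlim (\<lambda>y. \<zeta> * y) (nhds 0) (nhds 0)"
          using tendsto_at_iff_tendsto_nhds[of "\<lambda>y. \<zeta> * y" 0] by (auto intro!: tendsto_eq_intros)
        have ev: "\<forall>\<^sub>F y in nhds 0. f (\<psi> y) = poly p (y ^ k) + (y * \<eta> y) ^ Suc n * u (\<psi> y)"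
        proof -
          have "\<forall>\<^sub>F y in nhds 0. y \<in> ball 0 \<rho>" using \<rho>(1) by (intro eventually_nhds_in_open) auto
          with eventually_compose_filterlim[OF e(2) lim\<psi>] eventually_compose_filterlim[OF e(3) lim\<psi>] \<eta>(2)
            eventually_compose_filterlim[OF w(4) lim\<psi>]
          show ?thesis by eventually_elim (use \<psi>(2) in simp)
        qed
        \<comment> \<open>An error of order \<open>n + 1\<close> contradicts the order \<open>n\<close> of the difference.\<close>
        define Q where "Q y = (\<zeta> * \<eta> (\<zeta> * y)) ^ Suc n * u (\<psi> (\<zeta> * y)) - \<eta> y ^ Suc n * u (\<psi> y)" for y
        have "\<forall>\<^sub>F y in nhds 0. y ^ n * u0 y = y ^ Suc n * Q y"
          using ev eventually_compose_filterlim[OF ev lim\<zeta>] u0(3)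
        proof eventually_elim
          case (elim y)
          have "(\<zeta> * y) ^ k = y ^ k" using \<zeta> by (simp add: power_mult_distrib)
          with elim have "y ^ n * u0 y = (\<zeta> * y * \<eta> (\<zeta> * y)) ^ Suc n * u (\<psi> (\<zeta> * y))
              - (y * \<eta> y) ^ Suc n * u (\<psi> y)"
            by (simp add: \<Delta>_def)
          then show ?case by (simp add: Q_def power_mult_distrib algebra_simps)
        qed
        then have evQ: "\<forall>\<^sub>F y in at 0. y * Q y = u0 y"
          unfolding eventually_at_filter by eventually_elim auto
        have "isCont Q 0"
        proof -
          have c: "isCont \<eta> 0" "isCont u (\<psi> 0)" "isCont \<psi> 0"
            using \<eta>(1) e(1) \<psi>an \<psi>0 by (auto intro: analytic_at_imp_isCont)
          have c2: "isCont (\<lambda>y. u (\<psi> y)) 0" by (rule isCont_o2[OF c(3,2)])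
          have m\<zeta>: "isCont (\<lambda>y. \<zeta> * y) 0" by (intro continuous_intros)
          have "isCont (\<lambda>y. \<eta> (\<zeta> * y)) 0"
            by (rule isCont_o2[OF m\<zeta>]) (use c(1) in simp)
          moreover have "isCont (\<lambda>y. u (\<psi> (\<zeta> * y))) 0"
            by (rule isCont_o2[OF m\<zeta>]) (use c2 in simp)
          ultimately show ?thesis unfolding Q_def using c(1) c2 m\<zeta> by (intro continuous_intros)
        qed
        then have "((\<lambda>y. y * Q y) \<longlongrightarrow> 0 * Q 0) (at 0)"
          unfolding isCont_def by (intro tendsto_intros)
        then have "(u0 \<longlongrightarrow> 0) (at 0)"
          using Lim_transform_eventually[OF _ evQ] by simp
        moreover have "(u0 \<longlongrightarrow> u0 0) (at 0)"
          using u0(1) analytic_at_imp_isCont isContD by blast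
        ultimately show False using u0(2) tendsto_unique[of "at (0::complex)"] by (metis at_neq_bot)
      qed
      then have "\<forall>\<^sub>F y in nhds 0. \<Delta> y = 0"
        using analytic_at_zero_or_order[OF \<Delta>an] by blast
      then obtain Y where Y: "open Y" "0 \<in> Y" "\<And>y. y \<in> Y \<Longrightarrow> \<Delta> y = 0"
        by (auto simp: eventually_nhds)
      have "\<Delta> y = 0"
        by (rule analytic_continuation_open[of "Y \<inter> ball 0 \<rho>" "ball 0 \<rho>" \<Delta> "\<lambda>_. 0"])
           (use Y \<rho> y \<Delta>hol in auto)
      then show ?thesis by (simp add: \<Delta>_def)
    qed
    have fibres: "f z = f z'" if z: "z \<in> X" "z' \<in> X" "w z ^ k = w z' ^ k" for z z'
    proof (cases "w z = 0")
      case True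
      then have "w z' = w z" using z(3) k by (simp add: power_0_left)
      moreover have "z \<in> ball t r" "z' \<in> ball t r" using z by (auto simp: X_def)
      ultimately have "z = z'" using r(3) by (metis inj_onD)
      then show ?thesis by simp
    next
      case False
      define \<zeta> where "\<zeta> = w z' / w z"
      have "\<zeta> ^ k = 1" using False z(3)[symmetric] by (simp add: \<zeta>_def power_divide)
      then have "f (\<psi> (\<zeta> * w z)) = f (\<psi> (w z))"
        using rot z(1) by (simp add: X_def)
      moreover have "\<zeta> * w z = w z'" using False by (simp add: \<zeta>_def)
      ultimately show ?thesis using r(6) z by (simp add: X_def)
    qed
    have XS: "X \<subseteq> ball t r" by (auto simp: X_def)
    have nlc: "nowhere_locally_constant_on (\<lambda>z. w z ^ k) X"
      unfolding nowhere_locally_constant_on_def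
    proof (intro allI impI notI; elim conjE)
      fix Y assume Y: "open Y" "Y \<noteq> {}" "Y \<subseteq> X" "(\<lambda>z. w z ^ k) constant_on Y"
      then obtain c where "\<And>z. z \<in> Y \<Longrightarrow> w z ^ k = c" by (auto simp: constant_on_def)
      then have "w ` Y \<subseteq> {y. y ^ k = c}" by auto
      then have "finite (w ` Y)" using finite_nth_roots[OF k] finite_subset by blast
      moreover have "inj_on w Y" using r(3) XS Y(3) by (meson inj_on_subset order_trans)
      ultimately have "finite Y" by (rule finite_imageD)
      then show False using Y(1,2) finite_imp_not_open by blast
    qed
    have hol: "(\<lambda>z. w z ^ k) holomorphic_on X" "f holomorphic_on X"
      using wX fX XS by (auto intro!: holomorphic_intros intro: holomorphic_on_subset)
    obtain g where g: "g holomorphic_on (\<lambda>z. w z ^ k) ` X" "\<And>z. z \<in> X \<Longrightarrow> g (w z ^ k) = f z"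
      using holomorphic_factor_through[OF hol(1) \<open>open X\<close> nlc hol(2) fibres] by blast
    have "open ((\<lambda>z. w z ^ k) ` X)"
      by (rule open_image_nowhere_locally_constant[OF hol(1) \<open>open X\<close> nlc \<open>open X\<close>]) simp
    moreover have "0 \<in> (\<lambda>z. w z ^ k) ` X"
      using \<open>t \<in> X\<close> w(2) k by (auto intro!: image_eqI[of _ _ t] simp: power_0_left)
    ultimately have "g analytic_on {0}" using g(1) analytic_at by blast
    moreover have "\<forall>\<^sub>F z in nhds t. f z = g (m z)"
      using w(4) eventually_nhds_in_open[OF \<open>open X\<close> \<open>t \<in> X\<close>] by eventually_elim (simp add: g(2))
    ultimately show ?thesis by blast
  qed
  with m k show thesis using that by blast
qed

section \<open>Functions determined by the values of a map\<close>

text \<open>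
  The finite set \<open>E\<close> makes room for the zeros of denominators, so that the class is stable under
  division whenever the quotient is analytic.
\<close>
definition determined_near :: "(complex \<Rightarrow> 'a) \<Rightarrow> complex set \<Rightarrow> (complex \<Rightarrow> complex) \<Rightarrow> bool" where
  "determined_near F K f \<longleftrightarrow> f analytic_on K \<and>
     (\<exists>V E. open V \<and> K \<subseteq> V \<and> finite E \<and>
        (\<forall>z\<in>V - E. \<forall>z'\<in>V - E. F z = F z' \<longrightarrow> f z = f z'))"

lemma determined_nearE:
  assumes "determined_near F K f"
  obtains V E where "f analytic_on K" "open V" "K \<subseteq> V" "finite E"
    "\<And>z z'. z \<in> V - E \<Longrightarrow> z' \<in> V - E \<Longrightarrow> F z = F z' \<Longrightarrow> f z = f z'"
  using assms unfolding determined_near_def by blast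

lemma determined_near_combine:
  fixes \<phi> :: "complex \<Rightarrow> complex \<Rightarrow> complex"
  assumes f: "determined_near F K f" and g: "determined_near F K g"
    and h: "h analytic_on K" "open W" "K \<subseteq> W" "finite B" "\<And>z. z \<in> W - B \<Longrightarrow> h z = \<phi> (f z) (g z)"
  shows "determined_near F K h"
proof -
  obtain V E where V: "open V" "K \<subseteq> V" "finite E"
    "\<And>z z'. z \<in> V - E \<Longrightarrow> z' \<in> V - E \<Longrightarrow> F z = F z' \<Longrightarrow> f z = f z'"
    using determined_nearE[OF f] by metis
  obtain V' E' where V': "open V'" "K \<subseteq> V'" "finite E'"
    "\<And>z z'. z \<in> V' - E' \<Longrightarrow> z' \<in> V' - E' \<Longrightarrow> F z = F z' \<Longrightarrow> g z = g z'"
    using determined_nearE[OF g] by metis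
  have "h z = h z'"
    if *: "z \<in> V \<inter> V' \<inter> W - (E \<union> E' \<union> B)" "z' \<in> V \<inter> V' \<inter> W - (E \<union> E' \<union> B)" "F z = F z'" for z z'
  proof -
    have "f z = f z'" by (rule V(4)) (use * in auto)
    moreover have "g z = g z'" by (rule V'(4)) (use * in auto)
    moreover have "h z = \<phi> (f z) (g z)" "h z' = \<phi> (f z') (g z')" using * h(5) by auto
    ultimately show ?thesis by simp
  qed
  moreover have "open (V \<inter> V' \<inter> W)" "K \<subseteq> V \<inter> V' \<inter> W" "finite (E \<union> E' \<union> B)"
    using V V' h by auto
  ultimately have "open (V \<inter> V' \<inter> W) \<and> K \<subseteq> V \<inter> V' \<inter> W \<and> finite (E \<union> E' \<union> B) \<and>
      (\<forall>z\<in>V \<inter> V' \<inter> W - (E \<union> E' \<union> B). \<forall>z'\<in>V \<inter> V' \<inter> W - (E \<union> E' \<union> B). F z = F z' \<longrightarrow> h z = h z')"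
    by (intro conjI ballI impI)
  note witness = this
  show ?thesis
    unfolding determined_near_def by (rule conjI, fact h(1), rule exI, rule exI, fact witness)
qed

text \<open>
  The leading coefficients \<open>uf t\<close> and \<open>um t\<close> appear in the conclusion because \<open>c\<close> has to be recognized as real
  when \<open>f\<close> and \<open>m\<close> are real on an interval.
\<close>
lemma leading_term_cancel:
  assumes f: "vanishes_to_order f t (l * k)" and m: "vanishes_to_order m t k"
  obtains c u uf um where "u analytic_on {t}"
     "\<forall>\<^sub>F z in nhds t. f z - c * m z ^ l = (z - t) ^ Suc (l * k) * u z"
     "uf analytic_on {t}" "uf t \<noteq> 0" "\<forall>\<^sub>F z in nhds t. f z = (z - t) ^ (l * k) * uf z"
     "um analytic_on {t}" "um t \<noteq> 0" "\<forall>\<^sub>F z in nhds t. m z = (z - t) ^ k * um z"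
     "c = uf t / um t ^ l"
proof -
  obtain uf where uf: "uf analytic_on {t}" "uf t \<noteq> 0" "\<forall>\<^sub>F z in nhds t. f z = (z - t) ^ (l * k) * uf z"
    using f unfolding vanishes_to_order_def by blast
  obtain um where um: "um analytic_on {t}" "um t \<noteq> 0" "\<forall>\<^sub>F z in nhds t. m z = (z - t) ^ k * um z"
    using m unfolding vanishes_to_order_def by blast
  define c where "c = uf t / um t ^ l"
  have "(\<lambda>z. uf z - c * um z ^ l) analytic_on {t}"
    by (intro analytic_intros uf um)
  moreover have "uf t - c * um t ^ l = 0" using um(2) by (simp add: c_def)
  ultimately obtain u where u: "u analytic_on {t}" "\<forall>\<^sub>F z in nhds t. uf z - c * um z ^ l = (z - t) * u z"
    using analytic_at_zero_factor[of "\<lambda>z. uf z - c * um z ^ l" t] by blast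
  have "\<forall>\<^sub>F z in nhds t. f z - c * m z ^ l = (z - t) ^ Suc (l * k) * u z"
    using uf(3) um(3) u(2)
  proof eventually_elim
    case (elim z)
    have "f z - c * m z ^ l = (z - t) ^ (l * k) * (uf z - c * um z ^ l)"
      using elim by (simp add: power_mult_distrib algebra_simps flip: power_mult)
    then show ?case using elim by simp
  qed
  then show thesis using that[OF u(1) _ uf um] by (simp add: c_def)
qed

text \<open>
  Each point of \<open>K\<close> has a neighbourhood in which it is the only candidate for a singularity, so a
  finite subcover leaves finitely many singularities, all of them removable.
\<close>
lemma analytic_extension_across_finite_set:
  assumes K: "compact K"
    and loc: "\<And>x. x \<in> K \<Longrightarrow> \<exists>\<psi>. \<psi> analytic_on {x} \<and> (\<forall>\<^sub>F z in at x. \<phi> z = \<psi> z)"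
  obtains h V E where "h analytic_on K" "open V" "K \<subseteq> V" "finite E"
    "\<And>z. z \<in> V - E \<Longrightarrow> h z = \<phi> z"
    "\<And>x \<psi>. x \<in> K \<Longrightarrow> \<psi> analytic_on {x} \<Longrightarrow> \<forall>\<^sub>F z in at x. \<phi> z = \<psi> z \<Longrightarrow> \<forall>\<^sub>F z in nhds x. h z = \<psi> z"
proof -
  define h where "h = remove_sings \<phi>"
  have key: "\<exists>B. open B \<and> x \<in> B \<and> \<psi> holomorphic_on B \<and> (\<forall>z\<in>B - {x}. h z = \<phi> z) \<and> (\<forall>z\<in>B. h z = \<psi> z)"
    if \<psi>: "\<psi> analytic_on {x}" "\<forall>\<^sub>F z in at x. \<phi> z = \<psi> z" for x \<psi>
  proof -
    obtain A where A: "open A" "x \<in> A" "\<psi> holomorphic_on A" using \<psi>(1) analytic_at by blast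
    obtain A' where A': "open A'" "x \<in> A'" "\<And>z. z \<in> A' \<Longrightarrow> z \<noteq> x \<Longrightarrow> \<phi> z = \<psi> z"
      using \<psi>(2) by (auto simp: eventually_at_topological)
    have hx: "h x = \<psi> x"
      using \<psi> unfolding h_def
      by (metis remove_sings_cong remove_sings_at_analytic)
    have "h z = \<phi> z \<and> \<phi> z = \<psi> z" if z: "z \<in> A \<inter> A' - {x}" for z
    proof -
      have o: "open (A \<inter> A' - {x})" using A A' by auto
      have "\<psi> holomorphic_on (A \<inter> A' - {x})" using A(3) by (rule holomorphic_on_subset) auto
      then have "\<phi> holomorphic_on (A \<inter> A' - {x})"
        by (rule holomorphic_transform) (use A'(3) in auto)
      then have "\<phi> analytic_on {z}" using o z analytic_at by blast
      then show ?thesis using z A'(3) by (auto simp: h_def)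
    qed
    moreover from this hx have "h z = \<psi> z" if "z \<in> A \<inter> A'" for z
      using that by (cases "z = x") auto
    moreover have "\<psi> holomorphic_on A \<inter> A'" using A(3) by (rule holomorphic_on_subset) auto
    ultimately show ?thesis
      using A A' by (intro exI[of _ "A \<inter> A'"] conjI) auto
  qed
  have "\<forall>x\<in>K. \<exists>B. open B \<and> x \<in> B \<and> h holomorphic_on B \<and> (\<forall>z\<in>B - {x}. h z = \<phi> z)"
  proof
    fix x assume "x \<in> K"
    then obtain \<psi> where "\<psi> analytic_on {x}" "\<forall>\<^sub>F z in at x. \<phi> z = \<psi> z" using loc by blast
    then obtain B where "open B" "x \<in> B" "\<psi> holomorphic_on B" "\<forall>z\<in>B - {x}. h z = \<phi> z" "\<forall>z\<in>B. h z = \<psi> z"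
      using key by blast
    then show "\<exists>B. open B \<and> x \<in> B \<and> h holomorphic_on B \<and> (\<forall>z\<in>B - {x}. h z = \<phi> z)"
      by (metis holomorphic_cong)
  qed
  then obtain B where B: "\<And>x. x \<in> K \<Longrightarrow> open (B x)" "\<And>x. x \<in> K \<Longrightarrow> x \<in> B x"
    "\<And>x. x \<in> K \<Longrightarrow> h holomorphic_on B x" "\<And>x z. x \<in> K \<Longrightarrow> z \<in> B x - {x} \<Longrightarrow> h z = \<phi> z"
    by metis
  have "K \<subseteq> (\<Union>x\<in>K. B x)" using B(2) by blast
  then obtain E where E: "E \<subseteq> K" "finite E" "K \<subseteq> (\<Union>x\<in>E. B x)"
    using compactE_image[OF K, of K B] B(1) by metis
  show thesis
  proof (rule that[of h "\<Union>x\<in>E. B x" E])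
    show "h analytic_on K"
      using B(1,2,3) by (subst analytic_on_analytic_at) (use analytic_at in blast)
    show "open (\<Union>x\<in>E. B x)" using B(1) E(1) by blast
    show "h z = \<phi> z" if "z \<in> (\<Union>x\<in>E. B x) - E" for z
      using that B(4) E(1) by blast
    show "\<forall>\<^sub>F z in nhds x. h z = \<psi> z"
      if "x \<in> K" "\<psi> analytic_on {x}" "\<forall>\<^sub>F z in at x. \<phi> z = \<psi> z" for x \<psi>
      using key[OF that(2,3)] by (auto simp: eventually_nhds)
  qed (use E in auto)
qed

lemma analytic_on_convex_neighbourhood:
  assumes "f analytic_on K" "compact K" "convex K"
  obtains V where "open V" "convex V" "K \<subseteq> V" "f holomorphic_on V"
proof -
  obtain S where S: "open S" "K \<subseteq> S" "f holomorphic_on S"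
    using assms(1) by (auto simp: analytic_on_holomorphic)
  then obtain V where "open V" "convex V" "K \<subseteq> V" "V \<subseteq> S"
    using convex_neighbourhood[OF assms(2,3) S(1,2)] by metis
  then show thesis using that S(3) holomorphic_on_subset by metis
qed

lemma eventually_zero_along_convex:
  assumes "f analytic_on K" "compact K" "convex K" "x \<in> K" "y \<in> K" "\<forall>\<^sub>F z in nhds x. f z = 0"
  shows "\<forall>\<^sub>F z in nhds y. f z = 0"
proof -
  obtain V where V: "open V" "convex V" "K \<subseteq> V" "f holomorphic_on V"
    using analytic_on_convex_neighbourhood[OF assms(1-3)] .
  obtain X where X: "open X" "x \<in> X" "\<And>z. z \<in> X \<Longrightarrow> f z = 0"
    using assms(6) by (auto simp: eventually_nhds)
  have "f z = 0" if "z \<in> V" for z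
    by (rule analytic_continuation_open[of "X \<inter> V" V f "\<lambda>_. 0"])
       (use V X assms(4) that in \<open>auto intro: convex_connected\<close>)
  then show ?thesis using V(1,3) assms(5) by (auto simp: eventually_nhds)
qed

lemma not_eventually_zero_if_vanishes_to_order:
  assumes "vanishes_to_order f t n"
  shows "\<not> (\<forall>\<^sub>F z in nhds t. f z = 0)"
proof
  assume z: "\<forall>\<^sub>F z in nhds t. f z = 0"
  obtain u where u: "u analytic_on {t}" "u t \<noteq> 0" "\<forall>\<^sub>F z in nhds t. f z = (z - t) ^ n * u z"
    using assms unfolding vanishes_to_order_def by blast
  have "\<forall>\<^sub>F z in nhds t. z = t"
    using z u(3) analytic_at_nonzero_eventually[OF u(1,2)] by eventually_elim auto
  then obtain S where "open S" "t \<in> S" "\<And>z. z \<in> S \<Longrightarrow> z = t"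
    by (auto simp: eventually_nhds)
  then have "S = {t}" by blast
  with \<open>open S\<close> show False using not_open_singleton by blast
qed

lemma vanishes_to_order_along_convex:
  assumes "f analytic_on K" "compact K" "convex K" "t \<in> K" "vanishes_to_order f t n" "x \<in> K"
  shows "\<exists>p. vanishes_to_order f x p"
  using eventually_zero_along_convex[OF assms(1-3,6,4)] analytic_at_zero_or_order[of f x]
    not_eventually_zero_if_vanishes_to_order[OF assms(5)] assms(1,6) analytic_on_analytic_at by blast

lemma determined_near_const: "determined_near F K (\<lambda>_. c)"
proof -
  have "open UNIV \<and> K \<subseteq> UNIV \<and> finite {} \<and>
      (\<forall>z\<in>UNIV - {}. \<forall>z'\<in>UNIV - {}. F z = F z' \<longrightarrow> c = c)" by simp
  then show ?thesis unfolding determined_near_def by (intro conjI analytic_on_const) blast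
qed

lemma vanishes_to_order_cong:
  assumes "vanishes_to_order f t n" "\<forall>\<^sub>F z in nhds t. g z = f z"
  shows "vanishes_to_order g t n"
proof -
  obtain u where u: "u analytic_on {t}" "u t \<noteq> 0" "\<forall>\<^sub>F z in nhds t. f z = (z - t) ^ n * u z"
    using assms(1) unfolding vanishes_to_order_def by blast
  have "\<forall>\<^sub>F z in nhds t. g z = (z - t) ^ n * u z"
    using u(3) assms(2) by eventually_elim simp
  with u(1,2) show ?thesis unfolding vanishes_to_order_def by blast
qed

lemma vanishes_to_order_value:
  assumes "vanishes_to_order f t n"
  shows "f t = 0 \<longleftrightarrow> n > 0"
proof -
  obtain u where u: "u t \<noteq> 0" "\<forall>\<^sub>F z in nhds t. f z = (z - t) ^ n * u z"
    using assms unfolding vanishes_to_order_def by blast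
  have "f t = (t - t) ^ n * u t" using eventually_nhds_x_imp_x[OF u(2)] .
  then show ?thesis using u(1) by (auto simp: power_0_left)
qed

lemma vanishes_to_order_positive:
  assumes "f analytic_on {t}" "\<not> (\<forall>\<^sub>F z in nhds t. f z = f t)"
  obtains n where "n > 0" "vanishes_to_order (\<lambda>z. f z - f t) t n"
proof -
  have "(\<lambda>z. f z - f t) analytic_on {t}" using assms(1) by (intro analytic_intros)
  moreover have "\<not> (\<forall>\<^sub>F z in nhds t. f z - f t = 0)" using assms(2) by simp
  ultimately obtain n where n: "vanishes_to_order (\<lambda>z. f z - f t) t n"
    using analytic_at_zero_or_order by blast
  then have "n > 0" using vanishes_to_order_value[OF n] by simp
  with n that show thesis by blast
qed

lemma compact_real_interval: "compact (real_interval a b)"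
  unfolding real_interval_def by (intro compact_continuous_image continuous_intros) simp

lemma convex_real_interval: "convex (real_interval a b)"
  unfolding real_interval_def by (intro convex_linear_image) (auto intro: linearI simp: scaleR_conv_of_real)

lemma real_interval_nontrivial_limit:
  assumes "a < b" "x \<in> real_interval a b"
  shows "at x within real_interval a b \<noteq> bot"
proof -
  have "complex_of_real a \<in> real_interval a b" "complex_of_real b \<in> real_interval a b"
    using assms(1) by (auto simp: real_interval_def)
  moreover have "complex_of_real a \<noteq> complex_of_real b" using assms(1) by simp
  ultimately have "x islimpt real_interval a b"
    using connected_imp_perfect[OF convex_connected[OF convex_real_interval[of a b]] assms(2)] by (metis singletonD)
  then show ?thesis by (simp add: trivial_limit_within)
qed

lemma real_limit_along_interval:
  assumes "a < b" "x \<in> real_interval a b" "u analytic_on {x}"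
    "\<forall>\<^sub>F z in at x within real_interval a b. u z \<in> \<real>"
  shows "u x \<in> \<real>"
proof -
  have "isCont u x" using assms(3) by (rule analytic_at_imp_isCont)
  then have "(u \<longlongrightarrow> u x) (at x within real_interval a b)"
    using continuous_at_imp_continuous_within continuous_within by blast
  then show ?thesis
    using Lim_in_closed_set[OF closed_complex_Reals assms(4) real_interval_nontrivial_limit[OF assms(1,2)]]
    by simp
qed

text \<open>
  The coefficient is the limit of the real quotients \<open>f z / (z - x)\<^sup>n\<close> along the interval; this needs
  an interval that does not reduce to a point.
\<close>
lemma real_leading_coefficient:
  assumes "a < b" "x \<in> real_interval a b" "f ` real_interval a b \<subseteq> \<real>"
    and u: "u analytic_on {x}" "\<forall>\<^sub>F z in nhds x. f z = (z - x) ^ n * u z"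
  shows "u x \<in> \<real>"
proof (rule real_limit_along_interval[OF assms(1,2) u(1)])
  have "\<forall>\<^sub>F z in at x within real_interval a b. f z = (z - x) ^ n * u z"
    unfolding eventually_at_filter using u(2) by eventually_elim simp
  moreover have "\<forall>\<^sub>F z in at x within real_interval a b. z \<in> real_interval a b \<and> z \<noteq> x"
    by (simp add: eventually_at_filter)
  ultimately show "\<forall>\<^sub>F z in at x within real_interval a b. u z \<in> \<real>"
  proof eventually_elim
    case (elim z)
    then have "f z \<in> \<real>" using assms(3) by blast
    moreover have "z \<in> \<real>" "x \<in> \<real>" using elim assms(2) by (auto simp: real_interval_def)
    moreover have "u z = f z / (z - x) ^ n" using elim by simp
    ultimately show ?case by simp
  qed
qed

text \<open>
  For \<open>q = f / g\<close> this is \<open>q / (1 + q\<^sup>2)\<close>.  Where \<open>q\<close> is real there is no pole: poles of \<open>q\<close> become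
  zeros, and \<open>1 + q\<^sup>2\<close> does not vanish.  Zeros of \<open>q\<close> keep their order.
\<close>
lemma bounded_quotient_locally:
  fixes f g :: "complex \<Rightarrow> complex"
  assumes u: "u analytic_on {x}" "u x \<noteq> 0" "u x \<in> \<real>" "\<forall>\<^sub>F z in nhds x. f z = (z - x) ^ n * u z"
    and v: "v analytic_on {x}" "v x \<noteq> 0" "v x \<in> \<real>" "\<forall>\<^sub>F z in nhds x. g z = (z - x) ^ p * v z"
    and le: "p \<le> n"
  obtains \<psi> where "\<psi> analytic_on {x}" "\<psi> x \<in> \<real>"
    "\<forall>\<^sub>F z in at x. f z * g z / (f z ^ 2 + g z ^ 2) = \<psi> z"
    "p < n \<Longrightarrow> vanishes_to_order \<psi> x (n - p)"
proof -
  define s where "s z = ((z - x) ^ (n - p) * u z) ^ 2 + v z ^ 2" for z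
  define w where "w z = u z * v z / s z" for z
  have sx: "s x = (if p < n then 0 else u x ^ 2) + v x ^ 2"
    using le by (auto simp: s_def power_0_left)
  obtain r where r: "v x = of_real r" "r \<noteq> 0" using v(2,3) by (auto elim: Reals_cases)
  obtain q where q: "u x = of_real q" using u(3) by (auto elim: Reals_cases)
  have "s x = of_real ((if p < n then 0 else q ^ 2) + r ^ 2)" using sx r q by simp
  moreover have "(if p < n then 0 else q ^ 2) + r ^ 2 > 0"
    using r(2) by (simp add: add_nonneg_pos)
  ultimately have s: "s x \<noteq> 0" "s x \<in> \<real>" by (metis less_irrefl of_real_eq_0_iff, simp)
  have san: "s analytic_on {x}" unfolding s_def by (intro analytic_intros u v)
  have wan: "w analytic_on {x}" unfolding w_def by (intro analytic_intros u v san) (use s in auto)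
  have wx: "w x \<noteq> 0" "w x \<in> \<real>" using s u v by (auto simp: w_def)
  define \<psi> where "\<psi> z = (z - x) ^ (n - p) * w z" for z
  have "\<psi> analytic_on {x}" unfolding \<psi>_def by (intro analytic_intros wan)
  moreover have "\<psi> x \<in> \<real>" using wx by (auto simp: \<psi>_def power_0_left)
  moreover have "\<forall>\<^sub>F z in at x. f z * g z / (f z ^ 2 + g z ^ 2) = \<psi> z"
  proof -
    have "\<forall>\<^sub>F z in at x. f z = (z - x) ^ n * u z" "\<forall>\<^sub>F z in at x. g z = (z - x) ^ p * v z"
      using u(4) v(4) eventually_nhds_conv_at by blast+
    moreover have "\<forall>\<^sub>F z in at x. z \<noteq> x" by (simp add: eventually_at_filter)
    ultimately show ?thesis
    proof eventually_elim
      case (elim z)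
      have n: "(z - x) ^ n = (z - x) ^ p * (z - x) ^ (n - p)" using le by (simp flip: power_add)
      have "f z ^ 2 + g z ^ 2 = ((z - x) ^ p) ^ 2 * s z"
        using elim n by (simp add: s_def power_mult_distrib algebra_simps)
      moreover have "f z * g z = ((z - x) ^ p) ^ 2 * ((z - x) ^ (n - p) * (u z * v z))"
        using elim n by (simp add: power2_eq_square)
      ultimately show ?case using elim(3) by (simp add: \<psi>_def w_def)
    qed
  qed
  moreover have "vanishes_to_order \<psi> x (n - p)"
    unfolding vanishes_to_order_def \<psi>_def using wan wx by auto
  ultimately show thesis using that by blast
qed

text \<open>
  The plain quotient \<open>f / g\<close> may have poles on the interval away from \<open>t\<close>; its bounded
  substitute \<open>f g / (f\<^sup>2 + g\<^sup>2)\<close> has none, and has the same order \<open>n - p\<close> at \<open>t\<close>.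
\<close>
lemma bounded_quotient:
  assumes ab: "a < b" and t: "t \<in> real_interval a b"
    and f: "determined_near F (real_interval a b) f" "f ` real_interval a b \<subseteq> \<real>" "vanishes_to_order f t n"
    and g: "determined_near F (real_interval a b) g" "g ` real_interval a b \<subseteq> \<real>" "vanishes_to_order g t p"
    and "p < n"
  obtains h where "determined_near F (real_interval a b) h" "h ` real_interval a b \<subseteq> \<real>"
    "vanishes_to_order h t (n - p)"
proof -
  let ?I = "real_interval a b"
  define \<phi> where "\<phi> z = f z * g z / (f z ^ 2 + g z ^ 2)" for z
  have an: "f analytic_on ?I" "g analytic_on ?I" using f(1) g(1) by (auto simp: determined_near_def)
  have loc: "\<exists>\<psi>. \<psi> analytic_on {x} \<and> \<psi> x \<in> \<real> \<and> (\<forall>\<^sub>F z in at x. \<phi> z = \<psi> z)" if x: "x \<in> ?I" for x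
  proof -
    obtain n' where "vanishes_to_order f x n'"
      using vanishes_to_order_along_convex[OF an(1) compact_real_interval convex_real_interval t f(3) x] by blast
    then obtain u where u: "u analytic_on {x}" "u x \<noteq> 0" "\<forall>\<^sub>F z in nhds x. f z = (z - x) ^ n' * u z"
      unfolding vanishes_to_order_def by blast
    obtain p' where "vanishes_to_order g x p'"
      using vanishes_to_order_along_convex[OF an(2) compact_real_interval convex_real_interval t g(3) x] by blast
    then obtain v where v: "v analytic_on {x}" "v x \<noteq> 0" "\<forall>\<^sub>F z in nhds x. g z = (z - x) ^ p' * v z"
      unfolding vanishes_to_order_def by blast
    have real: "u x \<in> \<real>" "v x \<in> \<real>"
      using real_leading_coefficient[OF ab x f(2) u(1,3)] real_leading_coefficient[OF ab x g(2) v(1,3)] .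
    show ?thesis
    proof (cases "p' \<le> n'")
      case True
      show ?thesis
        by (rule bounded_quotient_locally[OF u(1,2) real(1) u(3) v(1,2) real(2) v(3) True])
           (auto simp: \<phi>_def)
    next
      case False
      then have "n' \<le> p'" by simp
      show ?thesis
        by (rule bounded_quotient_locally[OF v(1,2) real(2) v(3) u(1,2) real(1) u(3) \<open>n' \<le> p'\<close>])
           (auto simp: \<phi>_def mult.commute add.commute)
    qed
  qed
  then have loc': "\<And>x. x \<in> ?I \<Longrightarrow> \<exists>\<psi>. \<psi> analytic_on {x} \<and> (\<forall>\<^sub>F z in at x. \<phi> z = \<psi> z)" by blast
  show thesis
  proof (rule analytic_extension_across_finite_set[OF compact_real_interval loc'])
    fix h V E assume h: "h analytic_on ?I" "open V" "?I \<subseteq> V" "finite E" "\<And>z. z \<in> V - E \<Longrightarrow> h z = \<phi> z"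
      "\<And>x \<psi>. x \<in> ?I \<Longrightarrow> \<psi> analytic_on {x} \<Longrightarrow> \<forall>\<^sub>F z in at x. \<phi> z = \<psi> z \<Longrightarrow> \<forall>\<^sub>F z in nhds x. h z = \<psi> z"
    have "determined_near F ?I h"
      by (rule determined_near_combine[OF f(1) g(1) h(1-4), of "\<lambda>x y. x * y / (x ^ 2 + y ^ 2)"])
         (use h(5) in \<open>simp add: \<phi>_def\<close>)
    moreover have "h ` ?I \<subseteq> \<real>"
    proof (rule image_subsetI)
      fix x assume x: "x \<in> ?I"
      then obtain \<psi> where \<psi>: "\<psi> analytic_on {x}" "\<psi> x \<in> \<real>" "\<forall>\<^sub>F z in at x. \<phi> z = \<psi> z"
        using loc by blast
      have "h x = \<psi> x" using eventually_nhds_x_imp_x[OF h(6)[OF x \<psi>(1,3)]] .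
      with \<psi>(2) show "h x \<in> \<real>" by simp
    qed
    moreover have "vanishes_to_order h t (n - p)"
    proof -
      obtain u where u: "u analytic_on {t}" "u t \<noteq> 0" "\<forall>\<^sub>F z in nhds t. f z = (z - t) ^ n * u z"
        using f(3) unfolding vanishes_to_order_def by blast
      obtain v where v: "v analytic_on {t}" "v t \<noteq> 0" "\<forall>\<^sub>F z in nhds t. g z = (z - t) ^ p * v z"
        using g(3) unfolding vanishes_to_order_def by blast
      have real: "u t \<in> \<real>" "v t \<in> \<real>"
        using real_leading_coefficient[OF ab t f(2) u(1,3)] real_leading_coefficient[OF ab t g(2) v(1,3)] .
      obtain \<psi> where \<psi>: "\<psi> analytic_on {t}"
        "\<forall>\<^sub>F z in at t. f z * g z / (f z ^ 2 + g z ^ 2) = \<psi> z" "vanishes_to_order \<psi> t (n - p)"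
        by (rule bounded_quotient_locally[OF u(1,2) real(1) u(3) v(1,2) real(2) v(3) less_imp_le[OF \<open>p < n\<close>]])
           (use \<open>p < n\<close> in auto)
      have "\<forall>\<^sub>F z in nhds t. h z = \<psi> z" using h(6)[OF t \<psi>(1)] \<psi>(2) by (simp add: \<phi>_def)
      with \<psi>(3) show ?thesis by (rule vanishes_to_order_cong)
    qed
    ultimately show thesis using that by blast
  qed
qed

text \<open>
  Real leading coefficients keep the class of functions real on the interval stable under removal of leading
  terms, and the bounded quotient takes the place of division.
\<close>
lemma generator_on_real_interval:
  fixes F :: "complex \<Rightarrow> 'a"
  defines "R \<equiv> \<lambda>a b. {f. determined_near F (real_interval a b) f \<and> f ` real_interval a b \<subseteq> \<real>}"
  assumes ab: "a < b" and t: "t \<in> real_interval a b"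
    and f0: "f\<^sub>0 \<in> R a b" "\<not> (\<forall>\<^sub>F z in nhds t. f\<^sub>0 z = f\<^sub>0 t)"
  obtains m k where "m \<in> R a b" "k > 0" "vanishes_to_order m t k"
    "\<And>f. f \<in> R a b \<Longrightarrow> \<exists>g. g analytic_on {0} \<and> (\<forall>\<^sub>F z in nhds t. f z = g (m z))"
proof (rule generator_of_local_functions[of "R a b" t])
  let ?I = "real_interval a b"
  show "f analytic_on {t}" if "f \<in> R a b" for f
    using that t unfolding R_def determined_near_def by (metis (no_types, lifting) analytic_on_subset
      bot_least insert_subset mem_Collect_eq)
  have lin: "(\<lambda>z. f z - c * m z ^ l) \<in> R a b" if fm: "f \<in> R a b" "m \<in> R a b" "c \<in> \<real>" for f m c l
  proof -
    have an: "(\<lambda>z. f z - c * m z ^ l) analytic_on ?I"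
      using fm by (intro analytic_intros) (auto simp: R_def determined_near_def)
    have "determined_near F ?I (\<lambda>z. f z - c * m z ^ l)"
      by (rule determined_near_combine[of F ?I f m _ UNIV "{}" "\<lambda>x y. x - c * y ^ l"])
         (use fm an in \<open>auto simp: R_def\<close>)
    moreover have "f z - c * m z ^ l \<in> \<real>" if "z \<in> ?I" for z
    proof -
      have "f z \<in> \<real>" "m z \<in> \<real>" using \<open>f \<in> R a b\<close> \<open>m \<in> R a b\<close> that by (auto simp: R_def)
      then show ?thesis using \<open>c \<in> \<real>\<close> by simp
    qed
    ultimately show ?thesis by (auto simp: R_def)
  qed
  show "\<exists>c u. (\<lambda>z. f z - c * m z ^ l) \<in> R a b \<and> u analytic_on {t} \<and>
         (\<forall>\<^sub>F z in nhds t. f z - c * m z ^ l = (z - t) ^ Suc (l * k) * u z)"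
    if fm: "f \<in> R a b" "m \<in> R a b" "vanishes_to_order f t (l * k)" "vanishes_to_order m t k" for f m l k
  proof (rule leading_term_cancel[OF fm(3,4)])
    fix c u uf um
    assume u: "u analytic_on {t}" "\<forall>\<^sub>F z in nhds t. f z - c * m z ^ l = (z - t) ^ Suc (l * k) * u z"
      and uf: "uf analytic_on {t}" "\<forall>\<^sub>F z in nhds t. f z = (z - t) ^ (l * k) * uf z"
      and um: "um analytic_on {t}" "\<forall>\<^sub>F z in nhds t. m z = (z - t) ^ k * um z"
      and c: "c = uf t / um t ^ l"
    have "uf t \<in> \<real>" "um t \<in> \<real>"
      using real_leading_coefficient[OF ab t _ uf] real_leading_coefficient[OF ab t _ um] fm
      by (auto simp: R_def)
    then have "c \<in> \<real>" by (simp add: c)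
    with lin fm u show ?thesis by blast
  qed
  show "\<exists>h\<in>R a b. vanishes_to_order h t (n - p)"
    if fg: "f \<in> R a b" "g \<in> R a b" "vanishes_to_order f t n" "vanishes_to_order g t p" "p < n" for f g n p
  proof -
    have f: "determined_near F ?I f" "f ` ?I \<subseteq> \<real>" and g: "determined_near F ?I g" "g ` ?I \<subseteq> \<real>"
      using fg by (auto simp: R_def)
    obtain h where "determined_near F ?I h" "h ` ?I \<subseteq> \<real>" "vanishes_to_order h t (n - p)"
      by (rule bounded_quotient[OF ab t f fg(3) g fg(4,5)])
    then show ?thesis unfolding R_def by blast
  qed
  have one: "(\<lambda>_. 1) \<in> R a b"
    by (auto simp: R_def determined_near_const)
  have f0t: "f\<^sub>0 t \<in> \<real>" using f0(1) t by (auto simp: R_def)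
  have "f\<^sub>0 analytic_on {t}"
    using f0(1) t unfolding R_def determined_near_def
    by (metis (no_types, lifting) analytic_on_subset bot_least insert_subset mem_Collect_eq)
  then obtain n where "n > 0" "vanishes_to_order (\<lambda>z. f\<^sub>0 z - f\<^sub>0 t) t n"
    using vanishes_to_order_positive f0(2) by blast
  then show "\<exists>f\<in>R a b. \<exists>n>0. vanishes_to_order f t n"
    using lin[OF f0(1) one f0t, of 1] by auto
qed (rule that; assumption)

text \<open>
  At a single point there are no other poles to avoid, so the plain quotient serves.
\<close>
lemma generator_at_point:
  fixes F :: "complex \<Rightarrow> 'a"
  defines "R \<equiv> \<lambda>t. {f. determined_near F {t} f}"
  assumes f0: "f\<^sub>0 \<in> R t" "\<not> (\<forall>\<^sub>F z in nhds t. f\<^sub>0 z = f\<^sub>0 t)"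
  obtains m k where "m \<in> R t" "k > 0" "vanishes_to_order m t k"
    "\<And>f. f \<in> R t \<Longrightarrow> \<exists>g. g analytic_on {0} \<and> (\<forall>\<^sub>F z in nhds t. f z = g (m z))"
proof (rule generator_of_local_functions[of "R t" t])
  show an: "f analytic_on {t}" if "f \<in> R t" for f
    using that unfolding R_def determined_near_def by blast
  have lin: "(\<lambda>z. f z - c * m z ^ l) \<in> R t" if fm: "f \<in> R t" "m \<in> R t" for f m c l
  proof -
    have an': "(\<lambda>z. f z - c * m z ^ l) analytic_on {t}"
      using fm by (intro analytic_intros an)
    have "determined_near F {t} (\<lambda>z. f z - c * m z ^ l)"
      by (rule determined_near_combine[of F "{t}" f m _ UNIV "{}" "\<lambda>x y. x - c * y ^ l"])
         (use fm an' in \<open>auto simp: R_def\<close>)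
    then show ?thesis by (simp add: R_def)
  qed
  show "\<exists>c u. (\<lambda>z. f z - c * m z ^ l) \<in> R t \<and> u analytic_on {t} \<and>
         (\<forall>\<^sub>F z in nhds t. f z - c * m z ^ l = (z - t) ^ Suc (l * k) * u z)"
    if fm: "f \<in> R t" "m \<in> R t" "vanishes_to_order f t (l * k)" "vanishes_to_order m t k" for f m l k
    by (rule leading_term_cancel[OF fm(3,4)]) (use lin[OF fm(1,2)] in blast)
  show "\<exists>h\<in>R t. vanishes_to_order h t (n - p)"
    if fg: "f \<in> R t" "g \<in> R t" "vanishes_to_order f t n" "vanishes_to_order g t p" "p < n" for f g n p
  proof -
    obtain u where u: "u analytic_on {t}" "u t \<noteq> 0" "\<forall>\<^sub>F z in nhds t. f z = (z - t) ^ n * u z"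
      using fg(3) unfolding vanishes_to_order_def by blast
    obtain v where v: "v analytic_on {t}" "v t \<noteq> 0" "\<forall>\<^sub>F z in nhds t. g z = (z - t) ^ p * v z"
      using fg(4) unfolding vanishes_to_order_def by blast
    define h where "h z = (z - t) ^ (n - p) * (u z / v z)" for z
    have w: "(\<lambda>z. u z / v z) analytic_on {t}" by (intro analytic_intros u v) (use v in auto)
    have h: "h analytic_on {t}" unfolding h_def by (intro analytic_intros w)
    have "\<forall>\<^sub>F z in nhds t. z \<noteq> t \<longrightarrow> h z = f z / g z"
      using u(3) v(3)
    proof eventually_elim
      case (elim z)
      have "(z - t) ^ n = (z - t) ^ p * (z - t) ^ (n - p)" using fg(5) by (simp flip: power_add)
      then show ?case using elim by (simp add: h_def)
    qed
    then obtain W where W: "open W" "t \<in> W" "\<And>z. z \<in> W - {t} \<Longrightarrow> h z = f z / g z"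
      by (auto simp: eventually_nhds)
    have "determined_near F {t} h"
      by (rule determined_near_combine[of F "{t}" f g h W "{t}" "(/)"])
         (use fg h W in \<open>auto simp: R_def\<close>)
    then have "h \<in> R t" by (simp add: R_def)
    moreover have "vanishes_to_order h t (n - p)"
      unfolding vanishes_to_order_def h_def using w u v by (intro exI[of _ "\<lambda>z. u z / v z"]) auto
    ultimately show ?thesis by blast
  qed
  have one: "(\<lambda>_. 1) \<in> R t"
    by (auto simp: R_def determined_near_const)
  obtain n where "n > 0" "vanishes_to_order (\<lambda>z. f\<^sub>0 z - f\<^sub>0 t) t n"
    using vanishes_to_order_positive f0(2) an[OF f0(1)] by blast
  then show "\<exists>f\<in>R t. \<exists>n>0. vanishes_to_order f t n"
    using lin[OF f0(1) one, of "f\<^sub>0 t" 1] by auto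
qed (rule that; assumption)

section \<open>Unit-speed parametrization\<close>

lemma real_derivative_along_interval:
  assumes "a < b" "x \<in> real_interval a b" "f ` real_interval a b \<subseteq> \<real>" "f analytic_on {x}"
  shows "deriv f x \<in> \<real>"
proof -
  have an: "(\<lambda>z. f z - f x) analytic_on {x}" using assms(4) by (intro analytic_intros)
  obtain q where q: "q analytic_on {x}" "\<forall>\<^sub>F z in nhds x. f z - f x = (z - x) * q z"
    by (rule analytic_at_zero_factor[OF an]) auto
  have "f x \<in> \<real>" using assms(2,3) by blast
  then have "(\<lambda>z. f z - f x) ` real_interval a b \<subseteq> \<real>" using assms(3) by auto
  then have "q x \<in> \<real>"
    using real_leading_coefficient[OF assms(1,2) _ q(1), of _ 1] q(2) by simp
  moreover have "((\<lambda>z. f x + (z - x) * q z) has_field_derivative q x) (at x)"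
  proof -
    have "(q has_field_derivative deriv q x) (at x)"
      using q(1) by (simp add: analytic_on_imp_differentiable_at field_differentiable_derivI)
    then show ?thesis by (auto intro!: derivative_eq_intros)
  qed
  then have "deriv (\<lambda>z. f x + (z - x) * q z) x = q x" by (rule DERIV_imp_deriv)
  moreover have "deriv f x = deriv (\<lambda>z. f x + (z - x) * q z) x"
    by (rule deriv_cong_ev) (use q(2) in \<open>auto elim!: eventually_mono simp: algebra_simps\<close>)
  ultimately show ?thesis by simp
qed

lemma real_if_square_nonneg:
  fixes w :: complex
  assumes "w ^ 2 = of_real r" "r \<ge> 0"
  shows "w \<in> \<real>"
proof -
  have "w ^ 2 = of_real (sqrt r) ^ 2" using assms by (simp flip: of_real_power)
  then have "w = of_real (sqrt r) \<or> w = - of_real (sqrt r)" by (simp add: power2_eq_iff)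
  then show ?thesis by auto
qed

lemma real_along_interval_if_derivative_real:
  assumes \<theta>: "\<theta> holomorphic_on V" "open V" "real_interval x y \<subseteq> V"
    and d: "\<And>w. w \<in> real_interval x y \<Longrightarrow> deriv \<theta> w \<in> \<real>"
    and t: "t \<in> real_interval x y" "\<theta> t \<in> \<real>"
  shows "\<theta> ` real_interval x y \<subseteq> \<real>"
proof -
  have "((\<lambda>r. Im (\<theta> (of_real r))) has_field_derivative 0) (at r within {x..y})" if r: "r \<in> {x..y}" for r
  proof -
    have m: "of_real r \<in> real_interval x y" using r by (auto simp: real_interval_def)
    then have "(\<theta> has_field_derivative deriv \<theta> (of_real r)) (at (of_real r))"
      using \<theta> by (intro holomorphic_derivI[of \<theta> V]) auto
    then have "((\<lambda>r. \<theta> (of_real r)) has_vector_derivative deriv \<theta> (of_real r)) (at r within {x..y})"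
      using has_vector_derivative_real_field has_vector_derivative_at_within by blast
    then have "((\<lambda>r. Im (\<theta> (of_real r))) has_vector_derivative Im (deriv \<theta> (of_real r))) (at r within {x..y})"
      by (rule bounded_linear.has_vector_derivative[OF bounded_linear_Im])
    moreover have "Im (deriv \<theta> (of_real r)) = 0" using d[OF m] by (simp add: complex_is_Real_iff)
    ultimately show ?thesis by (simp add: has_real_derivative_iff_has_vector_derivative)
  qed
  then obtain c where c: "\<And>r. r \<in> {x..y} \<Longrightarrow> Im (\<theta> (of_real r)) = c"
    using has_field_derivative_zero_constant[of "{x..y}" "\<lambda>r. Im (\<theta> (of_real r))"] by auto
  obtain r0 where r0: "r0 \<in> {x..y}" "t = of_real r0" using t(1) by (auto simp: real_interval_def)
  then have "c = 0" using c[OF r0(1)] t(2) by (simp add: complex_is_Real_iff)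
  then show ?thesis using c by (auto simp: real_interval_def complex_is_Real_iff)
qed

text \<open>
  The curve \<open>\<Gamma>\<close>, traversed with parameter \<open>\<theta>\<close>, gives the family \<open>f\<close>.  The last condition is
  unit speed, written with the holomorphic square of the velocity so that it makes sense off the reals.
\<close>
definition unit_speed_factorization ::
    "'i set \<Rightarrow> ('i \<Rightarrow> complex \<Rightarrow> complex) \<Rightarrow> complex set \<Rightarrow> complex set \<Rightarrow> (complex \<Rightarrow> complex)
       \<Rightarrow> complex set \<Rightarrow> ('i \<Rightarrow> complex \<Rightarrow> complex) \<Rightarrow> bool" where
  "unit_speed_factorization A f K V \<theta> W \<Gamma> \<longleftrightarrow>
     open V \<and> convex V \<and> K \<subseteq> V \<and> \<theta> holomorphic_on V \<and> \<theta> ` K \<subseteq> \<real> \<and>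
     open W \<and> convex W \<and> \<theta> ` V \<subseteq> W \<and>
     (\<forall>i\<in>A. \<Gamma> i holomorphic_on W \<and> (\<forall>z\<in>V. f i z = \<Gamma> i (\<theta> z))) \<and>
     (\<forall>s\<in>W. (\<Sum>i\<in>A. deriv (\<Gamma> i) s ^ 2) = 1)"

lemma unit_speed_factorizationD:
  assumes "unit_speed_factorization A f K V \<theta> W \<Gamma>"
  shows "open V" "convex V" "K \<subseteq> V" "\<theta> holomorphic_on V" "\<theta> ` K \<subseteq> \<real>"
    "open W" "convex W" "\<theta> ` V \<subseteq> W" "\<And>i. i \<in> A \<Longrightarrow> \<Gamma> i holomorphic_on W"
    "\<And>i z. i \<in> A \<Longrightarrow> z \<in> V \<Longrightarrow> f i z = \<Gamma> i (\<theta> z)"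
    "\<And>s. s \<in> W \<Longrightarrow> (\<Sum>i\<in>A. deriv (\<Gamma> i) s ^ 2) = 1"
  using assms unfolding unit_speed_factorization_def by auto

lemma deriv_comp_holomorphic:
  assumes "\<theta> holomorphic_on V" "open V" "z \<in> V" "g holomorphic_on W" "open W" "\<theta> z \<in> W"
  shows "deriv (\<lambda>z. g (\<theta> z)) z = deriv g (\<theta> z) * deriv \<theta> z"
proof -
  have "\<theta> field_differentiable at z" "g field_differentiable at (\<theta> z)"
    using assms by (auto intro: holomorphic_on_imp_differentiable_at)
  then show ?thesis using deriv_chain[of \<theta> z g] by (simp add: o_def)
qed

lemma eventually_analytic_at:
  assumes "f analytic_on {t}"
  shows "\<forall>\<^sub>F z in nhds t. f analytic_on {z}"
proof -
  obtain S where "open S" "t \<in> S" "f holomorphic_on S" using assms analytic_at by blast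
  then show ?thesis unfolding eventually_nhds using analytic_at by blast
qed

lemma deriv_cong_open:
  assumes "open S" "z \<in> S" "\<And>x. x \<in> S \<Longrightarrow> f x = g x"
  shows "deriv f z = deriv g z"
  by (rule deriv_cong_ev) (use assms in \<open>auto simp: eventually_nhds\<close>)

text \<open>
  In terms of the local parameter \<open>m\<close> the squared speed is \<open>S = \<Sum> (g\<^sub>i')\<^sup>2\<close>.  The derivatives
  \<open>g\<^sub>i'\<close> are real at \<open>m t\<close> and not all zero, so \<open>S\<close> has a holomorphic square root near \<open>m t\<close>.  Its
  primitive \<open>R\<close> is invertible, \<open>\<theta> = R \<circ> m\<close> is the arc length, and \<open>\<Gamma>\<^sub>i = g\<^sub>i \<circ> R\<^sup>-\<^sup>1\<close>.  The square of
  \<open>\<theta>'\<close> is the sum of the \<open>(f\<^sub>i')\<^sup>2\<close>, which is nonnegative on the interval, so \<open>\<theta>\<close> is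
  real there.
\<close>
lemma unit_speed_local:
  fixes f :: "'i \<Rightarrow> complex \<Rightarrow> complex"
  assumes ab: "a < b" and A: "finite A" and t: "t \<in> {a..b}"
    and f: "\<And>i. i \<in> A \<Longrightarrow> f i ` real_interval a b \<subseteq> \<real>"
    and m: "m analytic_on {of_real t}" "m ` real_interval a b \<subseteq> \<real>"
      "\<not> (\<forall>\<^sub>F z in nhds (of_real t). m z = m (of_real t))"
    and g: "\<And>i. i \<in> A \<Longrightarrow> g i analytic_on {m (of_real t)}"
      "\<And>i. i \<in> A \<Longrightarrow> \<forall>\<^sub>F z in nhds (of_real t). f i z = g i (m z)"
    and imm: "\<exists>i\<in>A. deriv (g i) (m (of_real t)) \<noteq> 0"
  shows "\<exists>d>0. \<forall>x y. a \<le> x \<and> y \<le> b \<and> x \<le> t \<and> t \<le> y \<and> y - x < d \<longrightarrow>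
     (\<exists>V \<theta> W \<Gamma>. unit_speed_factorization A f (real_interval x y) V \<theta> W \<Gamma>)"
proof -
  define T u0 where "T = complex_of_real t" and "u0 = m T"
  have TI: "T \<in> real_interval a b" using t by (auto simp: T_def real_interval_def)
  note m = m[folded T_def] and g = g[folded T_def, folded u0_def] and imm = imm[folded T_def, folded u0_def]
  \<comment> \<open>The difference quotients of \<open>f i\<close> by \<open>m\<close> along the interval are real, hence so is their limit.\<close>
  have gr: "deriv (g i) u0 \<in> \<real>" if i: "i \<in> A" for i
  proof -
    have an: "(\<lambda>u. g i u - g i u0) analytic_on {u0}" using g(1)[OF i] by (intro analytic_intros)
    obtain q where q: "q analytic_on {u0}" "\<forall>\<^sub>F u in nhds u0. g i u - g i u0 = (u - u0) * q u"
      by (rule analytic_at_zero_factor[OF an]) auto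
    have "(q has_field_derivative deriv q u0) (at u0)"
      using q(1) by (simp add: analytic_on_imp_differentiable_at field_differentiable_derivI)
    then have "((\<lambda>u. g i u0 + (u - u0) * q u) has_field_derivative q u0) (at u0)"
      by (auto intro!: derivative_eq_intros)
    then have "deriv (\<lambda>u. g i u0 + (u - u0) * q u) u0 = q u0" by (rule DERIV_imp_deriv)
    moreover have "deriv (g i) u0 = deriv (\<lambda>u. g i u0 + (u - u0) * q u) u0"
      by (rule deriv_cong_ev) (use q(2) in \<open>auto elim!: eventually_mono simp: algebra_simps\<close>)
    ultimately have dq: "deriv (g i) u0 = q u0" by simp
    have qm: "(\<lambda>z. q (m z)) analytic_on {T}"
      using analytic_on_compose[OF m(1), of q] q(1) by (simp add: o_def u0_def)
    have limm: "filterlim m (nhds u0) (nhds T)"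
      using analytic_at_imp_isCont[OF m(1)] unfolding isCont_def u0_def
      by (simp add: tendsto_at_iff_tendsto_nhds)
    obtain k where "vanishes_to_order (\<lambda>z. m z - m T) T k"
      using vanishes_to_order_positive[OF m(1,3)] by metis
    then obtain u where u: "u analytic_on {T}" "u T \<noteq> 0" "\<forall>\<^sub>F z in nhds T. m z - m T = (z - T) ^ k * u z"
      unfolding vanishes_to_order_def by blast
    have "\<forall>\<^sub>F z in nhds T. z \<noteq> T \<longrightarrow> z \<in> real_interval a b \<longrightarrow> q (m z) \<in> \<real>"
      using eventually_compose_filterlim[OF q(2) limm] g(2)[OF i] u(3) analytic_at_nonzero_eventually[OF u(1,2)]
    proof eventually_elim
      case (elim z)
      show ?case
      proof (intro impI)
        assume z: "z \<noteq> T" "z \<in> real_interval a b"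
        then have ne: "m z - u0 \<noteq> 0" using elim by (simp add: u0_def)
        have "f i T = g i u0"
          using eventually_nhds_x_imp_x[OF g(2)[OF i]] by (simp add: u0_def)
        then have "q (m z) = (f i z - f i T) / (m z - m T)"
          using elim ne by (simp add: u0_def)
        moreover have "f i z \<in> \<real>" "f i T \<in> \<real>" "m z \<in> \<real>" "m T \<in> \<real>"
          using f[OF i] m(2) z(2) TI by blast+
        ultimately show "q (m z) \<in> \<real>" by simp
      qed
    qed
    then have "\<forall>\<^sub>F z in at T within real_interval a b. q (m z) \<in> \<real>"
      unfolding eventually_at_filter .
    then have "q (m T) \<in> \<real>" by (rule real_limit_along_interval[OF ab TI qm])
    with dq show ?thesis by (simp add: u0_def)
  qed
  define S where "S u = (\<Sum>i\<in>A. deriv (g i) u ^ 2)" for u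
  have S0: "S u0 \<noteq> 0"
  proof -
    obtain i where i: "i \<in> A" "deriv (g i) u0 \<noteq> 0" using imm by blast
    have "deriv (g i) u0 ^ 2 = of_real (Re (deriv (g i) u0) ^ 2)" if "i \<in> A" for i
      using gr[OF that] by (simp add: complex_is_Real_iff complex_eq_iff power2_eq_square)
    then have "S u0 = of_real (\<Sum>i\<in>A. Re (deriv (g i) u0) ^ 2)" by (simp add: S_def)
    moreover have "(\<Sum>i\<in>A. Re (deriv (g i) u0) ^ 2) > 0"
      using i gr[OF i(1)] A by (intro sum_pos2[of _ i]) (auto simp: complex_is_Real_iff complex_eq_iff)
    ultimately show ?thesis by (metis less_irrefl of_real_eq_0_iff)
  qed
  have San: "S analytic_on {u0}" unfolding S_def by (intro analytic_intros analytic_deriv g)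
  have "\<forall>\<^sub>F u in nhds u0. \<forall>i\<in>A. g i analytic_on {u}"
    using A g(1) by (intro eventually_ball_finite) (auto simp: eventually_analytic_at)
  with analytic_at_nonzero_eventually[OF San S0]
  have "\<forall>\<^sub>F u in nhds u0. S u \<noteq> 0 \<and> (\<forall>i\<in>A. g i analytic_on {u})" by (rule eventually_conj)
  then obtain Y0 where Y0: "open Y0" "u0 \<in> Y0" "\<And>u. u \<in> Y0 \<Longrightarrow> S u \<noteq> 0"
     "\<And>u i. u \<in> Y0 \<Longrightarrow> i \<in> A \<Longrightarrow> g i analytic_on {u}"
    unfolding eventually_nhds by blast
  obtain \<epsilon> where \<epsilon>: "\<epsilon> > 0" "ball u0 \<epsilon> \<subseteq> Y0" using Y0(1,2) open_contains_ball by blast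
  define Y where "Y = ball u0 \<epsilon>"
  have Y: "open Y" "convex Y" "u0 \<in> Y" "\<And>u. u \<in> Y \<Longrightarrow> S u \<noteq> 0" using \<epsilon> Y0 by (auto simp: Y_def)
  have gY: "g i holomorphic_on Y" if "i \<in> A" for i
  proof -
    have "g i analytic_on Y" using Y0(4) \<epsilon> that by (subst analytic_on_analytic_at) (auto simp: Y_def)
    then show ?thesis by (rule analytic_imp_holomorphic)
  qed
  have SY: "S holomorphic_on Y" unfolding S_def by (intro holomorphic_intros holomorphic_deriv gY Y)
  obtain \<rho> where \<rho>: "\<rho> holomorphic_on Y" "\<And>u. u \<in> Y \<Longrightarrow> S u = \<rho> u ^ 2"
    by (rule contractible_imp_holomorphic_sqrt[OF SY convex_imp_contractible[OF Y(2)] Y(4)]) auto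
  obtain R0 where R0: "\<And>u. u \<in> Y \<Longrightarrow> (R0 has_field_derivative \<rho> u) (at u)"
    using holomorphic_convex_primitive'[OF Y(2,1) \<rho>(1)] at_within_open[OF _ Y(1)] by metis
  define R where "R u = R0 u - R0 u0" for u
  have R: "(R has_field_derivative \<rho> u) (at u)" if "u \<in> Y" for u
    unfolding R_def using R0[OF that] by (auto intro!: derivative_eq_intros)
  have Rhol: "R holomorphic_on Y" using R Y(1) by (auto simp: holomorphic_on_open)
  have dR: "deriv R u = \<rho> u" if "u \<in> Y" for u using R[OF that] by (rule DERIV_imp_deriv)
  have "deriv R u0 \<noteq> 0" using dR \<rho>(2) Y(3,4) by (metis power_zero_numeral)
  then obtain r \<psi> where r: "r > 0" "ball u0 r \<subseteq> Y" "open (R ` ball u0 r)"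
    "\<psi> holomorphic_on R ` ball u0 r" "\<And>x. x \<in> ball u0 r \<Longrightarrow> \<psi> (R x) = x"
    "\<And>x. x \<in> ball u0 r \<Longrightarrow> deriv R x * deriv \<psi> (R x) = 1"
    using holomorphic_local_inverse[OF Rhol Y(1,3)] by metis
  have "0 \<in> R ` ball u0 r" using r(1) by (intro image_eqI[of _ _ u0]) (auto simp: R_def)
  then obtain s where s: "s > 0" "ball 0 s \<subseteq> R ` ball u0 r" using r(3) open_contains_ball by blast
  define W where "W = ball (0::complex) s"
  define \<Gamma> where "\<Gamma> i w = g i (\<psi> w)" for i w
  have \<psi>W: "\<psi> w \<in> ball u0 r \<and> R (\<psi> w) = w" if w: "w \<in> W" for w
  proof -
    obtain x where "x \<in> ball u0 r" "w = R x" using w s(2) by (auto simp: W_def)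
    then show ?thesis using r(5) by simp
  qed
  have \<psi>hol: "\<psi> holomorphic_on W" using r(4) s(2) unfolding W_def by (rule holomorphic_on_subset)
  have \<Gamma>: "\<Gamma> i holomorphic_on W" if "i \<in> A" for i
    unfolding \<Gamma>_def
    by (rule holomorphic_on_compose_gen[OF \<psi>hol gY[OF that], unfolded o_def]) (use \<psi>W r(2) in auto)
  have unit: "(\<Sum>i\<in>A. deriv (\<Gamma> i) w ^ 2) = 1" if w: "w \<in> W" for w
  proof -
    have x: "\<psi> w \<in> ball u0 r" "R (\<psi> w) = w" "\<psi> w \<in> Y" using \<psi>W[OF w] r(2) by auto
    have "\<rho> (\<psi> w) * deriv \<psi> w = 1" using r(6)[OF x(1)] dR[OF x(3)] x(2) by simp
    moreover have "deriv (\<Gamma> i) w = deriv (g i) (\<psi> w) * deriv \<psi> w" if "i \<in> A" for i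
      unfolding \<Gamma>_def
      by (rule deriv_comp_holomorphic[OF \<psi>hol _ w gY[OF that] Y(1) x(3)]) (simp add: W_def)
    then have "(\<Sum>i\<in>A. deriv (\<Gamma> i) w ^ 2) = S (\<psi> w) * deriv \<psi> w ^ 2"
      by (simp add: S_def sum_distrib_right power_mult_distrib)
    ultimately show ?thesis using \<rho>(2)[OF x(3)] by (metis power_mult_distrib power_one)
  qed
  have contR: "continuous_on (ball u0 r) R"
    using Rhol r(2) by (meson continuous_on_subset holomorphic_on_imp_continuous_on)
  have "open (ball u0 r \<inter> R -` W)" by (intro continuous_open_preimage contR) (auto simp: W_def)
  moreover have "u0 \<in> ball u0 r \<inter> R -` W" using r(1) s(1) by (simp add: W_def R_def)
  ultimately have "\<forall>\<^sub>F u in nhds u0. u \<in> ball u0 r \<inter> R -` W" by (rule eventually_nhds_in_open)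
  moreover have "filterlim m (nhds u0) (nhds T)"
    using analytic_at_imp_isCont[OF m(1)] unfolding isCont_def u0_def
    by (simp add: tendsto_at_iff_tendsto_nhds)
  ultimately have "\<forall>\<^sub>F z in nhds T. m z \<in> ball u0 r \<inter> R -` W"
    by (rule eventually_compose_filterlim)
  moreover have "\<forall>\<^sub>F z in nhds T. \<forall>i\<in>A. f i z = g i (m z)"
    using A g(2) by (intro eventually_ball_finite) auto
  moreover have "\<forall>\<^sub>F z in nhds T. m analytic_on {z}" using m(1) by (simp add: eventually_analytic_at)
  ultimately have "\<forall>\<^sub>F z in nhds T. m z \<in> ball u0 r \<inter> R -` W \<and> (\<forall>i\<in>A. f i z = g i (m z)) \<and> m analytic_on {z}"
    by eventually_elim blast
  then obtain d where d: "d > 0" "\<And>z. z \<in> ball T d \<Longrightarrow> m z \<in> ball u0 r \<inter> R -` W"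
     "\<And>z i. z \<in> ball T d \<Longrightarrow> i \<in> A \<Longrightarrow> f i z = g i (m z)" "\<And>z. z \<in> ball T d \<Longrightarrow> m analytic_on {z}"
    unfolding eventually_nhds_metric by (auto simp: dist_commute)
  define V where "V = ball T d"
  define \<theta> where "\<theta> z = R (m z)" for z
  have mV: "m holomorphic_on V"
    using d(4) analytic_imp_holomorphic analytic_on_analytic_at V_def by blast
  have mY: "m z \<in> Y" if "z \<in> V" for z using d(2) that r(2) by (auto simp: V_def)
  have \<theta>hol: "\<theta> holomorphic_on V"
    unfolding \<theta>_def by (rule holomorphic_on_compose_gen[OF mV Rhol, unfolded o_def]) (use mY in auto)
  have fV: "f i z = \<Gamma> i (\<theta> z)" if "i \<in> A" "z \<in> V" for i z
    using d(2,3) that r(5) by (simp add: V_def \<Gamma>_def \<theta>_def)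
  have dreal: "deriv \<theta> z \<in> \<real>" if z: "z \<in> V" "z \<in> real_interval a b" for z
  proof -
    have fd: "deriv (f i) z = deriv (g i) (m z) * deriv m z" if i: "i \<in> A" for i
    proof -
      have "deriv (f i) z = deriv (\<lambda>z. g i (m z)) z"
        by (rule deriv_cong_open[of V]) (use z d(3) i in \<open>auto simp: V_def\<close>)
      also have "\<dots> = deriv (g i) (m z) * deriv m z"
        by (rule deriv_comp_holomorphic[OF mV _ z(1) gY[OF i] Y(1) mY[OF z(1)]]) (simp add: V_def)
      finally show ?thesis .
    qed
    have fr: "deriv (f i) z \<in> \<real>" if i: "i \<in> A" for i
    proof -
      have "(\<lambda>z. g i (m z)) holomorphic_on V"
        by (rule holomorphic_on_compose_gen[OF mV gY[OF i], unfolded o_def]) (use mY in auto)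
      then have "f i holomorphic_on V"
        by (rule holomorphic_transform) (use d(3) i in \<open>auto simp: V_def\<close>)
      then have "f i analytic_on {z}" using z(1) analytic_at V_def by blast
      then show ?thesis by (rule real_derivative_along_interval[OF ab z(2) f[OF i]])
    qed
    have "deriv \<theta> z = \<rho> (m z) * deriv m z"
      unfolding \<theta>_def using deriv_comp_holomorphic[OF mV _ z(1) Rhol Y(1) mY[OF z(1)]] dR[OF mY[OF z(1)]]
      by (simp add: V_def)
    then have "deriv \<theta> z ^ 2 = S (m z) * deriv m z ^ 2" using \<rho>(2)[OF mY[OF z(1)]] by (simp add: power_mult_distrib)
    also have "\<dots> = (\<Sum>i\<in>A. deriv (f i) z ^ 2)"
      by (simp add: S_def sum_distrib_right fd power_mult_distrib)
    also have "\<dots> = of_real (\<Sum>i\<in>A. Re (deriv (f i) z) ^ 2)"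
    proof -
      have "deriv (f i) z ^ 2 = of_real (Re (deriv (f i) z) ^ 2)" if "i \<in> A" for i
        using fr[OF that] by (simp add: complex_is_Real_iff complex_eq_iff power2_eq_square)
      then show ?thesis by simp
    qed
    finally show ?thesis by (rule real_if_square_nonneg) (simp add: sum_nonneg)
  qed
  have "unit_speed_factorization A f (real_interval x y) V \<theta> W \<Gamma>"
    if xy: "a \<le> x" "y \<le> b" "x \<le> t" "t \<le> y" "y - x < d" for x y
  proof -
    have I: "real_interval x y \<subseteq> V" "real_interval x y \<subseteq> real_interval a b" "T \<in> real_interval x y"
      using xy by (auto simp: V_def T_def real_interval_def dist_norm simp flip: of_real_diff)
    have "\<theta> T = 0" by (simp add: \<theta>_def R_def u0_def)
    have dI: "deriv \<theta> w \<in> \<real>" if "w \<in> real_interval x y" for w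
      using dreal I(1,2) that by blast
    have "\<theta> ` real_interval x y \<subseteq> \<real>"
      by (rule real_along_interval_if_derivative_real[OF \<theta>hol _ I(1) dI I(3)])
         (simp_all add: V_def \<open>\<theta> T = 0\<close>)
    then show ?thesis
      unfolding unit_speed_factorization_def
      using I(1) \<theta>hol \<Gamma> fV unit d(2) by (auto simp: V_def W_def \<theta>_def)
  qed
  then show ?thesis using d(1) by blast
qed

lemma holomorphic_square_eq:
  assumes f: "f holomorphic_on S" "g holomorphic_on S" "open S" "connected S"
    and eq: "\<And>z. z \<in> S \<Longrightarrow> f z ^ 2 = g z ^ 2"
  obtains e :: complex where "e = 1 \<or> e = -1" "\<And>z. z \<in> S \<Longrightarrow> f z = e * g z"
proof (cases "\<forall>z\<in>S. f z = g z")
  case True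
  then show thesis using that[of 1] by simp
next
  case False
  then obtain z0 where z0: "z0 \<in> S" "f z0 - g z0 \<noteq> 0" by auto
  have "continuous_on S (\<lambda>z. f z - g z)"
    using f by (intro continuous_intros holomorphic_on_imp_continuous_on)
  then have "open (S \<inter> (\<lambda>z. f z - g z) -` (- {0}))"
    by (intro continuous_open_preimage f) auto
  moreover have "f z = - g z" if "z \<in> S \<inter> (\<lambda>z. f z - g z) -` (- {0})" for z
    using eq[of z] that by (auto simp: power2_eq_iff)
  ultimately have op: "open (S \<inter> (\<lambda>z. f z - g z) -` (- {0}))"
    and neg: "\<And>z. z \<in> S \<inter> (\<lambda>z. f z - g z) -` (- {0}) \<Longrightarrow> f z = - g z" by blast+
  have ne: "S \<inter> (\<lambda>z. f z - g z) -` (- {0}) \<noteq> {}" using z0 by auto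
  have "f z = - g z" if "z \<in> S" for z
    using analytic_continuation_open[OF op f(3) ne f(4) Int_lower1 f(1) holomorphic_on_minus[OF f(2)] neg that] .
  then show thesis using that[of "-1"] by simp
qed

lemma connected_real_imp_convex:
  fixes J :: "complex set"
  assumes "connected J" "J \<subseteq> \<real>"
  shows "convex J"
proof -
  have "connected (Re ` J)" by (intro connected_continuous_image continuous_intros assms)
  then have "convex (Re ` J)" by (metis is_interval_connected_1 is_interval_convex_1)
  then have "convex (complex_of_real ` Re ` J)"
    by (rule convex_linear_image[rotated]) (auto intro: linearI simp: scaleR_conv_of_real)
  moreover have "complex_of_real (Re z) = z" if "z \<in> J" for z
    using assms(2) that by (simp add: subset_iff)
  then have "complex_of_real ` Re ` J = J" by (auto simp: image_image)
  ultimately show ?thesis by simp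
qed

text \<open>
  Arc length may be reversed and shifted.
\<close>
lemma unit_speed_affine:
  assumes u: "unit_speed_factorization A f K V \<theta> W \<Gamma>" and e: "e = 1 \<or> e = -1" and c: "c \<in> \<real>"
  shows "unit_speed_factorization A f K V (\<lambda>z. e * \<theta> z + c)
           ((\<lambda>w. e * (w - c)) -` W) (\<lambda>i w. \<Gamma> i (e * (w - c)))"
proof -
  have ee: "e * e = 1" "e * (e * x) = x" for x using e by auto
  let ?l = "\<lambda>w. e * (w - c)"
  note V = unit_speed_factorizationD[OF u]
  have op: "open (?l -` W)" by (intro open_vimage V continuous_intros)
  have "?l -` W = (\<lambda>w. c + e * w) ` W"
  proof (intro set_eqI iffI)
    fix w assume "w \<in> ?l -` W"
    then show "w \<in> (\<lambda>w. c + e * w) ` W" by (intro image_eqI[of _ _ "?l w"]) (auto simp: ee)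
  qed (auto simp: ee)
  also have "\<dots> = (\<lambda>w. c + w) ` (\<lambda>w. e * w) ` W" by (simp add: image_image)
  finally have "convex (?l -` W)"
    using V(7) by (simp add: convex_translation convex_linear_image linear_times)
  moreover have hol: "(\<lambda>w. \<Gamma> i (?l w)) holomorphic_on ?l -` W" if "i \<in> A" for i
    by (rule holomorphic_on_compose_gen[OF _ V(9)[OF that], of ?l, unfolded o_def])
       (auto intro!: holomorphic_intros)
  moreover have "(\<Sum>i\<in>A. deriv (\<lambda>w. \<Gamma> i (?l w)) s ^ 2) = 1" if s: "s \<in> ?l -` W" for s
  proof -
    have "deriv (\<lambda>w. \<Gamma> i (?l w)) s = deriv (\<Gamma> i) (?l s) * e" if i: "i \<in> A" for i
    proof -
      have "(?l has_field_derivative e) (at s)" by (auto intro!: derivative_eq_intros)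
      then have "deriv ?l s = e" by (rule DERIV_imp_deriv)
      moreover have "?l holomorphic_on ?l -` W" by (intro holomorphic_intros)
      ultimately show ?thesis
        using deriv_comp_holomorphic[OF _ op s V(9)[OF i] V(6)] s by simp
    qed
    then have "(\<Sum>i\<in>A. deriv (\<lambda>w. \<Gamma> i (?l w)) s ^ 2) = (\<Sum>i\<in>A. deriv (\<Gamma> i) (?l s) ^ 2) * e ^ 2"
      by (simp add: power_mult_distrib sum_distrib_right)
    then show ?thesis using V(11)[of "?l s"] s e by auto
  qed
  moreover have "(\<lambda>z. e * \<theta> z + c) holomorphic_on V" by (intro holomorphic_intros V)
  moreover have "(\<lambda>z. e * \<theta> z + c) ` K \<subseteq> \<real>" using V(5) e c by auto
  ultimately show ?thesis
    unfolding unit_speed_factorization_def using V op by (auto simp: ee)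
qed

text \<open>
  When both parameters agree on the overlap, so do the curves on an open set of parameter values,
  hence on the whole intersection of the convex sets \<open>W1\<close> and \<open>W2\<close>.  This remains true if the two
  parameter intervals overlap because the path folds back.  The union is cut down to a convex
  neighbourhood at the end.
\<close>
lemma unit_speed_glue_agreeing:
  assumes u1: "unit_speed_factorization A f (real_interval x y) V1 \<theta>1 W1 \<Gamma>1"
    and u2: "unit_speed_factorization A f (real_interval y z) V2 \<theta>2 W2 \<Gamma>2"
    and xyz: "x \<le> y" "y \<le> z"
    and agree: "\<And>v. v \<in> V1 \<inter> V2 \<Longrightarrow> \<theta>1 v = \<theta>2 v"
    and nc: "\<not> \<theta>1 constant_on (V1 \<inter> V2)"
  shows "\<exists>V \<theta> W \<Gamma>. unit_speed_factorization A f (real_interval x z) V \<theta> W \<Gamma>"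
proof -
  note V1 = unit_speed_factorizationD[OF u1]
  note V2 = unit_speed_factorizationD[OF u2]
  define X where "X = V1 \<inter> V2"
  have X: "open X" "convex X" using V1 V2 by (auto simp: X_def convex_Int)
  have opX: "open (\<theta>1 ` X)"
    by (rule open_mapping_thm[of \<theta>1 X])
       (use X V1(4) nc in \<open>auto intro: holomorphic_on_subset convex_connected simp: X_def\<close>)
  have neX: "X \<noteq> {}" using nc by (auto simp: X_def constant_on_def)
  have \<Gamma>agree: "\<Gamma>1 i s = \<Gamma>2 i s" if i: "i \<in> A" and s: "s \<in> W1 \<inter> W2" for i s
  proof (rule analytic_continuation_open[of "\<theta>1 ` X" "W1 \<inter> W2" "\<Gamma>1 i" "\<Gamma>2 i"])
    show "\<theta>1 ` X \<subseteq> W1 \<inter> W2" using V1(8) V2(8) agree by (force simp: X_def)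
    show "\<Gamma>1 i w = \<Gamma>2 i w" if "w \<in> \<theta>1 ` X" for w
    proof -
      obtain v where v: "v \<in> V1" "v \<in> V2" "w = \<theta>1 v" "w = \<theta>2 v"
        using \<open>w \<in> \<theta>1 ` X\<close> agree by (auto simp: X_def)
      then show ?thesis using V1(10)[OF i v(1)] V2(10)[OF i v(2)] by simp
    qed
    show "connected (W1 \<inter> W2)" using V1(7) V2(7) by (intro convex_connected convex_Int)
    show "\<Gamma>1 i holomorphic_on W1 \<inter> W2" using V1(9)[OF i] by (rule holomorphic_on_subset) auto
    show "\<Gamma>2 i holomorphic_on W1 \<inter> W2" using V2(9)[OF i] by (rule holomorphic_on_subset) auto
    show "open (\<theta>1 ` X)" "\<theta>1 ` X \<noteq> {}" "open (W1 \<inter> W2)" "s \<in> W1 \<inter> W2"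
      using opX neX s V1(6) V2(6) by auto
  qed
  define \<theta> where "\<theta> v = (if v \<in> V1 then \<theta>1 v else \<theta>2 v)" for v
  define \<Gamma> where "\<Gamma> i w = (if w \<in> W1 then \<Gamma>1 i w else \<Gamma>2 i w)" for i w
  have \<theta>12: "v \<in> V1 \<Longrightarrow> \<theta> v = \<theta>1 v" "v \<in> V2 \<Longrightarrow> \<theta> v = \<theta>2 v" for v
    using agree by (auto simp: \<theta>_def)
  have \<Gamma>12: "w \<in> W1 \<Longrightarrow> \<Gamma> i w = \<Gamma>1 i w" "i \<in> A \<Longrightarrow> w \<in> W2 \<Longrightarrow> \<Gamma> i w = \<Gamma>2 i w" for i w
    using \<Gamma>agree by (auto simp: \<Gamma>_def)
  have \<theta>hol: "\<theta> holomorphic_on V1 \<union> V2"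
  proof (rule holomorphic_on_Un)
    show "\<theta> holomorphic_on V1" using V1(4) by (rule holomorphic_transform) (simp add: \<theta>12)
    show "\<theta> holomorphic_on V2" using V2(4) by (rule holomorphic_transform) (simp add: \<theta>12)
  qed (use V1(1) V2(1) in auto)
  have \<Gamma>hol: "\<Gamma> i holomorphic_on W1 \<union> W2" if i: "i \<in> A" for i
  proof (rule holomorphic_on_Un)
    show "\<Gamma> i holomorphic_on W1" using V1(9)[OF i] by (rule holomorphic_transform) (simp add: \<Gamma>12)
    show "\<Gamma> i holomorphic_on W2" using V2(9)[OF i] by (rule holomorphic_transform) (simp add: \<Gamma>12 i)
  qed (use V1(6) V2(6) in auto)
  have split: "real_interval x z = real_interval x y \<union> real_interval y z"
    unfolding real_interval_def by (simp add: ivl_disj_un_two_touch(4)[OF xyz] flip: image_Un)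
  define J where "J = \<theta> ` real_interval x z"
  have K: "real_interval x z \<subseteq> V1 \<union> V2" using V1(3) V2(3) split by auto
  have cont: "continuous_on (real_interval x z) \<theta>"
    using \<theta>hol K by (meson continuous_on_subset holomorphic_on_imp_continuous_on)
  have J1: "\<theta> v = \<theta>1 v" if "v \<in> real_interval x y" for v using \<theta>12(1) V1(3) that by blast
  have J2: "\<theta> v = \<theta>2 v" if "v \<in> real_interval y z" for v using \<theta>12(2) V2(3) that by blast
  have Jeq: "J = \<theta>1 ` real_interval x y \<union> \<theta>2 ` real_interval y z"
    using J1 J2 by (simp add: J_def split image_Un cong: image_cong)
  then have Jreal: "J \<subseteq> \<real>" using V1(5) V2(5) by blast
  have Jc: "compact J"
    unfolding J_def by (rule compact_continuous_image[OF cont compact_real_interval])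
  have "connected J"
    unfolding J_def by (rule connected_continuous_image[OF cont convex_connected[OF convex_real_interval]])
  then have Jv: "convex J" using Jreal by (rule connected_real_imp_convex)
  have JW: "J \<subseteq> W1 \<union> W2" unfolding Jeq using V1(3,8) V2(3,8) by blast
  obtain W where W: "open W" "convex W" "J \<subseteq> W" "W \<subseteq> W1 \<union> W2"
    by (rule convex_neighbourhood[OF Jc Jv open_Un[OF V1(6) V2(6)] JW])
  have opV: "open ((V1 \<union> V2) \<inter> \<theta> -` W)"
    using \<theta>hol V1(1) V2(1) W(1)
    by (intro continuous_open_preimage holomorphic_on_imp_continuous_on) auto
  have KV: "real_interval x z \<subseteq> (V1 \<union> V2) \<inter> \<theta> -` W" using K W(3) unfolding J_def by blast
  obtain V where V: "open V" "convex V" "real_interval x z \<subseteq> V" "V \<subseteq> (V1 \<union> V2) \<inter> \<theta> -` W"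
    by (rule convex_neighbourhood[OF compact_real_interval convex_real_interval opV KV])
  have fac: "f i v = \<Gamma> i (\<theta> v)" if "i \<in> A" "v \<in> V" for i v
  proof (cases "v \<in> V1")
    case True
    then have "\<theta>1 v \<in> W1" using V1(8) by blast
    then show ?thesis using V1(10)[OF that(1) True] True \<theta>12 \<Gamma>12 by simp
  next
    case False
    then have v: "v \<in> V2" using V(4) that by blast
    then have "\<theta>2 v \<in> W2" using V2(8) by blast
    then show ?thesis using V2(10)[OF that(1) v] v \<theta>12 \<Gamma>12(2)[OF that(1)] by simp
  qed
  have unit: "(\<Sum>i\<in>A. deriv (\<Gamma> i) s ^ 2) = 1" if s: "s \<in> W" for s
  proof (cases "s \<in> W1")
    case True
    have "deriv (\<Gamma> i) s = deriv (\<Gamma>1 i) s" for i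
      by (rule deriv_cong_open[OF V1(6) True]) (use \<Gamma>12 in auto)
    then show ?thesis using V1(11)[OF True] by simp
  next
    case False
    then have s2: "s \<in> W2" using W(4) s by blast
    have "deriv (\<Gamma> i) s = deriv (\<Gamma>2 i) s" if "i \<in> A" for i
      by (rule deriv_cong_open[OF V2(6) s2]) (use \<Gamma>12 that in auto)
    then show ?thesis using V2(11)[OF s2] by simp
  qed
  have "unit_speed_factorization A f (real_interval x z) V \<theta> W \<Gamma>"
    unfolding unit_speed_factorization_def
  proof (intro conjI ballI)
    show "\<theta> holomorphic_on V" using \<theta>hol V(4) by (auto intro: holomorphic_on_subset)
    show "\<Gamma> i holomorphic_on W" if "i \<in> A" for i
      using \<Gamma>hol[OF that] W(4) by (rule holomorphic_on_subset)
  qed (use V W fac unit Jreal in \<open>auto simp: J_def\<close>)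
  then show ?thesis by blast
qed

text \<open>
  On the overlap both derivatives \<open>\<theta>'\<close> have the same square, the sum of the \<open>(f\<^sub>i')\<^sup>2\<close>.  So the
  parameters agree up to sign and a constant, which is real because both are real at \<open>y\<close>.
\<close>
lemma unit_speed_glue:
  assumes u1: "unit_speed_factorization A f (real_interval x y) V1 \<theta>1 W1 \<Gamma>1"
    and u2: "unit_speed_factorization A f (real_interval y z) V2 \<theta>2 W2 \<Gamma>2"
    and xyz: "x \<le> y" "y \<le> z"
    and nc: "i0 \<in> A" "\<not> (\<forall>\<^sub>F v in nhds (of_real y). f i0 v = f i0 (of_real y))"
  shows "\<exists>V \<theta> W \<Gamma>. unit_speed_factorization A f (real_interval x z) V \<theta> W \<Gamma>"
proof -
  note V1 = unit_speed_factorizationD[OF u1]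
  note V2 = unit_speed_factorizationD[OF u2]
  define X where "X = V1 \<inter> V2"
  have X: "open X" "convex X" using V1 V2 by (auto simp: X_def convex_Int)
  have y: "complex_of_real y \<in> real_interval x y" "complex_of_real y \<in> real_interval y z"
    using xyz by (auto simp: real_interval_def)
  then have yX: "of_real y \<in> X" using V1(3) V2(3) by (auto simp: X_def)
  have hol: "\<theta>1 holomorphic_on X" "\<theta>2 holomorphic_on X"
    using V1(4) V2(4) by (auto simp: X_def intro: holomorphic_on_subset)
  have sq: "deriv \<theta>1 v ^ 2 = deriv \<theta>2 v ^ 2" if v: "v \<in> X" for v
  proof -
    have vv: "v \<in> V1" "v \<in> V2" "\<theta>1 v \<in> W1" "\<theta>2 v \<in> W2" using v V1(8) V2(8) by (auto simp: X_def)
    have 1: "deriv (f i) v = deriv (\<Gamma>1 i) (\<theta>1 v) * deriv \<theta>1 v" if i: "i \<in> A" for i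
      using deriv_cong_open[OF V1(1) vv(1), of "f i" "\<lambda>v. \<Gamma>1 i (\<theta>1 v)"] V1(10)[OF i]
        deriv_comp_holomorphic[OF V1(4,1) vv(1) V1(9)[OF i] V1(6) vv(3)] by simp
    have 2: "deriv (f i) v = deriv (\<Gamma>2 i) (\<theta>2 v) * deriv \<theta>2 v" if i: "i \<in> A" for i
      using deriv_cong_open[OF V2(1) vv(2), of "f i" "\<lambda>v. \<Gamma>2 i (\<theta>2 v)"] V2(10)[OF i]
        deriv_comp_holomorphic[OF V2(4,1) vv(2) V2(9)[OF i] V2(6) vv(4)] by simp
    have "(\<Sum>i\<in>A. deriv (f i) v ^ 2) = (\<Sum>i\<in>A. deriv (\<Gamma>1 i) (\<theta>1 v) ^ 2) * deriv \<theta>1 v ^ 2"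
      by (simp add: 1 sum_distrib_right power_mult_distrib)
    moreover have "(\<Sum>i\<in>A. deriv (f i) v ^ 2) = (\<Sum>i\<in>A. deriv (\<Gamma>2 i) (\<theta>2 v) ^ 2) * deriv \<theta>2 v ^ 2"
      by (simp add: 2 sum_distrib_right power_mult_distrib)
    ultimately show ?thesis using V1(11)[OF vv(3)] V2(11)[OF vv(4)] by simp
  qed
  obtain e where e: "e = 1 \<or> e = -1" "\<And>v. v \<in> X \<Longrightarrow> deriv \<theta>1 v = e * deriv \<theta>2 v"
    by (rule holomorphic_square_eq[OF holomorphic_deriv[OF hol(1) X(1)] holomorphic_deriv[OF hol(2) X(1)]
          X(1) convex_connected[OF X(2)] sq]) auto
  have "((\<lambda>v. \<theta>1 v - e * \<theta>2 v) has_field_derivative 0) (at v within X)" if v: "v \<in> X" for v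
  proof -
    have "(\<theta>1 has_field_derivative deriv \<theta>1 v) (at v within X)" "(\<theta>2 has_field_derivative deriv \<theta>2 v) (at v within X)"
      using hol X(1) v by (auto intro: holomorphic_derivI has_field_derivative_at_within)
    then show ?thesis using e(2)[OF v] by (auto intro!: derivative_eq_intros)
  qed
  then have "\<exists>c. \<forall>v\<in>X. \<theta>1 v - e * \<theta>2 v = c"
    by (rule has_field_derivative_zero_constant[OF X(2)])
  then obtain c where c: "\<And>v. v \<in> X \<Longrightarrow> \<theta>1 v - e * \<theta>2 v = c" by blast
  have "\<theta>1 (of_real y) \<in> \<real>" "\<theta>2 (of_real y) \<in> \<real>" using V1(5) V2(5) y by blast+
  then have "c \<in> \<real>" using c[OF yX] e(1) by (metis Reals_diff Reals_minus Reals_mult Reals_1)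
  have u3: "unit_speed_factorization A f (real_interval y z) V2 (\<lambda>z. e * \<theta>2 z + c)
           ((\<lambda>w. e * (w - c)) -` W2) (\<lambda>i w. \<Gamma>2 i (e * (w - c)))"
    by (rule unit_speed_affine[OF u2 e(1) \<open>c \<in> \<real>\<close>])
  show ?thesis
  proof (rule unit_speed_glue_agreeing[OF u1 u3 xyz])
    show "\<theta>1 v = e * \<theta>2 v + c" if "v \<in> V1 \<inter> V2" for v
      using c[of v] that by (simp add: X_def algebra_simps)
    show "\<not> \<theta>1 constant_on V1 \<inter> V2"
    proof
      assume "\<theta>1 constant_on V1 \<inter> V2"
      then obtain k where k: "\<And>v. v \<in> X \<Longrightarrow> \<theta>1 v = k" by (auto simp: constant_on_def X_def)
      have "f i0 v = f i0 (of_real y)" if "v \<in> X" for v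
        using V1(10)[OF nc(1)] k that yX by (simp add: X_def)
      then have "\<forall>\<^sub>F v in nhds (of_real y). f i0 v = f i0 (of_real y)"
        unfolding eventually_nhds using X(1) yX by blast
      with nc(2) show False by simp
    qed
  qed
qed

text \<open>
  Bisection reduces the claim to short intervals and to gluing two adjacent ones.
\<close>
lemma unit_speed_factorization_exists:
  fixes f :: "'i \<Rightarrow> complex \<Rightarrow> complex"
  assumes ab: "a < b" and A: "finite A"
    and f: "\<And>i. i \<in> A \<Longrightarrow> f i ` real_interval a b \<subseteq> \<real>"
    and nc: "i0 \<in> A" "\<And>t. t \<in> real_interval a b \<Longrightarrow> \<not> (\<forall>\<^sub>F v in nhds t. f i0 v = f i0 t)"
    and gen: "\<And>t. t \<in> real_interval a b \<Longrightarrow> \<exists>m g. m analytic_on {t} \<and> m ` real_interval a b \<subseteq> \<real> \<and>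
      \<not> (\<forall>\<^sub>F z in nhds t. m z = m t) \<and>
      (\<forall>i\<in>A. g i analytic_on {m t} \<and> (\<forall>\<^sub>F z in nhds t. f i z = g i (m z))) \<and>
      (\<exists>i\<in>A. deriv (g i) (m t) \<noteq> 0)"
  obtains V \<theta> W \<Gamma> where "unit_speed_factorization A f (real_interval a b) V \<theta> W \<Gamma>"
proof -
  define P where "P x y \<longleftrightarrow> (a \<le> x \<and> y \<le> b \<longrightarrow>
      (\<exists>V \<theta> W \<Gamma>. unit_speed_factorization A f (real_interval x y) V \<theta> W \<Gamma>))" for x y
  have "P a b"
  proof (rule Bolzano)
    show "a \<le> b" using ab by simp
    show "P x z" if "P x y" "P y z" "x \<le> y" "y \<le> z" for x y z
      unfolding P_def
    proof
      assume xz: "a \<le> x \<and> z \<le> b"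
      obtain V1 \<theta>1 W1 \<Gamma>1 where u1: "unit_speed_factorization A f (real_interval x y) V1 \<theta>1 W1 \<Gamma>1"
        using \<open>P x y\<close> xz \<open>y \<le> z\<close> by (auto simp: P_def)
      obtain V2 \<theta>2 W2 \<Gamma>2 where u2: "unit_speed_factorization A f (real_interval y z) V2 \<theta>2 W2 \<Gamma>2"
        using \<open>P y z\<close> xz \<open>x \<le> y\<close> by (auto simp: P_def)
      have "complex_of_real y \<in> real_interval a b" using xz that(3,4) by (auto simp: real_interval_def)
      from unit_speed_glue[OF u1 u2 that(3,4) nc(1) nc(2)[OF this]]
      show "\<exists>V \<theta> W \<Gamma>. unit_speed_factorization A f (real_interval x z) V \<theta> W \<Gamma>" .
    qed
    show "\<exists>d>0. \<forall>x y. x \<le> t \<and> t \<le> y \<and> y - x < d \<longrightarrow> P x y" if t: "a \<le> t" "t \<le> b" for t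
    proof -
      have tI: "complex_of_real t \<in> real_interval a b" "t \<in> {a..b}" using t by (auto simp: real_interval_def)
      obtain m g where mg: "m analytic_on {of_real t} \<and> m ` real_interval a b \<subseteq> \<real> \<and>
          \<not> (\<forall>\<^sub>F z in nhds (of_real t). m z = m (of_real t)) \<and>
          (\<forall>i\<in>A. g i analytic_on {m (of_real t)} \<and> (\<forall>\<^sub>F z in nhds (of_real t). f i z = g i (m z))) \<and>
          (\<exists>i\<in>A. deriv (g i) (m (of_real t)) \<noteq> 0)"
        using gen[OF tI(1)] by (elim exE)
      then have m: "m analytic_on {of_real t}" "m ` real_interval a b \<subseteq> \<real>"
          "\<not> (\<forall>\<^sub>F z in nhds (of_real t). m z = m (of_real t))"
        and g: "\<And>i. i \<in> A \<Longrightarrow> g i analytic_on {m (of_real t)}"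
          "\<And>i. i \<in> A \<Longrightarrow> \<forall>\<^sub>F z in nhds (of_real t). f i z = g i (m z)"
        and imm: "\<exists>i\<in>A. deriv (g i) (m (of_real t)) \<noteq> 0"
        by simp_all
      from unit_speed_local[OF ab A tI(2) f m g imm] show ?thesis
        unfolding P_def by blast
    qed
  qed
  then show thesis using that by (auto simp: P_def)
qed

section \<open>Coincidences of a unit-speed curve\<close>

definition same_point :: "'i set \<Rightarrow> ('i \<Rightarrow> complex \<Rightarrow> complex) \<Rightarrow> complex \<Rightarrow> complex \<Rightarrow> bool" where
  "same_point A \<Gamma> s s' \<longleftrightarrow> (\<forall>i\<in>A. \<Gamma> i s = \<Gamma> i s')"

definition unit_speed_on :: "'i set \<Rightarrow> ('i \<Rightarrow> complex \<Rightarrow> complex) \<Rightarrow> complex set \<Rightarrow> bool" where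
  "unit_speed_on A \<Gamma> W \<longleftrightarrow> open W \<and> convex W \<and> (\<forall>i\<in>A. \<Gamma> i holomorphic_on W) \<and>
     (\<forall>s\<in>W. (\<Sum>i\<in>A. deriv (\<Gamma> i) s ^ 2) = 1)"

text \<open>
  The curve is known only near an interval; the condition concerns those \<open>s\<close> for which both points
  belong to \<open>W\<close>.
\<close>
definition translation_period :: "'i set \<Rightarrow> ('i \<Rightarrow> complex \<Rightarrow> complex) \<Rightarrow> complex set \<Rightarrow> complex \<Rightarrow> bool" where
  "translation_period A \<Gamma> W c \<longleftrightarrow> (\<forall>s. s \<in> W \<and> s + c \<in> W \<longrightarrow> same_point A \<Gamma> s (s + c))"

lemma same_point_sym: "same_point A \<Gamma> s s' \<Longrightarrow> same_point A \<Gamma> s' s"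
  by (simp add: same_point_def)

lemma same_point_trans: "same_point A \<Gamma> s s' \<Longrightarrow> same_point A \<Gamma> s' s'' \<Longrightarrow> same_point A \<Gamma> s s''"
  by (simp add: same_point_def)

lemma unit_speed_nonzero_derivative:
  assumes "unit_speed_on A \<Gamma> W" "p \<in> W"
  obtains i where "i \<in> A" "deriv (\<Gamma> i) p \<noteq> 0"
proof -
  have "(\<Sum>i\<in>A. deriv (\<Gamma> i) p ^ 2) = 1" using assms by (simp add: unit_speed_on_def)
  have "\<exists>i\<in>A. deriv (\<Gamma> i) p \<noteq> 0"
  proof (rule ccontr)
    assume "\<not> ?thesis"
    then have "(\<Sum>i\<in>A. deriv (\<Gamma> i) p ^ 2) = 0" by (intro sum.neutral) auto
    then show False using \<open>(\<Sum>i\<in>A. deriv (\<Gamma> i) p ^ 2) = 1\<close> by simp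
  qed
  then show thesis using that by blast
qed

text \<open>
  Some component \<open>\<Gamma> i\<close> is invertible near \<open>p'\<close>, so coincidences near \<open>(p, p')\<close> lie on the graph of
  \<open>\<phi> = (\<Gamma> i)\<^sup>-\<^sup>1 \<circ> \<Gamma> i\<close>.  Either some component separates \<open>s\<close> from \<open>\<phi> s\<close> for all \<open>s \<noteq> p\<close>
  near \<open>p\<close>, or \<open>\<Gamma> \<circ> \<phi> = \<Gamma>\<close>, and comparing speeds gives \<open>(\<phi>')\<^sup>2 = 1\<close>.
\<close>
lemma coincidence_isolated_or_isometric:
  assumes u: "unit_speed_on A \<Gamma> W" and p: "p \<in> W" "p' \<in> W"
  obtains r where "r > 0" "ball p r \<subseteq> W" "ball p' r \<subseteq> W"
    "\<And>s s'. s \<in> ball p r \<Longrightarrow> s' \<in> ball p' r \<Longrightarrow> same_point A \<Gamma> s s' \<Longrightarrow> s = p \<and> s' = p'"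
  | r e where "r > 0" "ball p r \<subseteq> W" "ball p' r \<subseteq> W" "e = 1 \<or> e = -1"
    "\<And>s. s \<in> ball p r \<Longrightarrow> same_point A \<Gamma> s (p' + e * (s - p))"
    "\<And>s s'. s \<in> ball p r \<Longrightarrow> s' \<in> ball p' r \<Longrightarrow> same_point A \<Gamma> s s' \<Longrightarrow> s' = p' + e * (s - p)"
proof -
  have W: "open W" "convex W" "\<And>i. i \<in> A \<Longrightarrow> \<Gamma> i holomorphic_on W"
    "\<And>s. s \<in> W \<Longrightarrow> (\<Sum>i\<in>A. deriv (\<Gamma> i) s ^ 2) = 1"
    using u by (auto simp: unit_speed_on_def)
  have cont: "continuous_on W (\<Gamma> i)" if "i \<in> A" for i
    using W(3)[OF that] by (rule holomorphic_on_imp_continuous_on)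
  show thesis
  proof (cases "same_point A \<Gamma> p p'")
    case False
    then obtain i where i: "i \<in> A" "\<Gamma> i p \<noteq> \<Gamma> i p'" by (auto simp: same_point_def)
    obtain X Y where XY: "open X" "open Y" "\<Gamma> i p \<in> X" "\<Gamma> i p' \<in> Y" "X \<inter> Y = {}"
      using hausdorff[OF i(2)] by auto
    have "open (W \<inter> \<Gamma> i -` X)" "open (W \<inter> \<Gamma> i -` Y)"
      using XY by (auto intro: continuous_open_preimage[OF cont[OF i(1)] W(1)])
    moreover have "p \<in> W \<inter> \<Gamma> i -` X" "p' \<in> W \<inter> \<Gamma> i -` Y" using p XY by auto
    ultimately obtain r1 r2 where r: "r1 > 0" "ball p r1 \<subseteq> W \<inter> \<Gamma> i -` X" "r2 > 0" "ball p' r2 \<subseteq> W \<inter> \<Gamma> i -` Y"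
      by (meson open_contains_ball)
    define r where "r = min r1 r2"
    have b: "r > 0" "ball p r \<subseteq> W \<inter> \<Gamma> i -` X" "ball p' r \<subseteq> W \<inter> \<Gamma> i -` Y"
      using r by (auto simp: r_def)
    have no: "\<not> same_point A \<Gamma> s s'" if "s \<in> ball p r" "s' \<in> ball p' r" for s s'
    proof
      assume "same_point A \<Gamma> s s'"
      then have "\<Gamma> i s = \<Gamma> i s'" using i(1) by (simp add: same_point_def)
      moreover have "\<Gamma> i s \<in> X" "\<Gamma> i s' \<in> Y" using b(2,3) that by blast+
      ultimately show False using XY(5) by auto
    qed
    show thesis by (rule that(1)[of r]) (use b no in auto)
  next
    case True
    obtain i where i: "i \<in> A" "deriv (\<Gamma> i) p' \<noteq> 0" using unit_speed_nonzero_derivative[OF u p(2)] .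
    obtain r1 \<psi> where r1: "r1 > 0" "ball p' r1 \<subseteq> W" "open (\<Gamma> i ` ball p' r1)"
      "\<psi> holomorphic_on \<Gamma> i ` ball p' r1" "\<And>x. x \<in> ball p' r1 \<Longrightarrow> \<psi> (\<Gamma> i x) = x"
      using holomorphic_local_inverse[OF W(3)[OF i(1)] W(1) p(2) i(2)] by metis
    define X where "X = W \<inter> \<Gamma> i -` (\<Gamma> i ` ball p' r1)"
    have "open X" unfolding X_def by (intro continuous_open_preimage cont i W(1) r1(3))
    moreover have "p \<in> X"
    proof -
      have "\<Gamma> i p = \<Gamma> i p'" using True i(1) by (simp add: same_point_def)
      then show ?thesis using p(1) r1(1) by (simp add: X_def)
    qed
    ultimately obtain r2 where r2: "r2 > 0" "ball p r2 \<subseteq> X" using open_contains_ball by blast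
    define \<phi> where "\<phi> s = \<psi> (\<Gamma> i s)" for s
    have \<phi>: "\<phi> s \<in> ball p' r1" "\<Gamma> i (\<phi> s) = \<Gamma> i s" if s: "s \<in> ball p r2" for s
    proof -
      obtain x where "x \<in> ball p' r1" "\<Gamma> i s = \<Gamma> i x" using r2(2) s unfolding X_def by blast
      then show "\<phi> s \<in> ball p' r1" "\<Gamma> i (\<phi> s) = \<Gamma> i s" using r1(5) by (simp_all add: \<phi>_def)
    qed
    have \<phi>p: "\<phi> p = p'"
    proof -
      have "\<Gamma> i p = \<Gamma> i p'" using True i(1) by (simp add: same_point_def)
      then show ?thesis using r1(1,5) by (simp add: \<phi>_def)
    qed
    have r2W: "ball p r2 \<subseteq> W" using r2(2) by (auto simp: X_def)
    have \<Gamma>r2: "\<Gamma> l holomorphic_on ball p r2" if "l \<in> A" for l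
      using W(3)[OF that] r2W by (rule holomorphic_on_subset)
    have \<phi>hol: "\<phi> holomorphic_on ball p r2"
      unfolding \<phi>_def
      by (rule holomorphic_on_compose_gen[OF \<Gamma>r2[OF i(1)] r1(4), unfolded o_def]) (use r2(2) in \<open>auto simp: X_def\<close>)
    have uniq: "s' = \<phi> s" if "s \<in> ball p r2" "s' \<in> ball p' r1" "same_point A \<Gamma> s s'" for s s'
    proof -
      have "\<Gamma> i s = \<Gamma> i s'" using that(3) i(1) by (simp add: same_point_def)
      then show ?thesis using r1(5)[OF that(2)] by (simp add: \<phi>_def)
    qed
    have \<Gamma>\<phi>: "(\<lambda>s. \<Gamma> l (\<phi> s)) holomorphic_on ball p r2" if "l \<in> A" for l
      by (rule holomorphic_on_compose_gen[OF \<phi>hol W(3)[OF that], unfolded o_def]) (use \<phi>(1) r1(2) in blast)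
    show thesis
    proof (cases "\<forall>l\<in>A. \<forall>s\<in>ball p r2. \<Gamma> l (\<phi> s) = \<Gamma> l s")
      case all: True
      have d1: "deriv \<phi> s ^ 2 = 1 ^ 2" if s: "s \<in> ball p r2" for s
      proof -
        have \<phi>W: "\<phi> s \<in> W" using \<phi>(1)[OF s] r1(2) by blast
        have "deriv (\<Gamma> l) s = deriv (\<Gamma> l) (\<phi> s) * deriv \<phi> s" if l: "l \<in> A" for l
          using deriv_cong_open[OF open_ball s, of "\<lambda>s. \<Gamma> l (\<phi> s)" "\<Gamma> l"] all l
            deriv_comp_holomorphic[OF \<phi>hol open_ball s W(3)[OF l] W(1) \<phi>W] by simp
        then have "(\<Sum>l\<in>A. deriv (\<Gamma> l) s ^ 2) = (\<Sum>l\<in>A. deriv (\<Gamma> l) (\<phi> s) ^ 2) * deriv \<phi> s ^ 2"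
          by (simp add: power_mult_distrib sum_distrib_right)
        moreover have "s \<in> W" using s r2W by blast
        ultimately show ?thesis using W(4)[OF \<phi>W] W(4)[of s] by simp
      qed
      obtain e where e: "e = 1 \<or> e = -1" "\<And>s. s \<in> ball p r2 \<Longrightarrow> deriv \<phi> s = e * 1"
        by (rule holomorphic_square_eq[OF holomorphic_deriv[OF \<phi>hol open_ball] holomorphic_on_const
              open_ball connected_ball d1]) auto
      have "((\<lambda>s. \<phi> s - e * s) has_field_derivative 0) (at s within ball p r2)" if s: "s \<in> ball p r2" for s
      proof -
        have "(\<phi> has_field_derivative e) (at s)"
          using holomorphic_derivI[OF \<phi>hol open_ball s] e(2)[OF s] by simp
        then have "(\<phi> has_field_derivative e) (at s within ball p r2)" by (rule has_field_derivative_at_within)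
        then show ?thesis by (auto intro!: derivative_eq_intros)
      qed
      then have "\<exists>c. \<forall>s\<in>ball p r2. \<phi> s - e * s = c"
        by (rule has_field_derivative_zero_constant[OF convex_ball])
      then obtain c where c: "\<And>s. s \<in> ball p r2 \<Longrightarrow> \<phi> s - e * s = c" by blast
      have "c = p' - e * p" using c[of p] r2(1) \<phi>p by simp
      then have \<phi>eq: "\<phi> s = p' + e * (s - p)" if "s \<in> ball p r2" for s
        using c[OF that] by (simp add: algebra_simps)
      define r where "r = min r1 r2"
      have b: "r > 0" "ball p r \<subseteq> ball p r2" "ball p' r \<subseteq> ball p' r1" using r1(1) r2(1) by (auto simp: r_def)
      show thesis
      proof (rule that(2)[of r e])
        show "same_point A \<Gamma> s (p' + e * (s - p))" if "s \<in> ball p r" for s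
        proof -
          have "s \<in> ball p r2" using that b(2) by blast
          then show ?thesis using all \<phi>eq by (auto simp: same_point_def)
        qed
        show "s' = p' + e * (s - p)" if "s \<in> ball p r" "s' \<in> ball p' r" "same_point A \<Gamma> s s'" for s s'
        proof -
          have "s \<in> ball p r2" "s' \<in> ball p' r1" using that b by auto
          then show ?thesis using uniq[OF _ _ that(3)] \<phi>eq by simp
        qed
      qed (use b e r1(2) r2W in auto)
    next
      case False
      then obtain l s1 where l: "l \<in> A" "s1 \<in> ball p r2" "\<Gamma> l (\<phi> s1) \<noteq> \<Gamma> l s1" by blast
      have Dhol: "(\<lambda>s. \<Gamma> l (\<phi> s) - \<Gamma> l s) holomorphic_on ball p r2"
        by (intro holomorphic_intros \<Gamma>\<phi> \<Gamma>r2 l)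
      have D0: "\<Gamma> l (\<phi> p) - \<Gamma> l p = 0" using True l(1) \<phi>p by (simp add: same_point_def)
      have D1: "\<Gamma> l (\<phi> s1) - \<Gamma> l s1 \<noteq> 0" using l by simp
      obtain r3 where r3: "0 < r3" "ball p r3 \<subseteq> ball p r2"
        "\<And>s. s \<in> ball p r3 - {p} \<Longrightarrow> \<Gamma> l (\<phi> s) - \<Gamma> l s \<noteq> 0"
        by (rule isolated_zeros[OF Dhol open_ball connected_ball _ D0 l(2) D1]) (use r2(1) in auto)
      define r where "r = min r1 r3"
      have b: "r > 0" "ball p r \<subseteq> ball p r3" "ball p' r \<subseteq> ball p' r1" using r1(1) r3(1) by (auto simp: r_def)
      show thesis
      proof (rule that(1)[of r])
        show "s = p \<and> s' = p'" if "s \<in> ball p r" "s' \<in> ball p' r" "same_point A \<Gamma> s s'" for s s'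
        proof -
          have s: "s \<in> ball p r3" "s \<in> ball p r2" "s' \<in> ball p' r1" using that(1,2) b r3(2) by blast+
          have s': "s' = \<phi> s" using uniq[OF s(2,3) that(3)] .
          then have "\<Gamma> l (\<phi> s) = \<Gamma> l s" using that(3) l(1) by (simp add: same_point_def)
          then have "s = p" using r3(3)[of s] s(1) by auto
          then show ?thesis using s' \<phi>p by simp
        qed
      qed (use b r1(2) r3(2) r2W in auto)
    qed
  qed
qed

text \<open>
  Since \<open>W\<close> is convex, the symmetry \<open>\<Gamma> s = \<Gamma> (p + p' - s)\<close> continues to the midpoint of \<open>p\<close> and \<open>p'\<close>, where
  differentiation shows that the velocity equals its own negative.
\<close>
lemma no_reflection:
  assumes u: "unit_speed_on A \<Gamma> W" and p: "p \<in> W" "p' \<in> W" and r: "r > 0"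
    and refl: "\<And>s. s \<in> ball p r \<Longrightarrow> same_point A \<Gamma> s (p' + (-1) * (s - p))"
  shows False
proof -
  have W: "open W" "convex W" "\<And>i. i \<in> A \<Longrightarrow> \<Gamma> i holomorphic_on W"
    using u by (auto simp: unit_speed_on_def)
  let ?l = "\<lambda>s. (p + p') - s"
  define X where "X = W \<inter> ?l -` W"
  have lW: "open (?l -` W)" by (intro open_vimage W continuous_intros)
  have "?l -` W = (\<lambda>s. (p + p') + s) ` (\<lambda>s. (-1) * s) ` W"
  proof (intro set_eqI iffI)
    fix w assume "w \<in> ?l -` W"
    then show "w \<in> (\<lambda>s. (p + p') + s) ` (\<lambda>s. (-1) * s) ` W"
      by (intro image_eqI[of _ _ "- ?l w"] image_eqI[of _ _ "?l w"]) auto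
  qed auto
  then have "convex (?l -` W)"
    using W(2) by (simp only: convex_translation convex_linear_image linear_times)
  then have X: "open X" "convex X" using W lW by (auto simp: X_def convex_Int)
  define q where "q = (1 / 2) *\<^sub>R p + (1 / 2) *\<^sub>R p'"
  have "q \<in> W" unfolding q_def by (rule convexD[OF W(2) p]) auto
  moreover have lq: "?l q = q" by (simp add: q_def scaleR_conv_of_real algebra_simps)
  ultimately have "q \<in> X" by (simp add: X_def)
  have pX: "p \<in> X" using p by (simp add: X_def)
  obtain i where i: "i \<in> A" "deriv (\<Gamma> i) q \<noteq> 0" using unit_speed_nonzero_derivative[OF u \<open>q \<in> W\<close>] .
  have lhol: "?l holomorphic_on X" by (intro holomorphic_intros)
  have hol: "\<Gamma> i holomorphic_on X" using W(3)[OF i(1)] by (rule holomorphic_on_subset) (simp add: X_def)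
  have hol': "(\<lambda>s. \<Gamma> i (?l s)) holomorphic_on X"
    by (rule holomorphic_on_compose_gen[OF lhol W(3)[OF i(1)], unfolded o_def]) (auto simp: X_def)
  have "\<Gamma> i s = \<Gamma> i (?l s)" if s: "s \<in> X" for s
  proof (rule analytic_continuation_open[of "ball p r \<inter> X" X "\<Gamma> i" "\<lambda>s. \<Gamma> i (?l s)"])
    show "\<Gamma> i s = \<Gamma> i (?l s)" if "s \<in> ball p r \<inter> X" for s
    proof -
      have "p' + (-1) * (s - p) = ?l s" by simp
      then show ?thesis using refl[of s] that i(1) by (simp only: same_point_def IntE) auto
    qed
    have "p \<in> ball p r \<inter> X" using pX r by simp
    then show "ball p r \<inter> X \<noteq> {}" by blast
  qed (use X s hol hol' in \<open>auto intro: convex_connected\<close>)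
  then have "deriv (\<Gamma> i) q = deriv (\<lambda>s. \<Gamma> i (?l s)) q"
    by (rule deriv_cong_open[OF X(1) \<open>q \<in> X\<close>])
  also have "\<dots> = deriv (\<Gamma> i) q * deriv ?l q"
    using deriv_comp_holomorphic[OF lhol X(1) \<open>q \<in> X\<close> W(3)[OF i(1)] W(1)] lq \<open>q \<in> W\<close> by simp
  also have "deriv ?l q = -1" by (rule DERIV_imp_deriv) (auto intro!: derivative_eq_intros)
  finally show False using i(2) by simp
qed

text \<open>
  Analytic continuation in the convex set of all \<open>s\<close> with \<open>s\<close> and \<open>s + c\<close> in \<open>W\<close>.
\<close>
lemma translation_period_if_local:
  assumes u: "unit_speed_on A \<Gamma> W" and p: "p \<in> W" "p + c \<in> W"
    and ev: "\<forall>\<^sub>F s in nhds p. same_point A \<Gamma> s (s + c)"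
  shows "translation_period A \<Gamma> W c"
proof -
  have W: "open W" "convex W" "\<And>i. i \<in> A \<Longrightarrow> \<Gamma> i holomorphic_on W"
    using u by (auto simp: unit_speed_on_def)
  let ?l = "\<lambda>s. s + c"
  define X where "X = W \<inter> ?l -` W"
  have lW: "open (?l -` W)" by (intro open_vimage W continuous_intros)
  have "?l -` W = (\<lambda>s. - c + s) ` W"
    by (intro set_eqI iffI) (auto intro: image_eqI[of _ _ "_ + c"])
  then have "convex (?l -` W)" using W(2) by (simp only: convex_translation)
  then have X: "open X" "convex X" using W lW by (auto simp: X_def convex_Int)
  obtain Y where Y: "open Y" "p \<in> Y" "\<And>s. s \<in> Y \<Longrightarrow> same_point A \<Gamma> s (s + c)"
    using ev unfolding eventually_nhds by blast
  have lhol: "?l holomorphic_on X" by (intro holomorphic_intros)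
  have "\<Gamma> i s = \<Gamma> i (s + c)" if s: "s \<in> X" and i: "i \<in> A" for s i
  proof (rule analytic_continuation_open[of "Y \<inter> X" X "\<Gamma> i" "\<lambda>s. \<Gamma> i (s + c)"])
    show "\<Gamma> i holomorphic_on X" using W(3)[OF i] by (rule holomorphic_on_subset) (simp add: X_def)
    show "(\<lambda>s. \<Gamma> i (s + c)) holomorphic_on X"
      by (rule holomorphic_on_compose_gen[OF lhol W(3)[OF i], unfolded o_def]) (auto simp: X_def)
    show "\<Gamma> i s = \<Gamma> i (s + c)" if "s \<in> Y \<inter> X" for s
      using Y(3)[of s] that i by (simp add: same_point_def)
  qed (use X Y p s in \<open>auto intro: convex_connected simp: X_def\<close>)
  then show ?thesis by (simp add: translation_period_def same_point_def X_def)
qed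

lemma coincidence_isolated_or_translation:
  assumes u: "unit_speed_on A \<Gamma> W" and p: "p \<in> W" "p' \<in> W"
  obtains r where "r > 0"
    "\<And>s s'. s \<in> ball p r \<Longrightarrow> s' \<in> ball p' r \<Longrightarrow> same_point A \<Gamma> s s' \<Longrightarrow>
       s = p \<and> s' = p' \<or> translation_period A \<Gamma> W (p' - p) \<and> s' - s = p' - p"
proof (rule coincidence_isolated_or_isometric[OF u p])
  fix r assume "r > 0"
    "\<And>s s'. s \<in> ball p r \<Longrightarrow> s' \<in> ball p' r \<Longrightarrow> same_point A \<Gamma> s s' \<Longrightarrow> s = p \<and> s' = p'"
  then show thesis by (intro that[of r]) auto
next
  fix r e assume r: "r > 0" and e: "e = (1::complex) \<or> e = -1"
    and same: "\<And>s. s \<in> ball p r \<Longrightarrow> same_point A \<Gamma> s (p' + e * (s - p))"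
    and uniq: "\<And>s s'. s \<in> ball p r \<Longrightarrow> s' \<in> ball p' r \<Longrightarrow> same_point A \<Gamma> s s' \<Longrightarrow> s' = p' + e * (s - p)"
  have "e \<noteq> -1"
  proof
    assume "e = -1"
    then show False using no_reflection[OF u p r] same by blast
  qed
  with e have e1: "e = 1" by simp
  have "translation_period A \<Gamma> W (p' - p)"
  proof (rule translation_period_if_local[OF u p(1)])
    have "\<forall>\<^sub>F s in nhds p. s \<in> ball p r" by (rule eventually_nhds_in_open) (use r in auto)
    then show "\<forall>\<^sub>F s in nhds p. same_point A \<Gamma> s (s + (p' - p))"
    proof eventually_elim
      case (elim s)
      have "p' + e * (s - p) = s + (p' - p)" by (simp add: e1)
      with same[OF elim] show ?case by (simp only:)
    qed
  qed (use p in simp)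
  then show thesis
    using r uniq e1 by (intro that[of r]) (auto simp: algebra_simps)
qed

lemma translation_period_neg:
  assumes "translation_period A \<Gamma> W c"
  shows "translation_period A \<Gamma> W (- c)"
  unfolding translation_period_def
proof (intro allI impI)
  fix s assume s: "s \<in> W \<and> s + - c \<in> W"
  then have "same_point A \<Gamma> (s + - c) (s + - c + c)"
    using assms unfolding translation_period_def by (metis add.assoc add.left_inverse add.right_neutral)
  then show "same_point A \<Gamma> s (s + - c)" by (simp add: same_point_def)
qed

text \<open>
  The intermediate points \<open>s + j L\<close> lie in \<open>W\<close> by convexity, so that the single steps can be chained.
\<close>
lemma same_point_multiple_of_period:
  assumes W: "convex W" and per: "translation_period A \<Gamma> W (of_real L)"
    and "s \<in> W" "s + of_real (real n * L) \<in> W"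
  shows "same_point A \<Gamma> s (s + of_real (real n * L))"
  using assms(4)
proof (induction n)
  case 0
  then show ?case by (simp add: same_point_def)
next
  case (Suc n)
  \<comment> \<open>The point \<open>s + n L\<close> is this fraction of the way from \<open>s\<close> to \<open>s + (n + 1) L\<close>.\<close>
  define v where "v = real n / real (Suc n)"
  have v: "0 \<le> v" "v \<le> 1" by (auto simp: v_def)
  define M where "M = real (Suc n) * L"
  have "real n * L = v * M" by (simp add: v_def M_def field_simps)
  then have "s + of_real (real n * L) = (1 - v) *\<^sub>R s + v *\<^sub>R (s + of_real M)"
    by (simp add: scaleR_conv_of_real algebra_simps)
  also have "\<dots> \<in> W"
    by (rule convexD[OF W \<open>s \<in> W\<close> Suc.prems[folded M_def]]) (use v in auto)
  finally have mem: "s + of_real (real n * L) \<in> W" .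
  have eq: "s + of_real (real n * L) + of_real L = s + of_real (real (Suc n) * L)"
    by (simp add: algebra_simps)
  have "same_point A \<Gamma> (s + of_real (real n * L)) (s + of_real (real (Suc n) * L))"
    using per mem Suc.prems eq unfolding translation_period_def by metis
  with Suc.IH[OF mem] show ?case by (rule same_point_trans)
qed

text \<open>
  Near the left end \<open>\<alpha>\<close> all of \<open>s\<close>, \<open>s + c'\<close> and \<open>s + (c' - c)\<close> are in \<open>W\<close>, and the last two
  differ by \<open>c\<close>.
\<close>
lemma translation_period_diff:
  assumes u: "unit_speed_on A \<Gamma> W" and J: "real_interval \<alpha> \<beta> \<subseteq> W"
    and c: "0 < c" "c < c'" "c' \<le> \<beta> - \<alpha>"
    and per: "translation_period A \<Gamma> W (of_real c)" "translation_period A \<Gamma> W (of_real c')"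
  shows "translation_period A \<Gamma> W (of_real (c' - c))"
proof (rule translation_period_if_local[OF u, of "of_real \<alpha>"])
  have W: "open W" using u by (simp add: unit_speed_on_def)
  have mem: "complex_of_real (\<alpha> + x) \<in> W" if "0 \<le> x" "x \<le> \<beta> - \<alpha>" for x
  proof -
    have "complex_of_real (\<alpha> + x) \<in> real_interval \<alpha> \<beta>"
      unfolding real_interval_def by (rule imageI) (use that in auto)
    then show ?thesis using J by blast
  qed
  show m: "complex_of_real \<alpha> \<in> W" "complex_of_real \<alpha> + of_real (c' - c) \<in> W"
    using mem[of 0] mem[of "c' - c"] c by auto
  have ev: "\<forall>\<^sub>F s in nhds (complex_of_real \<alpha>). s + of_real x \<in> W" if "0 \<le> x" "x \<le> \<beta> - \<alpha>" for x
  proof -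
    have "open ((\<lambda>s. s + complex_of_real x) -` W)" by (intro open_vimage W continuous_intros)
    moreover have "complex_of_real \<alpha> \<in> (\<lambda>s. s + complex_of_real x) -` W" using mem[OF that] by simp
    ultimately have "\<forall>\<^sub>F s in nhds (complex_of_real \<alpha>). s \<in> (\<lambda>s. s + complex_of_real x) -` W"
      by (rule eventually_nhds_in_open)
    then show ?thesis by (rule eventually_mono) simp
  qed
  have "\<forall>\<^sub>F s in nhds (complex_of_real \<alpha>). s + of_real 0 \<in> W" "\<forall>\<^sub>F s in nhds (complex_of_real \<alpha>). s + of_real c' \<in> W"
    "\<forall>\<^sub>F s in nhds (complex_of_real \<alpha>). s + of_real (c' - c) \<in> W"
    by (rule ev; use c in simp)+
  then show "\<forall>\<^sub>F s in nhds (complex_of_real \<alpha>). same_point A \<Gamma> s (s + of_real (c' - c))"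
  proof eventually_elim
    case (elim s)
    have eq: "s + of_real (c' - c) + of_real c = s + of_real c'" by simp
    have "same_point A \<Gamma> s (s + of_real c')"
      using per(2) elim by (simp add: translation_period_def)
    moreover have "same_point A \<Gamma> (s + of_real (c' - c)) (s + of_real (c' - c) + of_real c)"
      using per(1) elim(2,3) unfolding translation_period_def eq[symmetric] by blast
    ultimately show ?case unfolding eq by (simp add: same_point_def)
  qed
qed

text \<open>
  The curve is injective near \<open>\<alpha>\<close>.
\<close>
lemma no_small_translation_periods:
  assumes u: "unit_speed_on A \<Gamma> W" and J: "real_interval \<alpha> \<beta> \<subseteq> W" "\<alpha> \<le> \<beta>"
  obtains \<delta> :: real where "\<delta> > 0"
    "\<And>c. 0 < c \<Longrightarrow> c < \<delta> \<Longrightarrow> c \<le> \<beta> - \<alpha> \<Longrightarrow> \<not> translation_period A \<Gamma> W (of_real c)"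
proof -
  have W: "open W" "\<And>i. i \<in> A \<Longrightarrow> \<Gamma> i holomorphic_on W" using u by (auto simp: unit_speed_on_def)
  have \<alpha>: "complex_of_real \<alpha> \<in> W" using J by (auto simp: real_interval_def)
  obtain i where i: "i \<in> A" "deriv (\<Gamma> i) (of_real \<alpha>) \<noteq> 0"
    using unit_speed_nonzero_derivative[OF u \<alpha>] .
  obtain r where r: "r > 0" "inj_on (\<Gamma> i) (ball (of_real \<alpha>) r)"
    using has_complex_derivative_locally_injective[OF W(2)[OF i(1)] \<alpha> W(1) i(2)] by metis
  show thesis
  proof (rule that[of r])
    fix c :: real assume c: "0 < c" "c < r" "c \<le> \<beta> - \<alpha>"
    show "\<not> translation_period A \<Gamma> W (of_real c)"
    proof
      assume per: "translation_period A \<Gamma> W (of_real c)"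
      have "complex_of_real (\<alpha> + c) \<in> real_interval \<alpha> \<beta>"
        unfolding real_interval_def by (rule imageI) (use c in auto)
      then have "complex_of_real (\<alpha> + c) \<in> W" using J(1) by blast
      then have "same_point A \<Gamma> (of_real \<alpha>) (of_real \<alpha> + of_real c)"
        using per \<alpha> by (simp add: translation_period_def)
      then have "\<Gamma> i (of_real \<alpha>) = \<Gamma> i (of_real \<alpha> + of_real c)" using i(1) by (simp add: same_point_def)
      moreover have "complex_of_real \<alpha> \<in> ball (of_real \<alpha>) r" "complex_of_real \<alpha> + of_real c \<in> ball (of_real \<alpha>) r"
        using r(1) c by (auto simp: dist_norm)
      ultimately have "complex_of_real \<alpha> = of_real \<alpha> + of_real c" using r(2) by (meson inj_onD)
      then show False using c by simp
    qed
  qed (use r in auto)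
qed

text \<open>
  By the previous two lemmas positive periods differ by at least \<open>\<delta>\<close>, hence there is a least one, and
  subtracting it repeatedly shows that the others are its multiples.  Without a period, \<open>L = \<beta> - \<alpha> + 1\<close>
  exceeds all differences of real parts within \<open>W\<close>; this is why the width of \<open>W\<close> is restricted.
\<close>
lemma fundamental_period:
  assumes u: "unit_speed_on A \<Gamma> W" and J: "real_interval \<alpha> \<beta> \<subseteq> W" "\<alpha> \<le> \<beta>"
    and width: "\<And>s. s \<in> W \<Longrightarrow> \<alpha> - 1 / 2 < Re s \<and> Re s < \<beta> + 1 / 2"
  obtains L :: real where "L > 0"
    "\<And>c. \<bar>c\<bar> \<le> \<beta> - \<alpha> \<Longrightarrow> translation_period A \<Gamma> W (of_real c) \<Longrightarrow> \<exists>k::int. c = of_int k * L"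
    "\<And>s s' k. s \<in> W \<Longrightarrow> s' \<in> W \<Longrightarrow> s' - s = of_real (of_int k * L) \<Longrightarrow> same_point A \<Gamma> s s'"
proof -
  define P where "P = {c. 0 < c \<and> c \<le> \<beta> - \<alpha> \<and> translation_period A \<Gamma> W (of_real c)}"
  have signed: "\<exists>k::int. c = of_int k * L"
    if pos: "\<And>c. c \<in> P \<Longrightarrow> \<exists>k::int. c = of_int k * L"
      and c: "\<bar>c\<bar> \<le> \<beta> - \<alpha>" "translation_period A \<Gamma> W (of_real c)" for c L
  proof -
    consider "c = 0" | "c > 0" | "c < 0" by linarith
    then show ?thesis
    proof cases
      case 1
      then show ?thesis by (intro exI[of _ 0]) simp
    next
      case 2
      then show ?thesis using pos[of c] c by (simp add: P_def)
    next
      case 3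
      then have "- c \<in> P" using c translation_period_neg[OF c(2)] by (simp add: P_def)
      then obtain k :: int where "- c = of_int k * L" using pos by blast
      then show ?thesis by (intro exI[of _ "- k"]) simp
    qed
  qed
  show thesis
  proof (cases "P = {}")
    case True
    define L where "L = \<beta> - \<alpha> + 1"
    have "L > 0" using J by (simp add: L_def)
    show thesis
    proof (rule that[of L])
      show "\<exists>k::int. c = of_int k * L"
        if "\<bar>c\<bar> \<le> \<beta> - \<alpha>" "translation_period A \<Gamma> W (of_real c)" for c
        using signed[of L c] that True by simp
      show "same_point A \<Gamma> s s'" if s: "s \<in> W" "s' \<in> W" "s' - s = of_real (of_int k * L)" for s s' k
      proof -
        have "Re s' - Re s = of_int k * L" using s(3) by (metis minus_complex.sel(1) Re_complex_of_real)
        then have lt: "\<bar>of_int k * L\<bar> < L" using width[OF s(1)] width[OF s(2)] by (auto simp: L_def)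
        have "k = 0"
        proof (rule ccontr)
          assume "k \<noteq> 0"
          then have "1 \<le> \<bar>real_of_int k\<bar>" by linarith
          then have "1 * L \<le> \<bar>real_of_int k\<bar> * L" using \<open>L > 0\<close> by (intro mult_right_mono) auto
          then show False using lt \<open>L > 0\<close> by (simp add: abs_mult)
        qed
        then have "s' = s" using s(3) by simp
        then show ?thesis by (simp add: same_point_def)
      qed
    qed (use \<open>L > 0\<close> in auto)
  next
    case False
    obtain \<delta> where \<delta>: "\<delta> > 0"
      "\<And>c. 0 < c \<Longrightarrow> c < \<delta> \<Longrightarrow> c \<le> \<beta> - \<alpha> \<Longrightarrow> \<not> translation_period A \<Gamma> W (of_real c)"
      using no_small_translation_periods[OF u J] by blast
    have diff: "c' - c \<in> P" if "c \<in> P" "c' \<in> P" "c < c'" for c c'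
      using translation_period_diff[OF u J(1), of c c'] that by (auto simp: P_def)
    have big: "\<delta> \<le> c" if "c \<in> P" for c using \<delta>(2)[of c] that by (force simp: P_def)
    have bdd: "bdd_below P" by (intro bdd_belowI[of _ 0]) (auto simp: P_def)
    have "Inf P < Inf P + \<delta>" using \<delta>(1) by simp
    then obtain L where L: "L \<in> P" "L < Inf P + \<delta>" using cInf_lessD[OF False] by blast
    have least: "L \<le> c" if "c \<in> P" for c
    proof (rule ccontr)
      assume "\<not> L \<le> c"
      then have "L - c \<in> P" using diff[OF that L(1)] by simp
      then have "\<delta> \<le> L - c" by (rule big)
      moreover have "Inf P \<le> c" using cInf_lower[OF that bdd] .
      ultimately show False using L(2) by simp
    qed
    have "L > 0" using L(1) by (simp add: P_def)
    have mult_nat: "\<exists>k::nat. c = real k * L" if "c \<in> P" "c < real n * L" for c n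
      using that
    proof (induction n arbitrary: c)
      case 0
      then show ?case by (simp add: P_def)
    next
      case (Suc n)
      show ?case
      proof (cases "c = L")
        case True
        then show ?thesis by (intro exI[of _ 1]) simp
      next
        case False
        then have "L < c" using least[OF Suc.prems(1)] by simp
        then have "c - L \<in> P" using diff[OF L(1) Suc.prems(1)] by simp
        moreover have "c - L < real n * L" using Suc.prems(2) by (simp add: algebra_simps)
        ultimately obtain k :: nat where "c - L = real k * L" using Suc.IH by blast
        then show ?thesis by (intro exI[of _ "Suc k"]) (simp add: algebra_simps)
      qed
    qed
    have mult: "\<exists>k::int. c = of_int k * L" if c: "c \<in> P" for c
    proof -
      obtain n where "c < real n * L" using reals_Archimedean3[OF \<open>L > 0\<close>] by blast
      then obtain k :: nat where "c = real k * L" using mult_nat[OF c] by blast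
      then show ?thesis by (intro exI[of _ "int k"]) simp
    qed
    have conv: "convex W" using u by (simp add: unit_speed_on_def)
    have per: "translation_period A \<Gamma> W (of_real L)" using L(1) by (simp add: P_def)
    show thesis
    proof (rule that[of L])
      show "\<exists>k::int. c = of_int k * L"
        if "\<bar>c\<bar> \<le> \<beta> - \<alpha>" "translation_period A \<Gamma> W (of_real c)" for c
        using signed[OF mult that] .
      show "same_point A \<Gamma> s s'" if s: "s \<in> W" "s' \<in> W" "s' - s = of_real (of_int k * L)" for s s' k
      proof (cases "k \<ge> 0")
        case True
        then obtain n where n: "k = int n" using nonneg_int_cases by blast
        have "s' = s + of_real (real n * L)" using s(3) n by (simp add: algebra_simps)
        then show ?thesis using same_point_multiple_of_period[OF conv per s(1)] s(2) by metis
      next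
        case False
        define n where "n = nat (- k)"
        have k: "real_of_int k = - real n" using False by (simp add: n_def)
        have "s = s' + of_real (real n * L)" using s(3) by (simp add: k algebra_simps)
        then show ?thesis
          using same_point_multiple_of_period[OF conv per s(2)] s(1) same_point_sym by metis
      qed
    qed fact
  qed
qed

text \<open>
  Around each pair of points of the interval at most that pair itself is a coincidence that is not a
  multiple of \<open>L\<close>.  Compactness of the square of the interval gives finitely many such pairs in a
  neighbourhood of the form \<open>N \<times> N\<close>.
\<close>
lemma finitely_many_coincidences:
  assumes u: "unit_speed_on A \<Gamma> W" and J: "real_interval \<alpha> \<beta> \<subseteq> W" "\<alpha> \<le> \<beta>"
    and L: "\<And>c. \<bar>c\<bar> \<le> \<beta> - \<alpha> \<Longrightarrow> translation_period A \<Gamma> W (of_real c) \<Longrightarrow> \<exists>k::int. c = of_int k * L"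
  obtains N where "open N" "real_interval \<alpha> \<beta> \<subseteq> N" "N \<subseteq> W"
    "finite {(s, s'). s \<in> N \<and> s' \<in> N \<and> same_point A \<Gamma> s s' \<and> (\<nexists>k::int. s' - s = of_real (of_int k * L))}"
proof -
  let ?J = "real_interval \<alpha> \<beta>"
  let ?bad = "\<lambda>s s'. same_point A \<Gamma> s s' \<and> (\<nexists>k::int. s' - s = of_real (of_int k * L))"
  have W: "open W" using u by (simp add: unit_speed_on_def)
  have "\<exists>r>0. \<forall>s s'. s \<in> ball p r \<longrightarrow> s' \<in> ball p' r \<longrightarrow> ?bad s s' \<longrightarrow> s = p \<and> s' = p'"
    if p: "p \<in> ?J" "p' \<in> ?J" for p p'
  proof -
    have pW: "p \<in> W" "p' \<in> W" using p J by auto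
    obtain r where r: "r > 0"
      "\<And>s s'. s \<in> ball p r \<Longrightarrow> s' \<in> ball p' r \<Longrightarrow> same_point A \<Gamma> s s' \<Longrightarrow>
         s = p \<and> s' = p' \<or> translation_period A \<Gamma> W (p' - p) \<and> s' - s = p' - p"
      using coincidence_isolated_or_translation[OF u pW] by blast
    obtain x x' where x: "p = of_real x" "p' = of_real x'" "x \<in> {\<alpha>..\<beta>}" "x' \<in> {\<alpha>..\<beta>}"
      using p by (auto simp: real_interval_def)
    have "s = p \<and> s' = p'" if s: "s \<in> ball p r" "s' \<in> ball p' r" "?bad s s'" for s s'
    proof (rule ccontr)
      assume "\<not> (s = p \<and> s' = p')"
      then have "translation_period A \<Gamma> W (p' - p)" and eq: "s' - s = p' - p" using r(2) s by blast+
      then have "translation_period A \<Gamma> W (of_real (x' - x))" by (simp add: x)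
      moreover have "\<bar>x' - x\<bar> \<le> \<beta> - \<alpha>" using x(3,4) by auto
      ultimately obtain k :: int where "x' - x = of_int k * L" using L by blast
      moreover have "s' - s = of_real (x' - x)" using eq x by simp
      ultimately show False using s(3) by metis
    qed
    with r(1) show ?thesis by blast
  qed
  then have "\<forall>q\<in>?J \<times> ?J. \<exists>r>0. \<forall>s s'. s \<in> ball (fst q) r \<longrightarrow> s' \<in> ball (snd q) r \<longrightarrow> ?bad s s' \<longrightarrow> (s, s') = q"
    by (auto simp: prod_eq_iff)
  from bchoice[OF this] obtain r where r': "\<forall>q\<in>?J \<times> ?J. r q > 0 \<and>
      (\<forall>s s'. s \<in> ball (fst q) (r q) \<longrightarrow> s' \<in> ball (snd q) (r q) \<longrightarrow> ?bad s s' \<longrightarrow> (s, s') = q)"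
    by (elim exE)
  have r: "r q > 0" if "q \<in> ?J \<times> ?J" for q using r' that by blast
  have r2: "(s, s') = q" if "q \<in> ?J \<times> ?J" "s \<in> ball (fst q) (r q)" "s' \<in> ball (snd q) (r q)" "?bad s s'"
    for q s s'
    using bspec[OF r' that(1)] that(2-4) by simp
  define B where "B q = ball (fst q) (r q) \<times> ball (snd q) (r q)" for q
  have JJ: "compact (?J \<times> ?J)" by (intro compact_Times compact_real_interval)
  have opB: "\<And>q. q \<in> ?J \<times> ?J \<Longrightarrow> open (B q)" unfolding B_def by (intro open_Times) auto
  have cov: "?J \<times> ?J \<subseteq> (\<Union>q\<in>?J \<times> ?J. B q)" using r by (force simp: B_def)
  obtain Q where Q: "Q \<subseteq> ?J \<times> ?J" "finite Q" "?J \<times> ?J \<subseteq> (\<Union>q\<in>Q. B q)"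
    by (rule compactE_image[OF JJ opB cov])
  have "open (\<Union>q\<in>Q. B q)" using opB Q(1) by blast
  then obtain e where e: "e > 0" "(\<Union>q\<in>?J \<times> ?J. ball q e) \<subseteq> (\<Union>q\<in>Q. B q)"
    using compact_subset_open_imp_ball_epsilon_subset[OF JJ _ Q(3)] by metis
  define N where "N = W \<inter> (\<Union>p\<in>?J. ball p (e / 2))"
  have "{(s, s'). s \<in> N \<and> s' \<in> N \<and> ?bad s s'} \<subseteq> Q"
  proof safe
    fix s s' assume s: "s \<in> N" "s' \<in> N" "same_point A \<Gamma> s s'" "\<nexists>k::int. s' - s = of_real (of_int k * L)"
    obtain p p' where p: "p \<in> ?J" "p' \<in> ?J" "s \<in> ball p (e / 2)" "s' \<in> ball p' (e / 2)"
      using s(1,2) by (auto simp: N_def)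
    have "dist (p, p') (s, s') \<le> dist p s + dist p' s'"
      by (simp add: dist_Pair_Pair sqrt_sum_squares_le_sum)
    also have "\<dots> < e" using p(3,4) by simp
    finally have "(s, s') \<in> (\<Union>q\<in>?J \<times> ?J. ball q e)" using p(1,2) by auto
    then obtain q where "q \<in> Q" "(s, s') \<in> B q" using e(2) by blast
    then have "(s, s') = q" using r2[of q s s'] Q(1) s(3,4) by (auto simp: B_def)
    with \<open>q \<in> Q\<close> show "(s, s') \<in> Q" by simp
  qed
  then have "finite {(s, s'). s \<in> N \<and> s' \<in> N \<and> ?bad s s'}" using Q(2) finite_subset by blast
  moreover have "open N" using W by (auto simp: N_def)
  moreover have "?J \<subseteq> N" using J e(1) by (force simp: N_def)
  ultimately show thesis using that[of N] by (auto simp: N_def)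
qed

section \<open>The factorization and its universal property\<close>

lemma determined_near_finite_family:
  assumes "finite A" "\<And>f. f \<in> A \<Longrightarrow> determined_near F K f"
  obtains V E where "open V" "K \<subseteq> V" "finite E"
    "\<And>f z z'. f \<in> A \<Longrightarrow> z \<in> V - E \<Longrightarrow> z' \<in> V - E \<Longrightarrow> F z = F z' \<Longrightarrow> f z = f z'"
proof -
  have "\<forall>f\<in>A. \<exists>V E. open V \<and> K \<subseteq> V \<and> finite E \<and>
        (\<forall>z\<in>V - E. \<forall>z'\<in>V - E. F z = F z' \<longrightarrow> f z = f z')"
    using assms(2) by (simp add: determined_near_def)
  then obtain V E where VE: "\<forall>f\<in>A. open (V f) \<and> K \<subseteq> V f \<and> finite (E f) \<and>
        (\<forall>z\<in>V f - E f. \<forall>z'\<in>V f - E f. F z = F z' \<longrightarrow> f z = f z')"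
    unfolding bchoice_iff by blast
  show thesis
  proof (rule that[of "\<Inter>f\<in>A. V f" "\<Union>f\<in>A. E f"])
    show "open (\<Inter>f\<in>A. V f)" "K \<subseteq> (\<Inter>f\<in>A. V f)" "finite (\<Union>f\<in>A. E f)"
      using assms(1) VE by auto
    fix f z z'
    assume f: "f \<in> A" and z: "z \<in> (\<Inter>f\<in>A. V f) - (\<Union>f\<in>A. E f)" "z' \<in> (\<Inter>f\<in>A. V f) - (\<Union>f\<in>A. E f)"
      and eq: "F z = F z'"
    have "z \<in> V f - E f" "z' \<in> V f - E f" using f z by auto
    then show "f z = f z'" using VE f eq by blast
  qed
qed

lemma determined_near_component:
  fixes F :: "complex \<Rightarrow> complex ^ 'n"
  assumes "F vec_holomorphic_on U" "open U" "K \<subseteq> U"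
  shows "determined_near F K (\<lambda>z. F z $ j)"
proof -
  have "(\<lambda>z. F z $ j) holomorphic_on U" using assms(1) by (simp add: vec_holomorphic_on_def)
  then have "(\<lambda>z. F z $ j) analytic_on K"
    using assms(2,3) analytic_on_holomorphic by blast
  moreover have "open UNIV \<and> K \<subseteq> UNIV \<and> finite {} \<and>
      (\<forall>z\<in>UNIV - {}. \<forall>z'\<in>UNIV - {}. F z = F z' \<longrightarrow> F z $ j = F z' $ j)" by simp
  ultimately show ?thesis unfolding determined_near_def by blast
qed

lemma nonconstant_component:
  fixes F :: "complex \<Rightarrow> complex ^ 'n"
  assumes U: "complex_domain U" and F: "F vec_holomorphic_on U" "\<not> F constant_on U"
  obtains j where "nowhere_locally_constant_on (\<lambda>z. F z $ j) U"
proof -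
  have "\<exists>j. \<not> (\<lambda>z. F z $ j) constant_on U"
  proof (rule ccontr)
    assume "\<not> ?thesis"
    then have "\<forall>j. \<exists>c. \<forall>z\<in>U. F z $ j = c" by (simp add: constant_on_def)
    then obtain c where "\<And>j z. z \<in> U \<Longrightarrow> F z $ j = c j" by metis
    then have "\<And>z. z \<in> U \<Longrightarrow> F z = (\<chi> j. c j)" by (simp add: vec_eq_iff)
    then show False using F(2) by (auto simp: constant_on_def)
  qed
  then obtain j where "\<not> (\<lambda>z. F z $ j) constant_on U" by blast
  moreover have "(\<lambda>z. F z $ j) holomorphic_on U" using F(1) by (simp add: vec_holomorphic_on_def)
  ultimately show thesis
    using that nowhere_locally_constant_on_connected U by (metis complex_domain_def)
qed

lemma not_eventually_constant:
  assumes "nowhere_locally_constant_on f U" "open U" "t \<in> U"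
  shows "\<not> (\<forall>\<^sub>F z in nhds t. f z = c)"
proof
  assume "\<forall>\<^sub>F z in nhds t. f z = c"
  then obtain X where X: "open X" "t \<in> X" "\<And>z. z \<in> X \<Longrightarrow> f z = c" unfolding eventually_nhds by blast
  then have "open (X \<inter> U)" "X \<inter> U \<noteq> {}" "f constant_on X \<inter> U"
    using assms(2,3) by (auto simp: constant_on_def)
  then show False using assms(1) unfolding nowhere_locally_constant_on_def by blast
qed

definition injective_factorization ::
    "(complex \<Rightarrow> 'a) \<Rightarrow> complex set \<Rightarrow> (complex \<Rightarrow> complex) \<Rightarrow> (complex \<Rightarrow> 'a) \<Rightarrow> bool" where
  "injective_factorization F D h G \<longleftrightarrow>
     h holomorphic_on D \<and> (\<forall>z\<in>D. F z = G (h z)) \<and> inj_outside_finite G (h ` D)"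

text \<open>
  Equality of \<open>F\<close> on fibres of \<open>h1\<close> yields equality of \<open>h\<close> by injectivity of \<open>G\<close> off a finite set, and then
  \<open>h\<close> factors holomorphically through \<open>h1\<close>.
\<close>
lemma injective_factorization_universal:
  fixes F :: "complex \<Rightarrow> 'a"
  assumes D: "open D" "connected D" "D \<noteq> {}" "nowhere_locally_constant_on F D"
    and fac: "injective_factorization F D h G"
    and D1: "open D1" "h1 holomorphic_on D1" "\<And>z. z \<in> D1 \<Longrightarrow> F z = G1 (h1 z)"
  obtains q where "q holomorphic_on (h1 ` (D \<inter> D1))" "q ` (h1 ` (D \<inter> D1)) \<subseteq> h ` D"
    "\<And>z. z \<in> D \<inter> D1 \<Longrightarrow> h z = q (h1 z)" "\<And>w. w \<in> h1 ` (D \<inter> D1) \<Longrightarrow> G1 w = G (q w)"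
proof -
  have h: "h holomorphic_on D" "\<And>z. z \<in> D \<Longrightarrow> F z = G (h z)"
    using fac by (auto simp: injective_factorization_def)
  obtain E where E: "finite E" "inj_on G (h ` D - E)"
    using fac by (auto simp: injective_factorization_def inj_outside_finite_def)
  have nc: "\<not> h constant_on D"
  proof
    assume "h constant_on D"
    then have "F constant_on D" using h(2) by (auto simp: constant_on_def)
    then show False using D unfolding nowhere_locally_constant_on_def by blast
  qed
  let ?S = "D \<inter> D1"
  have S: "open ?S" using D(1) D1(1) by auto
  have hol: "h holomorphic_on ?S" "h1 holomorphic_on ?S"
    using h(1) D1(2) by (auto intro: holomorphic_on_subset)
  have nlc: "nowhere_locally_constant_on h1 ?S"
    unfolding nowhere_locally_constant_on_def
  proof (intro allI impI notI; elim conjE)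
    fix X assume X: "open X" "X \<noteq> {}" "X \<subseteq> ?S" "h1 constant_on X"
    then have "F constant_on X" using D1(3) by (force simp: constant_on_def)
    then show False using D(4) X unfolding nowhere_locally_constant_on_def by blast
  qed
  have eq: "G (h z) = G1 (h1 z)" if "z \<in> ?S" for z using h(2) D1(3) that by (metis IntD1 IntD2)
  have fib: "h z = h z'" if "z \<in> ?S" "z' \<in> ?S" "h1 z = h1 z'" for z z'
    by (rule equal_fibres_of_equal_outside_finite[OF h(1) D(1,2) nc hol(2) S nlc Int_lower1 E eq that])
  obtain q where q: "q holomorphic_on h1 ` ?S" "\<And>z. z \<in> ?S \<Longrightarrow> q (h1 z) = h z"
    using holomorphic_factor_through[OF hol(2) S nlc hol(1) fib] by blast
  show thesis
  proof (rule that[of q])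
    show "q ` (h1 ` ?S) \<subseteq> h ` D" using q(2) by auto
    show "G1 w = G (q w)" if "w \<in> h1 ` ?S" for w using that q(2) eq by auto
  qed (use q in auto)
qed

text \<open>
  The local generator \<open>m\<close> at \<open>t\<close> is determined by \<open>F\<close> off a finite set, which is injectivity of \<open>G\<close>, and
  the components of \<open>F\<close> are functions of \<open>m\<close>, which defines \<open>G\<close>.
\<close>
lemma factorization_at_point:
  fixes F :: "complex \<Rightarrow> complex ^ 'n"
  assumes U: "complex_domain U" and F: "F vec_holomorphic_on U" "\<not> F constant_on U" and t: "t \<in> U"
  obtains D h G where "complex_domain D" "D \<Subset> U" "t \<in> D" "h t = 1"
    "injective_factorization F D h G" "G vec_holomorphic_on (h ` D)"
proof -
  have opU: "open U" using U by (simp add: complex_domain_def)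
  obtain j0 where j0: "nowhere_locally_constant_on (\<lambda>z. F z $ j0) U"
    using nonconstant_component[OF U F] .
  have det: "determined_near F {t} (\<lambda>z. F z $ j)" for j
    by (rule determined_near_component[OF F(1) opU]) (use t in simp)
  obtain m k where m: "determined_near F {t} m" "k > 0" "vanishes_to_order m t k"
    "\<And>f. determined_near F {t} f \<Longrightarrow> \<exists>g. g analytic_on {0} \<and> (\<forall>\<^sub>F z in nhds t. f z = g (m z))"
    using generator_at_point[of "\<lambda>z. F z $ j0" F t] det not_eventually_constant[OF j0 opU t] by auto
  have "\<forall>j. \<exists>g. g analytic_on {0} \<and> (\<forall>\<^sub>F z in nhds t. F z $ j = g (m z))"
    using m(4) det by blast
  then obtain g where g: "\<And>j. g j analytic_on {0}" "\<And>j. \<forall>\<^sub>F z in nhds t. F z $ j = g j (m z)" by metis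
  obtain V E where VE: "m analytic_on {t}" "open V" "{t} \<subseteq> V" "finite E"
    "\<And>z z'. z \<in> V - E \<Longrightarrow> z' \<in> V - E \<Longrightarrow> F z = F z' \<Longrightarrow> m z = m z'"
    by (rule determined_nearE[OF m(1)]) (rule that; assumption)
  have m0: "m t = 0" using vanishes_to_order_value[OF m(3)] m(2) by simp
  have limm: "filterlim m (nhds 0) (nhds t)"
    using analytic_at_imp_isCont[OF VE(1)] tendsto_at_iff_tendsto_nhds[of m t]
    by (simp add: isCont_def m0)
  have "\<forall>\<^sub>F u in nhds 0. \<forall>j\<in>UNIV. g j analytic_on {u}"
    using g(1) by (intro eventually_ball_finite) (auto simp: eventually_analytic_at)
  then have ev1: "\<forall>\<^sub>F z in nhds t. \<forall>j\<in>UNIV. g j analytic_on {m z}"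
    using limm by (rule eventually_compose_filterlim)
  have ev2: "\<forall>\<^sub>F z in nhds t. \<forall>j\<in>UNIV. F z $ j = g j (m z)"
    using g(2) by (intro eventually_ball_finite) auto
  have ev3: "\<forall>\<^sub>F z in nhds t. m analytic_on {z}" using VE(1) by (rule eventually_analytic_at)
  have ev4: "\<forall>\<^sub>F z in nhds t. z \<in> V \<inter> U" by (rule eventually_nhds_in_open) (use VE t opU in auto)
  have "\<forall>\<^sub>F z in nhds t. (\<forall>j\<in>UNIV. g j analytic_on {m z}) \<and> (\<forall>j\<in>UNIV. F z $ j = g j (m z)) \<and>
      m analytic_on {z} \<and> z \<in> V \<inter> U"
    using ev1 ev2 ev3 ev4 by eventually_elim blast
  then obtain X where X: "open X" "t \<in> X" "\<And>z j. z \<in> X \<Longrightarrow> g j analytic_on {m z}"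
    "\<And>z j. z \<in> X \<Longrightarrow> F z $ j = g j (m z)" "\<And>z. z \<in> X \<Longrightarrow> m analytic_on {z}" "X \<subseteq> V" "X \<subseteq> U"
    unfolding eventually_nhds by blast
  obtain D where D: "open D" "convex D" "{t} \<subseteq> D" "D \<subseteq> X" "compact (closure D)" "closure D \<subseteq> X"
    by (rule convex_neighbourhood[of "{t}" X]) (use X(1,2) in auto)
  define h where "h z = 1 + m z" for z
  define G :: "complex \<Rightarrow> complex ^ 'n" where "G w = (\<chi> j. g j (w - 1))" for w
  have fac: "F z = G (h z)" if "z \<in> D" for z
    using X(4) D(4) that by (auto simp: G_def h_def vec_eq_iff)
  have "m analytic_on D" using X(5) D(4) by (subst analytic_on_analytic_at) auto
  then have hhol: "h holomorphic_on D" unfolding h_def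
    by (intro holomorphic_intros analytic_imp_holomorphic)
  have Ghol: "G vec_holomorphic_on (h ` D)"
    unfolding vec_holomorphic_on_def
  proof
    fix j
    have "g j analytic_on (m ` D)" using X(3) D(4) by (subst analytic_on_analytic_at) auto
    then have "g j holomorphic_on (m ` D)" by (rule analytic_imp_holomorphic)
    then have "(\<lambda>w. g j (w - 1)) holomorphic_on h ` D"
      by (rule holomorphic_on_compose_gen[of "\<lambda>w. w - 1", unfolded o_def, rotated])
         (auto intro!: holomorphic_intros simp: h_def)
    then show "(\<lambda>w. G w $ j) holomorphic_on h ` D" by (simp add: G_def)
  qed
  have "inj_outside_finite G (h ` D)"
    unfolding inj_outside_finite_def
  proof (intro exI[of _ "h ` (E \<inter> D)"] conjI inj_onI)
    fix w w' assume w: "w \<in> h ` D - h ` (E \<inter> D)" "w' \<in> h ` D - h ` (E \<inter> D)" "G w = G w'"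
    then obtain z z' where z: "z \<in> D" "z' \<in> D" "w = h z" "w' = h z'" by blast
    then have "z \<in> V - E" "z' \<in> V - E" using w D(4) X(6) by auto
    moreover have "F z = F z'" using fac z w(3) by simp
    ultimately have "m z = m z'" by (rule VE(5))
    then show "w = w'" using z by (simp add: h_def)
  qed (use VE(4) in auto)
  then have "injective_factorization F D h G"
    using hhol fac by (simp add: injective_factorization_def)
  moreover have "complex_domain D" "D \<Subset> U" "t \<in> D" "h t = 1"
    using D X(7) m0 by (auto simp: complex_domain_def relatively_compact_in_def convex_connected h_def)
  ultimately show thesis using that Ghol by blast
qed

text \<open>
  Away from the zeros of the derivative of a nonconstant component, the curve of the components is
  immersed with respect to the local generator.  At each of the finitely many zeros the generator itself is
  added to the family, which makes the enlarged curve immersed there.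
\<close>
lemma unit_speed_enlargement:
  fixes F :: "complex \<Rightarrow> complex ^ 'n"
  assumes U: "complex_domain U" and F: "F vec_holomorphic_on U" "\<not> F constant_on U"
    and ab: "a < b" and I: "real_interval a b \<subseteq> U" "F ` real_interval a b \<subseteq> real_vectors"
  obtains A :: "(complex \<Rightarrow> complex) set" and V \<theta> W \<Gamma>
  where "finite A" "\<And>j. (\<lambda>z. F z $ j) \<in> A" "\<And>f. f \<in> A \<Longrightarrow> determined_near F (real_interval a b) f"
    "unit_speed_factorization A (\<lambda>f. f) (real_interval a b) V \<theta> W \<Gamma>"
proof -
  let ?I = "real_interval a b"
  have opU: "open U" using U by (simp add: complex_domain_def)
  obtain j0 where j0: "nowhere_locally_constant_on (\<lambda>z. F z $ j0) U"
    using nonconstant_component[OF U F] .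
  define f0 where "f0 = (\<lambda>z. F z $ j0)"
  have f0: "f0 holomorphic_on U" "nowhere_locally_constant_on f0 U"
    using F(1) j0 by (auto simp: f0_def vec_holomorphic_on_def)
  define R where "R = {f. determined_near F ?I f \<and> f ` ?I \<subseteq> \<real>}"
  have comp: "(\<lambda>z. F z $ j) \<in> R" for j
    using determined_near_component[OF F(1) opU I(1)] I(2) by (auto simp: R_def real_vectors_def)
  have f0nc: "\<not> (\<forall>\<^sub>F z in nhds t. f0 z = f0 t)" if "t \<in> ?I" for t
    using not_eventually_constant[OF f0(2) opU] I(1) that by blast
  have "\<exists>m. m \<in> R \<and> (\<exists>k>0. vanishes_to_order m t k) \<and>
      (\<forall>f\<in>R. \<exists>g. g analytic_on {0} \<and> (\<forall>\<^sub>F z in nhds t. f z = g (m z)))" if t: "t \<in> ?I" for t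
    by (rule generator_on_real_interval[OF ab t, of f0 F])
       (use comp[of j0] f0nc[OF t] in \<open>auto simp: R_def f0_def\<close>)
  then obtain M where M: "\<And>t. t \<in> ?I \<Longrightarrow> M t \<in> R" "\<And>t. t \<in> ?I \<Longrightarrow> \<exists>k>0. vanishes_to_order (M t) t k"
      "\<And>t f. t \<in> ?I \<Longrightarrow> f \<in> R \<Longrightarrow> \<exists>g. g analytic_on {0} \<and> (\<forall>\<^sub>F z in nhds t. f z = g (M t z))"
    by metis
  define Z where "Z = {t \<in> ?I. deriv f0 t = 0}"
  have "finite Z"
  proof -
    have "\<forall>t\<in>?I. \<exists>r>0. \<forall>x\<in>ball t r - {t}. deriv f0 x \<noteq> 0"
      using isolated_critical_point[OF f0(1) opU f0(2)] I(1) by (metis subsetD)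
    then obtain r where r: "\<And>t. t \<in> ?I \<Longrightarrow> r t > 0" "\<And>t x. t \<in> ?I \<Longrightarrow> x \<in> ball t (r t) - {t} \<Longrightarrow> deriv f0 x \<noteq> 0"
      by metis
    have "?I \<subseteq> (\<Union>t\<in>?I. ball t (r t))" using r(1) by force
    then obtain C where C: "C \<subseteq> ?I" "finite C" "?I \<subseteq> (\<Union>t\<in>C. ball t (r t))"
      using compactE_image[OF compact_real_interval, of ?I "\<lambda>t. ball t (r t)"] by (metis open_ball)
    have "Z \<subseteq> C"
    proof
      fix z assume z: "z \<in> Z"
      then obtain t where "t \<in> C" "z \<in> ball t (r t)" using C(3) by (auto simp: Z_def)
      then show "z \<in> C" using r(2)[of t z] C(1) z by (auto simp: Z_def)
    qed
    then show ?thesis using C(2) finite_subset by blast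
  qed
  define A where "A = range (\<lambda>j z. F z $ j) \<union> M ` Z"
  have finA: "finite A" using \<open>finite Z\<close> by (simp add: A_def)
  have AR: "A \<subseteq> R" using comp M(1) by (auto simp: A_def Z_def)
  have f0A: "f0 \<in> A" by (auto simp: A_def f0_def)
  have gen: "\<exists>m g. m analytic_on {t} \<and> m ` ?I \<subseteq> \<real> \<and> \<not> (\<forall>\<^sub>F z in nhds t. m z = m t) \<and>
      (\<forall>i\<in>A. g i analytic_on {m t} \<and> (\<forall>\<^sub>F z in nhds t. i z = g i (m z))) \<and>
      (\<exists>i\<in>A. deriv (g i) (m t) \<noteq> 0)" if t: "t \<in> ?I" for t
  proof -
    obtain k where k: "k > 0" "vanishes_to_order (M t) t k" using M(2)[OF t] by blast
    have m0: "M t t = 0" using vanishes_to_order_value[OF k(2)] k(1) by simp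
    have nc: "\<not> (\<forall>\<^sub>F z in nhds t. M t z = M t t)"
      using not_eventually_zero_if_vanishes_to_order[OF k(2)] m0 by simp
    have "M t analytic_on ?I" "M t ` ?I \<subseteq> \<real>" using M(1)[OF t] by (auto simp: R_def determined_near_def)
    then have man: "M t analytic_on {t}" and mr: "M t ` ?I \<subseteq> \<real>" using t analytic_on_subset by blast+
    have "\<forall>i\<in>A. \<exists>g. g analytic_on {0} \<and> (\<forall>\<^sub>F z in nhds t. i z = g (M t z))" using M(3)[OF t] AR by blast
    then obtain g where g: "\<And>i. i \<in> A \<Longrightarrow> g i analytic_on {0}" "\<And>i. i \<in> A \<Longrightarrow> \<forall>\<^sub>F z in nhds t. i z = g i (M t z)"
      by metis
    show ?thesis
    proof (cases "t \<in> Z")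
      case True
      \<comment> \<open>As a member of the family, the generator is the identity function of itself.\<close>
      define g' where "g' = g(M t := (\<lambda>u. u))"
      have "M t \<in> A" using True by (auto simp: A_def)
      moreover have "deriv (g' (M t)) (M t t) \<noteq> 0" by (simp add: g'_def)
      moreover have "g' i analytic_on {M t t}" "\<forall>\<^sub>F z in nhds t. i z = g' i (M t z)" if "i \<in> A" for i
        using g(1)[OF that] g(2)[OF that] m0 by (auto simp: g'_def)
      ultimately show ?thesis using man mr nc by blast
    next
      case False
      then have d: "deriv f0 t \<noteq> 0" using t by (simp add: Z_def)
      have "deriv f0 t = deriv (\<lambda>z. g f0 (M t z)) t"
        using g(2)[OF f0A] by (intro deriv_cong_ev) auto
      also have "\<dots> = deriv (g f0) (M t t) * deriv (M t) t"
      proof -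
        have "M t field_differentiable at t" "g f0 field_differentiable at (M t t)"
          using man g(1)[OF f0A] m0 by (auto intro: analytic_on_imp_differentiable_at)
        then show ?thesis using deriv_chain[of "M t" t "g f0"] by (simp add: o_def)
      qed
      finally have "deriv (g f0) (M t t) \<noteq> 0" using d by auto
      moreover have "g i analytic_on {M t t}" "\<forall>\<^sub>F z in nhds t. i z = g i (M t z)" if "i \<in> A" for i
        using g(1)[OF that] g(2)[OF that] m0 by auto
      ultimately show ?thesis using man mr nc f0A by blast
    qed
  qed
  have Ar: "i ` ?I \<subseteq> \<real>" if "i \<in> A" for i using AR that by (auto simp: R_def)
  obtain V \<theta> W \<Gamma> where "unit_speed_factorization A (\<lambda>f. f) ?I V \<theta> W \<Gamma>"
    using unit_speed_factorization_exists[of a b A "\<lambda>f. f" f0, OF ab finA Ar f0A f0nc gen] .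
  moreover have "determined_near F ?I f" if "f \<in> A" for f using AR that by (auto simp: R_def)
  moreover have "(\<lambda>z. F z $ j) \<in> A" for j by (auto simp: A_def)
  ultimately show thesis using finA by (intro that)
qed

lemma continuous_image_real_interval:
  fixes \<theta> :: "complex \<Rightarrow> complex"
  assumes "continuous_on (real_interval a b) \<theta>" "\<theta> ` real_interval a b \<subseteq> \<real>" "a \<le> b"
  obtains \<alpha> \<beta> where "\<theta> ` real_interval a b = real_interval \<alpha> \<beta>" "\<alpha> \<le> \<beta>"
proof -
  let ?J = "\<theta> ` real_interval a b"
  have "compact ?J" by (rule compact_continuous_image[OF assms(1) compact_real_interval])
  then have "compact (Re ` ?J)"
    by (rule compact_continuous_image[OF continuous_on_Re[OF continuous_on_id]])
  moreover have "connected ?J"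
    by (rule connected_continuous_image[OF assms(1) convex_connected[OF convex_real_interval]])
  then have "connected (Re ` ?J)"
    by (rule connected_continuous_image[OF continuous_on_Re[OF continuous_on_id]])
  ultimately obtain \<alpha> \<beta> where R: "Re ` ?J = {\<alpha>..\<beta>}" using connected_compact_interval_1 by metis
  have "complex_of_real (Re w) = w" if "w \<in> ?J" for w using assms(2) that by (simp add: subset_iff)
  then have "of_real ` Re ` ?J = ?J" by (auto simp: image_iff)
  then have "?J = real_interval \<alpha> \<beta>"
    unfolding R real_interval_def[of \<alpha> \<beta>] by (rule sym)
  moreover have "real_interval a b \<noteq> {}" using assms(3) by (auto simp: real_interval_def)
  then have "\<alpha> \<le> \<beta>" using R by (metis atLeastatMost_empty_iff2 image_is_empty)
  ultimately show thesis by (rule that)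
qed

lemma exp_periodic_eq_iff:
  fixes L :: real
  assumes "L \<noteq> 0"
  shows "exp (2 * of_real pi * \<i> * s / of_real L) = exp (2 * of_real pi * \<i> * s' / of_real L) \<longleftrightarrow>
    (\<exists>k::int. s' - s = of_real (of_int k * L))"
proof -
  have "2 * of_real pi * \<i> * s' / of_real L = 2 * of_real pi * \<i> * s / of_real L + (of_int (2 * k) * of_real pi) * \<i> \<longleftrightarrow>
      s' - s = of_real (of_int k * L)" for k :: int
  proof -
    have "2 * of_real pi * \<i> * s / of_real L + (of_int (2 * k) * of_real pi) * \<i>
        = 2 * of_real pi * \<i> * (s + of_int k * of_real L) / of_real L"
      using assms by (simp add: field_simps)
    also have "2 * of_real pi * \<i> * s' / of_real L = \<dots> \<longleftrightarrow> s' = s + of_int k * of_real L"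
      using assms by simp
    finally show ?thesis by (auto simp: algebra_simps)
  qed
  then have "(\<exists>k::int. s' - s = of_real (of_int k * L)) \<longleftrightarrow>
      exp (2 * of_real pi * \<i> * s' / of_real L) = exp (2 * of_real pi * \<i> * s / of_real L)"
    unfolding exp_eq by auto
  then show ?thesis by auto
qed

text \<open>
  The map \<open>G\<close> is the factor of \<open>\<Gamma>\<close> through the exponential of period \<open>L\<close>.  Equal values of \<open>F\<close> give
  equal values of the whole family, off finitely many points, and so coincidences of \<open>\<Gamma>\<close>; these are
  differences by multiples of \<open>L\<close>, up to finitely many.
\<close>
lemma factorization_on_interval:
  fixes F :: "complex \<Rightarrow> complex ^ 'n"
  assumes U: "complex_domain U" and F: "F vec_holomorphic_on U" "\<not> F constant_on U"
    and ab: "a < b" and I: "real_interval a b \<subseteq> U" "F ` real_interval a b \<subseteq> real_vectors"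
  obtains D h G where "complex_domain D" "D \<Subset> U" "real_interval a b \<subseteq> D" "h ` real_interval a b \<subseteq> sphere 0 1"
    "injective_factorization F D h G" "G vec_holomorphic_on (h ` D)"
proof -
  let ?I = "real_interval a b"
  have opU: "open U" using U by (simp add: complex_domain_def)
  obtain A V \<theta> W \<Gamma> where A: "finite A" "\<And>j. (\<lambda>z. F z $ j) \<in> A"
      "\<And>f. f \<in> A \<Longrightarrow> determined_near F ?I f" "unit_speed_factorization A (\<lambda>f. f) ?I V \<theta> W \<Gamma>"
    by (rule unit_speed_enlargement[OF U F ab I]) (rule that; assumption)
  note VW = unit_speed_factorizationD[OF A(4)]
  have cont: "continuous_on ?I \<theta>"
    using VW(3,4) by (meson continuous_on_subset holomorphic_on_imp_continuous_on)
  obtain \<alpha> \<beta> where J: "\<theta> ` ?I = real_interval \<alpha> \<beta>" "\<alpha> \<le> \<beta>"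
    using continuous_image_real_interval[OF cont VW(5)] ab by (metis less_imp_le)
  \<comment> \<open>The strip keeps differences of parameters below \<open>\<beta> - \<alpha> + 1\<close>, as the choice of \<open>L\<close> without periods requires.\<close>
  define W' where "W' = W \<inter> {s. \<alpha> - 1 / 2 < Re s} \<inter> {s. Re s < \<beta> + 1 / 2}"
  have us: "unit_speed_on A \<Gamma> W'"
    unfolding unit_speed_on_def
  proof (intro conjI ballI)
    show "open W'" unfolding W'_def using VW(6) by (intro open_Int open_halfspace_Re_gt open_halfspace_Re_lt)
    show "convex W'" unfolding W'_def
      using VW(7) by (intro convex_Int convex_halfspace_Re_gt convex_halfspace_Re_lt)
    show "\<Gamma> f holomorphic_on W'" if "f \<in> A" for f
      using VW(9)[OF that] by (rule holomorphic_on_subset) (auto simp: W'_def)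
    show "(\<Sum>i\<in>A. deriv (\<Gamma> i) s ^ 2) = 1" if "s \<in> W'" for s using VW(11) that by (simp add: W'_def)
  qed
  have JW: "real_interval \<alpha> \<beta> \<subseteq> W'"
  proof -
    have "real_interval \<alpha> \<beta> \<subseteq> W" using J(1) VW(3,8) by blast
    then show ?thesis by (auto simp: W'_def real_interval_def)
  qed
  have width: "\<alpha> - 1 / 2 < Re s \<and> Re s < \<beta> + 1 / 2" if "s \<in> W'" for s using that by (simp add: W'_def)
  obtain L :: real where L: "L > 0"
    "\<And>c. \<bar>c\<bar> \<le> \<beta> - \<alpha> \<Longrightarrow> translation_period A \<Gamma> W' (of_real c) \<Longrightarrow> \<exists>k::int. c = of_int k * L"
    "\<And>s s' k. s \<in> W' \<Longrightarrow> s' \<in> W' \<Longrightarrow> s' - s = of_real (of_int k * L) \<Longrightarrow> same_point A \<Gamma> s s'"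
    by (rule fundamental_period[OF us JW J(2) width]) (assumption+, (rule that; assumption))
  obtain N where N: "open N" "real_interval \<alpha> \<beta> \<subseteq> N" "N \<subseteq> W'"
    "finite {(s, s'). s \<in> N \<and> s' \<in> N \<and> same_point A \<Gamma> s s' \<and> (\<nexists>k::int. s' - s = of_real (of_int k * L))}"
    by (rule finitely_many_coincidences[OF us JW J(2) L(2)]) assumption+
  define B where "B = {(s, s'). s \<in> N \<and> s' \<in> N \<and> same_point A \<Gamma> s s' \<and> (\<nexists>k::int. s' - s = of_real (of_int k * L))}"
  define ex where "ex s = exp (2 * of_real pi * \<i> * s / of_real L)" for s
  have ex_eq: "ex s = ex s' \<longleftrightarrow> (\<exists>k::int. s' - s = of_real (of_int k * L))" for s s'
    unfolding ex_def by (rule exp_periodic_eq_iff) (use L(1) in simp)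
  have exhol: "ex holomorphic_on S" for S unfolding ex_def by (intro holomorphic_intros) (use L in auto)
  have exnlc: "nowhere_locally_constant_on ex N"
  proof (rule nowhere_locally_constant_on_subset[of _ UNIV])
    have "ex 0 = 1" "ex (of_real (L / 2)) = -1" using L(1) by (simp_all add: ex_def)
    then have "\<not> ex constant_on UNIV" by (metis UNIV_I constant_on_def one_neq_neg_one)
    then show "nowhere_locally_constant_on ex UNIV"
      by (intro nowhere_locally_constant_on_connected exhol) auto
  qed simp
  have "\<exists>q. q holomorphic_on ex ` N \<and> (\<forall>s\<in>N. q (ex s) = \<Gamma> (\<lambda>z. F z $ j) s)" for j
  proof -
    have hol: "\<Gamma> (\<lambda>z. F z $ j) holomorphic_on N"
      using VW(9)[OF A(2)] by (rule holomorphic_on_subset) (use N(3) in \<open>auto simp: W'_def\<close>)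
    have fib: "\<Gamma> (\<lambda>z. F z $ j) s = \<Gamma> (\<lambda>z. F z $ j) s'" if ss: "s \<in> N" "s' \<in> N" "ex s = ex s'" for s s'
    proof -
      obtain k :: int where "s' - s = of_real (of_int k * L)" using ss(3) ex_eq by blast
      then have "same_point A \<Gamma> s s'" using L(3) N(3) ss by blast
      then show ?thesis using A(2) by (simp add: same_point_def)
    qed
    show ?thesis by (rule holomorphic_factor_through[OF exhol N(1) exnlc hol fib]) (assumption+, blast)
  qed
  then obtain q where q: "\<And>j. q j holomorphic_on ex ` N" "\<And>j s. s \<in> N \<Longrightarrow> q j (ex s) = \<Gamma> (\<lambda>z. F z $ j) s"
    by metis
  obtain V' E where E: "open V'" "?I \<subseteq> V'" "finite E"
    "\<And>f z z'. f \<in> A \<Longrightarrow> z \<in> V' - E \<Longrightarrow> z' \<in> V' - E \<Longrightarrow> F z = F z' \<Longrightarrow> f z = f z'"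
    by (rule determined_near_finite_family[OF A(1,3)]) (assumption+, (rule that; assumption))
  define X where "X = U \<inter> V' \<inter> (V \<inter> \<theta> -` N)"
  have "open (V \<inter> \<theta> -` N)"
    by (intro continuous_open_preimage holomorphic_on_imp_continuous_on VW N)
  then have opX: "open X" using opU E(1) by (auto simp: X_def)
  have "\<theta> ` ?I \<subseteq> N" using N(2) J(1) by simp
  then have IX: "?I \<subseteq> X" using I(1) E(2) VW(3) by (auto simp: X_def)
  obtain D where D: "open D" "convex D" "?I \<subseteq> D" "D \<subseteq> X" "compact (closure D)" "closure D \<subseteq> X"
    by (rule convex_neighbourhood[OF compact_real_interval convex_real_interval opX IX])
  define h where "h z = ex (\<theta> z)" for z
  define G :: "complex \<Rightarrow> complex ^ 'n" where "G w = (\<chi> j. q j w)" for w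
  have DN: "\<theta> z \<in> N" "z \<in> V" "z \<in> V'" if "z \<in> D" for z using D(4) that by (auto simp: X_def)
  have fac: "F z = G (h z)" if "z \<in> D" for z
    using q(2)[OF DN(1)[OF that]] VW(10)[OF A(2) DN(2)[OF that]] by (simp add: G_def h_def vec_eq_iff)
  have hhol: "h holomorphic_on D"
    unfolding h_def
    by (rule holomorphic_on_compose_gen[OF _ exhol[of UNIV], of \<theta>, unfolded o_def])
       (use VW(4) DN(2) in \<open>auto intro: holomorphic_on_subset\<close>)
  have "h ` D \<subseteq> ex ` N" using DN(1) by (auto simp: h_def)
  then have Ghol: "G vec_holomorphic_on (h ` D)"
    using q(1) by (auto simp: vec_holomorphic_on_def G_def intro: holomorphic_on_subset)
  have "inj_outside_finite G (h ` D)"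
    unfolding inj_outside_finite_def
  proof (intro exI[of _ "(h ` (E \<inter> D) \<union> ex ` fst ` B) \<inter> h ` D"] conjI inj_onI)
    show "finite ((h ` (E \<inter> D) \<union> ex ` fst ` B) \<inter> h ` D)" using E(3) N(4) by (simp add: B_def)
    fix w w' assume w: "w \<in> h ` D - (h ` (E \<inter> D) \<union> ex ` fst ` B) \<inter> h ` D"
      "w' \<in> h ` D - (h ` (E \<inter> D) \<union> ex ` fst ` B) \<inter> h ` D" "G w = G w'"
    then obtain z z' where z: "z \<in> D" "z' \<in> D" "w = h z" "w' = h z'" by blast
    then have zE: "z \<in> V' - E" "z' \<in> V' - E" using w DN(3) by auto
    have "F z = F z'" using fac z w(3) by simp
    then have "f z = f z'" if "f \<in> A" for f using E(4)[OF that zE] by simp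
    then have same: "same_point A \<Gamma> (\<theta> z) (\<theta> z')"
      using VW(10) DN(2) z(1,2) by (simp add: same_point_def)
    have "\<exists>k::int. \<theta> z' - \<theta> z = of_real (of_int k * L)"
    proof (rule ccontr)
      assume "\<not> ?thesis"
      then have "(\<theta> z, \<theta> z') \<in> B" using same DN(1) z(1,2) by (simp add: B_def)
      then have "w \<in> ex ` fst ` B" using z(3) by (force simp: h_def)
      then show False using w(1) by blast
    qed
    then show "w = w'" using z ex_eq by (simp add: h_def)
  qed auto
  then have "injective_factorization F D h G"
    using hhol fac by (simp add: injective_factorization_def)
  moreover have "complex_domain D" "D \<Subset> U"
  proof -
    have "D \<noteq> {}" using D(3) ab by (auto simp: real_interval_def)
    then show "complex_domain D" "D \<Subset> U"
      using D by (auto simp: complex_domain_def relatively_compact_in_def convex_connected X_def)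
  qed
  moreover have "h ` ?I \<subseteq> sphere 0 1"
  proof (rule image_subsetI)
    fix z assume "z \<in> ?I"
    then obtain x where "\<theta> z = of_real x" using VW(5) by (meson Reals_cases imageI subsetD)
    then have "h z = exp (\<i> * of_real (2 * pi * x / L))" by (simp add: h_def ex_def mult_ac)
    then show "h z \<in> sphere 0 1" by (simp only: norm_exp_i_times mem_sphere_0)
  qed
  ultimately show thesis using that[of D h G] D(3) Ghol by blast
qed

theorem theorem1p3:
  fixes F :: "complex \<Rightarrow> complex ^ 'n" and U :: "complex set" and a b :: real
  assumes "complex_domain U"
    and "F vec_holomorphic_on U"
    and "\<not> F constant_on U"
    and "a \<le> b"
    and "real_interval a b \<subseteq> U"
    and "F ` real_interval a b \<subseteq> real_vectors"
  shows "\<exists>(D :: complex set) (h :: complex \<Rightarrow> complex) (G :: complex \<Rightarrow> complex ^ 'n).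
    complex_domain D \<and> D \<Subset> U \<and> real_interval a b \<subseteq> D \<and>
    h holomorphic_on D \<and> \<not> h constant_on D \<and>
    G vec_holomorphic_on (h ` D) \<and> \<not> G constant_on (h ` D) \<and>
    (\<forall>z\<in>D. F z = G (h z)) \<and>
    h ` real_interval a b \<subseteq> sphere 0 1 \<and>
    inj_outside_finite G (h ` D) \<and>
    (\<forall>(D1 :: complex set) (h1 :: complex \<Rightarrow> complex) (G1 :: complex \<Rightarrow> complex ^ 'n).
      complex_domain D1 \<and> D1 \<Subset> U \<and> real_interval a b \<subseteq> D1 \<and>
      h1 holomorphic_on D1 \<and> G1 vec_holomorphic_on (h1 ` D1) \<and>
      (\<forall>z\<in>D1. F z = G1 (h1 z))
      \<longrightarrow> (\<exists>q :: complex \<Rightarrow> complex.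
            q holomorphic_on (h1 ` (D \<inter> D1)) \<and>
            q ` (h1 ` (D \<inter> D1)) \<subseteq> h ` D \<and>
            (\<forall>z \<in> D \<inter> D1. h z = q (h1 z)) \<and>
            (\<forall>w \<in> h1 ` (D \<inter> D1). G1 w = G (q w))))"
proof -
  note U = assms(1) and F = assms(2,3) and ab = assms(4) and I = assms(5,6)
  let ?I = "real_interval a b"
  have opU: "open U" and conU: "connected U" using U by (auto simp: complex_domain_def)
  obtain D h G where D: "complex_domain D" "D \<Subset> U" "?I \<subseteq> D" "h ` ?I \<subseteq> sphere 0 1"
    "injective_factorization F D h G" "G vec_holomorphic_on (h ` D)"
  proof (cases "a < b")
    case True
    then show thesis using factorization_on_interval[OF U F True I] that by metis
  next
    case False
    then have Ia: "?I = {of_real a}" using ab by (simp add: real_interval_def)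
    then have "of_real a \<in> U" using I(1) by simp
    from factorization_at_point[OF U F this] obtain D h G where
      "complex_domain D" "D \<Subset> U" "of_real a \<in> D" "h (of_real a) = 1"
      "injective_factorization F D h G" "G vec_holomorphic_on (h ` D)" .
    then show thesis by (intro that[of D h G]) (simp_all add: Ia)
  qed
  have DU: "D \<subseteq> U" using D(2) closure_subset by (auto simp: relatively_compact_in_def)
  have D': "open D" "connected D" "D \<noteq> {}" using D(1) by (auto simp: complex_domain_def)
  obtain j where "nowhere_locally_constant_on (\<lambda>z. F z $ j) U"
    using nonconstant_component[OF U F] .
  then have nlc: "nowhere_locally_constant_on F D"
    using DU unfolding nowhere_locally_constant_on_def constant_on_def by (metis order_trans)
  have h: "h holomorphic_on D" "\<forall>z\<in>D. F z = G (h z)" "inj_outside_finite G (h ` D)"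
    using D(5) by (auto simp: injective_factorization_def)
  have "\<not> F constant_on D" using nlc D' unfolding nowhere_locally_constant_on_def by blast
  moreover have "F constant_on D" if hc: "h constant_on D"
  proof -
    obtain c where "\<forall>z\<in>D. h z = c" using hc by (auto simp: constant_on_def)
    then have "\<forall>z\<in>D. F z = G c" using h(2) by simp
    then show ?thesis unfolding constant_on_def by blast
  qed
  moreover have "F constant_on D" if "G constant_on (h ` D)"
    using that h(2) by (simp add: constant_on_def)
  ultimately have nc: "\<not> h constant_on D" "\<not> G constant_on (h ` D)" by blast+
  have univ: "\<exists>q. q holomorphic_on (h1 ` (D \<inter> D1)) \<and> q ` (h1 ` (D \<inter> D1)) \<subseteq> h ` D \<and>
      (\<forall>z \<in> D \<inter> D1. h z = q (h1 z)) \<and> (\<forall>w \<in> h1 ` (D \<inter> D1). G1 w = G (q w))"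
    if D1: "complex_domain D1" "h1 holomorphic_on D1" "\<forall>z\<in>D1. F z = G1 (h1 z)" for D1 h1 G1
  proof -
    have "open D1" "\<And>z. z \<in> D1 \<Longrightarrow> F z = G1 (h1 z)" using D1 by (auto simp: complex_domain_def)
    from injective_factorization_universal[OF D' nlc D(5) this(1) D1(2) this(2)]
    show ?thesis by metis
  qed
  show ?thesis
    by (rule exI[of _ D], rule exI[of _ h], rule exI[of _ G], intro conjI allI impI D h nc,
        elim conjE, rule univ; assumption)
qed

end
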